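(* Assume: (i) There is $C<\infty$ with $P_0\{L_1(Q)-L_1(Q_0)\}^2\le C\,d_{01}(Q,Q_0)$ for all $Q\in Q(\mathcal M)$ and $P_0\{L_2(G)-L_2(G_0)\}^2\le C\,d_{02}(G,G_0)$ for all $G\in G(\mathcal M)$. (ii) $L_1(Q)$, $L_2(G)$, $D^*(Q,G)$ are elements of $D_d[0,\tau]$ with sectional variation norms bounded uniformly over $Q\in Q(\mathcal M)$, $G\in G(\mathcal M)$. Let $Q_n$, $G_n$ be HAL-MLEs of $Q_0,G_0$, satisfying $P_nL_1(Q_n)\le P_nL_1(Q_0)$ and $P_nL_2(G_n)\le P_nL_2(G_0)$, let $Q_n^{\#},G_n^{\#}$ be the bootstrapped HAL-MLEs, and define $d_{n1}(Q,Q_n)=P_n\{L_1(Q)-L_1(Q_n)\}$ and $d_{n2}(G,G_n)=P_n\{L_2(G)-L_2(G_n)\}$. Then $$d_{n1}(Q_n^{\#},Q_n)=O_P(n^{-1/2-\alpha/4}),\qquad d_{n2}(G_n^{\#},G_n)=O_P(n^{-1/2-\alpha/4}),$$ and $$d_{01}(Q_n^{\#},Q_0)=O_P(n^{-1/2-\alpha/4}),\qquad d_{02}(G_n^{\#},G_0)=O_P(n^{-1/2-\alpha/4}).$$ Moreover, for a model with the extra structure described in the context, the result also holds when the bounds $C^u=(C_Q^u,C_G^u)$ in the definition of the HAL-MLEs $(Q_n,G_n)$ are replaced by a data-adaptive choice $C_n^u=(C_{Qn}^u,C_{Gn}^u)$ (a function of $P_n$, held fixed under the bootstrap distribution) satisfying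 $$P_0\big(\|Q_0\|_v^*\le C_{Qn}^u\le C_Q^u,\ \|G_0\|_v^*\le C_{Gn}^u\le C_G^u\big)\to1\quad\text{as }n\to\infty,$$ with inequalities and norms understood componentwise.
   Context: Notation: $Pf=\int f\,dP$. $O_1,\dots,O_n$ are i.i.d. with distribution $P_0\in\mathcal M$, taking values in a cube $[0,\tau]\subset\mathbb R^d_{\ge0}$; $P_n$ is their empirical measure. $O_1^{\#},\dots,O_n^{\#}$ are, given $P_n$, $n$ i.i.d. draws from $P_n$, with empirical measure $P_n^{\#}$. $D_d[0,\tau]$ is the space of $d$-variate real-valued cadlag functions on $[0,\tau]$. For $F\in D_d[0,\tau]$ and $s\subset\{1,\dots,d\}$, the section $F_s(x_s)=F(x_s,0_{-s})$ sets coordinates outside $s$ to $0$. The sectional variation norm is $\|F\|_v^*=|F(0)|+\sum_s\int_{(0_s,\tau_s]}|dF_s(u_s)|$ (sum over nonempty $s$). Parameters: $\Psi:\mathcal M\to\mathbb R$ is a pathwise differentiable target parameter with canonical gradient $D^*(P)$. $Q:\mathcal M\to Q(\mathcal M)$, $G:\mathcal M\to G(\mathcal M)$ are function-valued parameters with $\Psi(P)=\Psi(Q(P))$, $D^*(P)=D^*(Q(P),G(P))$. $Q_0=Q(P_0)$, $G_0=G(P_0)$. $L_1(Q),L_2(G)$ are uniformly bounded losses with $Q_0=\arg\min_{Q\in Q(\mathcal M)}P_0L_1(Q)$, $G_0=\arg\min_{G\in G(\mathcal M)}P_0L_2(G)$; $d_{01}(Q,Q_0)=P_0L_1(Q)-P_0L_1(Q_0)$,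 $d_{02}(G,G_0)=P_0L_2(G)-P_0L_2(G_0)$. HAL-MLEs are estimators $Q_n\in Q(\mathcal M)$, $G_n\in G(\mathcal M)$ with the stated empirical risk inequalities (holding with probability tending to 1), e.g. minimizers of $P_nL_1$ over $Q(\mathcal M)$ and $P_nL_2$ over $G(\mathcal M)$. Bootstrapped HAL-MLEs are estimators $Q_n^{\#}\in Q(\mathcal M)$, $G_n^{\#}\in G(\mathcal M)$ based on $P_n^{\#}$ with, with probability tending to 1 conditional on $P_n$, $P_n^{\#}L_1(Q_n^{\#})\le P_n^{\#}L_1(Q_n)$ and $P_n^{\#}L_2(G_n^{\#})\le P_n^{\#}L_2(G_n)$. $\alpha\in(0,1)$ is such that $\sup_\Lambda\log^{1/2}N(\epsilon,\mathcal F,L^2(\Lambda))=O(\epsilon^{-(1-\alpha)})$, where $\mathcal F$ is the union of $\{L_1(Q)\}$, $\{L_2(G)\}$, $\{D^*(Q,G)\}$ over $Q\in Q(\mathcal M),G\in G(\mathcal M)$, $N$ is the covering number, and the supremum is over probability measures $\Lambda$. Extra model structure: $Q=(Q_1,\dots,Q_{K_1})$, $G=(G_1,\dots,G_{K_2})$ have variation independent components, $L_1,L_2$ are sums of component losses, and each component is a multivariate cadlag function on a cube with parameter space $\{F: C^l\le\|F\|_v^*\le C^u,\ dF_s(u_s)=I_{(s,u_s)\in A}dF_s(u_s)\ \forall s\}$ for a component-specific set $A$ of pairs $(s,u_s)$ and bounds $C^l<C^u$ (if $A$ excludes $\{0\}$ then $F(0)=0$), or the same with in addition $dF_s\ge0$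 for all $s$ and $F(0)\ge0$ (then $C^l=C^u$ is also allowed). $C_Q^u,C_G^u$ are the vectors of upper bounds. Then the HAL-MLEs with bounds $C^u$ minimize the empirical risks over elements of $Q(\mathcal M)$, $G(\mathcal M)$ whose component norms are at most the respective entries of $C_Q^u$, $C_G^u$, and the bootstrapped HAL-MLEs are $Q_n^{\#}=\arg\min_{Q\in Q(\mathcal M),\,Q\ll Q_n,\,\|Q\|_v^*\le\|Q_n\|_v^*}P_n^{\#}L_1(Q)$ and $G_n^{\#}=\arg\min_{G\in G(\mathcal M),\,G\ll G_n,\,\|G\|_v^*\le\|G_n\|_v^*}P_n^{\#}L_2(G)$, where $Q\ll Q_n$ means that, for each component $k$ and each subset $s$, the measure generated by the section $Q_{k,s}$ is absolutely continuous w.r.t. that generated by $Q_{n,k,s}$ (similarly for $G$), and norm inequalities are componentwise. *)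

theory Defs
  imports "HOL-Probability.Probability"
begin

section \<open>Cadlag functions on a cube and the sectional variation norm\<close>

definition cubeM :: "real^'d::finite \<Rightarrow> (real^'d) measure" where
  "cubeM \<tau> = restrict_space borel (cbox 0 \<tau>)"

text \<open>Multivariate cadlag in the sense of Neuhaus: limits exist along each of the quadrants
  (chosen by the set \<open>R\<close> of coordinates approached from the right), and the function is
  continuous from the upper right. Limits along a quadrant not accumulating at \<open>x\<close> are vacuous.\<close>

definition cadlag_on :: "real^'d::finite \<Rightarrow> (real^'d \<Rightarrow> real) \<Rightarrow> bool" where
  "cadlag_on \<tau> f \<longleftrightarrow> (\<forall>x\<in>cbox 0 \<tau>.
     (\<forall>R. \<exists>l. (f \<longlongrightarrow> l)
        (at x within {y\<in>cbox 0 \<tau>. \<forall>i. if i \<in> R then x $ i \<le> y $ i else y $ i < x $ i})) \<and>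
     (f \<longlongrightarrow> f x) (at x within {y\<in>cbox 0 \<tau>. \<forall>i. x $ i \<le> y $ i}))"

definition coord_section :: "'d::finite set \<Rightarrow> (real^'d \<Rightarrow> real) \<Rightarrow> real^'d \<Rightarrow> real" where
  "coord_section s F x = F (\<chi> i. if i \<in> s then x $ i else 0)"

text \<open>The set \<open>(0\<^sub>s, \<tau>\<^sub>s]\<close>, embedded in the cube by putting the coordinates outside \<open>s\<close> to 0.
  A coordinate with \<open>\<tau> $ i = 0\<close> makes the faces with \<open>i \<in> s\<close> empty, so a
  function of fewer than \<open>CARD('d)\<close> variables is a function on such a degenerate cube.\<close>

definition face :: "real^'d::finite \<Rightarrow> 'd set \<Rightarrow> (real^'d) set" where
  "face \<tau> s = {u\<in>cbox 0 \<tau>. \<forall>i. (i \<in> s \<longrightarrow> 0 < u $ i) \<and> (i \<notin> s \<longrightarrow> u $ i = 0)}"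

definition cell :: "real^'d::finite \<Rightarrow> 'd set \<Rightarrow> real^'d \<Rightarrow> real^'d \<Rightarrow> (real^'d) set" where
  "cell \<tau> s a b = {u\<in>face \<tau> s. \<forall>i\<in>s. a $ i < u $ i \<and> u $ i \<le> b $ i}"

definition increment :: "'d::finite set \<Rightarrow> (real^'d \<Rightarrow> real) \<Rightarrow> real^'d \<Rightarrow> real^'d \<Rightarrow> real" where
  "increment s F a b =
     (\<Sum>t\<in>Pow s. (- 1) ^ card (s - t) * coord_section s F (\<chi> i. if i \<in> t then b $ i else a $ i))"

text \<open>\<open>(p, n)\<close> is the Jordan decomposition of the finite signed measure \<open>dF\<^sub>s\<close> on \<open>(0\<^sub>s, \<tau>\<^sub>s]\<close>
  generated by the section \<open>F\<^sub>s\<close>. For \<open>s = {}\<close> this is the point mass \<open>F 0\<close> at \<open>0\<close>.\<close>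

definition jordan_parts ::
  "real^'d::finite \<Rightarrow> 'd set \<Rightarrow> (real^'d \<Rightarrow> real) \<Rightarrow> (real^'d) measure \<Rightarrow> (real^'d) measure \<Rightarrow> bool"
where
  "jordan_parts \<tau> s F p n \<longleftrightarrow>
     finite_measure p \<and> finite_measure n \<and>
     sets p = sets (restrict_space borel (face \<tau> s)) \<and>
     sets n = sets (restrict_space borel (face \<tau> s)) \<and>
     (\<exists>D\<in>sets p. emeasure p D = 0 \<and> emeasure n (face \<tau> s - D) = 0) \<and>
     (\<forall>a\<in>cbox 0 \<tau>. \<forall>b\<in>cbox 0 \<tau>. (\<forall>i. a $ i \<le> b $ i) \<longrightarrow>
        increment s F a b = measure p (cell \<tau> s a b) - measure n (cell \<tau> s a b))"

definition pos_part :: "real^'d::finite \<Rightarrow> 'd set \<Rightarrow> (real^'d \<Rightarrow> real) \<Rightarrow> (real^'d) measure" where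
  "pos_part \<tau> s F = (THE p. \<exists>n. jordan_parts \<tau> s F p n)"

definition neg_part :: "real^'d::finite \<Rightarrow> 'd set \<Rightarrow> (real^'d \<Rightarrow> real) \<Rightarrow> (real^'d) measure" where
  "neg_part \<tau> s F = (THE n. \<exists>p. jordan_parts \<tau> s F p n)"

text \<open>The total variation measure \<open>|dF\<^sub>s|\<close>; meaningful only if \<open>F\<^sub>s\<close> generates a finite
  signed measure.\<close>

definition var_measure :: "real^'d::finite \<Rightarrow> 'd set \<Rightarrow> (real^'d \<Rightarrow> real) \<Rightarrow> (real^'d) measure" where
  "var_measure \<tau> s F = measure_of (face \<tau> s) (sets (restrict_space borel (face \<tau> s)))
     (\<lambda>B. emeasure (pos_part \<tau> s F) B + emeasure (neg_part \<tau> s F) B)"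

definition sv_norm :: "real^'d::finite \<Rightarrow> (real^'d \<Rightarrow> real) \<Rightarrow> ennreal" where
  "sv_norm \<tau> F = ennreal \<bar>F 0\<bar> +
     (\<Sum>s\<in>{s. s \<noteq> {}}. if \<exists>p n. jordan_parts \<tau> s F p n
        then emeasure (var_measure \<tau> s F) (face \<tau> s) else \<infinity>)"


section \<open>Uniform entropy\<close>

definition L2_norm :: "'a measure \<Rightarrow> ('a \<Rightarrow> real) \<Rightarrow> real" where
  "L2_norm \<Lambda> f = sqrt (\<integral>x. (f x)\<^sup>2 \<partial>\<Lambda>)"

definition square_integrable :: "'a measure \<Rightarrow> ('a \<Rightarrow> real) \<Rightarrow> bool" where
  "square_integrable \<Lambda> f \<longleftrightarrow> f \<in> borel_measurable \<Lambda> \<and> integrable \<Lambda> (\<lambda>x. (f x)\<^sup>2)"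

definition covering_number :: "real \<Rightarrow> ('a \<Rightarrow> real) set \<Rightarrow> 'a measure \<Rightarrow> enat" where
  "covering_number \<epsilon> \<F> \<Lambda> = Inf {enat (card C) | C. finite C \<and>
     (\<forall>g\<in>C. square_integrable \<Lambda> g) \<and> (\<forall>f\<in>\<F>. \<exists>g\<in>C. L2_norm \<Lambda> (\<lambda>x. f x - g x) < \<epsilon>)}"

definition sqrt_log :: "enat \<Rightarrow> ennreal" where
  "sqrt_log N = (case N of enat m \<Rightarrow> ennreal (sqrt (ln (real m))) | \<infinity> \<Rightarrow> \<infinity>)"

definition unif_entropy :: "'a measure \<Rightarrow> ('a \<Rightarrow> real) set \<Rightarrow> real \<Rightarrow> ennreal" where
  "unif_entropy S \<F> \<epsilon> =
     (SUP \<Lambda>\<in>{\<Lambda>. prob_space \<Lambda> \<and> sets \<Lambda> = sets S}. sqrt_log (covering_number \<epsilon> \<F> \<Lambda>))"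


section \<open>Pathwise differentiability\<close>

text \<open>\<open>h\<close> is the score at \<open>t = 0\<close> of the one-dimensional submodel \<open>\<gamma>\<close> through \<open>P\<close>, in the
  sense of differentiability in quadratic mean. The condition does not depend on the choice of
  the measures \<open>\<mu> t\<close> dominating both \<open>\<gamma> t\<close> and \<open>P\<close>.\<close>

definition is_score :: "'a measure \<Rightarrow> (real \<Rightarrow> 'a measure) \<Rightarrow> ('a \<Rightarrow> real) \<Rightarrow> bool" where
  "is_score P \<gamma> h \<longleftrightarrow> \<gamma> 0 = P \<and> square_integrable P h \<and>
     (\<exists>\<mu> p q.
        (\<forall>\<^sub>F t in at 0. sets (\<mu> t) = sets P \<and>
           p t \<in> borel_measurable P \<and> q t \<in> borel_measurable P \<and>
           (\<forall>x\<in>space P. 0 \<le> p t x \<and> 0 \<le> q t x) \<and>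
           \<gamma> t = density (\<mu> t) (\<lambda>x. ennreal (p t x)) \<and> P = density (\<mu> t) (\<lambda>x. ennreal (q t x))) \<and>
        ((\<lambda>t. \<integral>\<^sup>+x. ennreal (((sqrt (p t x) - sqrt (q t x)) / t - h x * sqrt (q t x) / 2)\<^sup>2) \<partial>\<mu> t)
           \<longlongrightarrow> 0) (at 0))"

text \<open>\<open>\<Gamma> P\<close> is the chosen class of submodels through \<open>P\<close>. The canonical gradient is the gradient
  that lies in the tangent space, i.e. the \<open>L\<^sup>2(P)\<close>-closure of the linear span of the scores.\<close>

definition canonical_gradient ::
  "'a measure set \<Rightarrow> ('a measure \<Rightarrow> (real \<Rightarrow> 'a measure) set) \<Rightarrow> ('a measure \<Rightarrow> real) \<Rightarrow>
   ('a measure \<Rightarrow> 'a \<Rightarrow> real) \<Rightarrow> bool"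
where
  "canonical_gradient \<M> \<Gamma> \<Psi> D \<longleftrightarrow> (\<forall>P\<in>\<M>.
     square_integrable P (D P) \<and>
     (\<forall>\<gamma>\<in>\<Gamma> P. (\<forall>\<^sub>F t in at 0. \<gamma> t \<in> \<M>) \<and> (\<exists>h. is_score P \<gamma> h)) \<and>
     (\<forall>\<gamma>\<in>\<Gamma> P. \<forall>h. is_score P \<gamma> h \<longrightarrow>
        ((\<lambda>t. \<Psi> (\<gamma> t)) has_real_derivative (\<integral>x. D P x * h x \<partial>P)) (at 0)) \<and>
     (\<forall>\<epsilon>>0. \<exists>H c. finite H \<and> H \<subseteq> {h. \<exists>\<gamma>\<in>\<Gamma> P. is_score P \<gamma> h} \<and>
        L2_norm P (\<lambda>x. D P x - (\<Sum>h\<in>H. c h * h x)) < \<epsilon>))"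


section \<open>Empirical measures, bootstrap and stochastic order\<close>

definition emp :: "'a measure \<Rightarrow> nat \<Rightarrow> (nat \<Rightarrow> 'a) \<Rightarrow> 'a measure" where
  "emp S n x = distr (uniform_count_measure {..<n}) S x"

definition boot_law :: "nat \<Rightarrow> 'a measure \<Rightarrow> (nat \<Rightarrow> 'a) measure" where
  "boot_law n P = PiM {..<n} (\<lambda>_. P)"

text \<open>Given \<open>X 0, \<dots>, X (n - 1)\<close>, the variables \<open>Xs n 0, \<dots>, Xs n (n - 1)\<close> are i.i.d. draws
  from the empirical measure.\<close>

definition bootstrap_sample ::
  "'w measure \<Rightarrow> 'a measure \<Rightarrow> (nat \<Rightarrow> 'w \<Rightarrow> 'a) \<Rightarrow> (nat \<Rightarrow> nat \<Rightarrow> 'w \<Rightarrow> 'a) \<Rightarrow> bool"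
where
  "bootstrap_sample \<Omega> S X Xs \<longleftrightarrow> (\<forall>n>0.
     (\<forall>i<n. Xs n i \<in> measurable \<Omega> S) \<and>
     (\<forall>A\<in>sets (PiM {..<n} (\<lambda>_. S)). \<forall>B\<in>sets (PiM {..<n} (\<lambda>_. S)).
        measure \<Omega> {\<omega>\<in>space \<Omega>. (\<lambda>i\<in>{..<n}. X i \<omega>) \<in> A \<and> (\<lambda>i\<in>{..<n}. Xs n i \<omega>) \<in> B} =
        (\<integral>\<omega>. indicator A (\<lambda>i\<in>{..<n}. X i \<omega>) *
              measure (boot_law n (emp S n (\<lambda>i. X i \<omega>))) B \<partial>\<Omega>)))"

text \<open>Inner probability is used for hypotheses and outer probability in \<open>O\<^sub>P\<close>, so that nothing
  depends on the value 0 that \<^const>\<open>measure\<close> assigns to non-measurable sets.\<close>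

definition wp_to_1 :: "'w measure \<Rightarrow> (nat \<Rightarrow> 'w \<Rightarrow> bool) \<Rightarrow> bool" where
  "wp_to_1 \<Omega> E \<longleftrightarrow> (\<exists>A. (\<forall>n. A n \<in> sets \<Omega> \<and> A n \<subseteq> {\<omega>\<in>space \<Omega>. E n \<omega>}) \<and>
     (\<lambda>n. measure \<Omega> (A n)) \<longlonglongrightarrow> 1)"

text \<open>The probability of \<open>E n P\<^sub>n P\<^sub>n\<^sup>#\<close>, conditional on \<open>P\<^sub>n\<close>, tends to 1 in probability.\<close>

definition boot_wp_to_1 ::
  "'w measure \<Rightarrow> 'a measure \<Rightarrow> (nat \<Rightarrow> 'w \<Rightarrow> 'a measure) \<Rightarrow>
   (nat \<Rightarrow> 'a measure \<Rightarrow> 'a measure \<Rightarrow> bool) \<Rightarrow> bool"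
where
  "boot_wp_to_1 \<Omega> S Pn E \<longleftrightarrow> (\<forall>\<epsilon>>0. wp_to_1 \<Omega> (\<lambda>n \<omega>.
     \<exists>B\<in>sets (boot_law n (Pn n \<omega>)). B \<subseteq> {y. E n (Pn n \<omega>) (emp S n y)} \<and>
        measure (boot_law n (Pn n \<omega>)) B > 1 - \<epsilon>))"

definition big_OP :: "'w measure \<Rightarrow> (nat \<Rightarrow> 'w \<Rightarrow> real) \<Rightarrow> (nat \<Rightarrow> real) \<Rightarrow> bool" where
  "big_OP \<Omega> Z r \<longleftrightarrow> (\<forall>\<epsilon>>0. \<exists>K>0. \<forall>\<^sub>F n in sequentially.
     \<exists>A\<in>sets \<Omega>. {\<omega>\<in>space \<Omega>. \<bar>Z n \<omega>\<bar> > K * r n} \<subseteq> A \<and> measure \<Omega> A < \<epsilon>)"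


section \<open>Estimators\<close>

text \<open>An estimator is a function of the empirical measure such that its loss at each point is a
  random variable; the bootstrapped estimator may depend on both \<open>P\<^sub>n\<close> and \<open>P\<^sub>n\<^sup>#\<close>.\<close>

definition is_estimator ::
  "'a measure \<Rightarrow> 'q set \<Rightarrow> ('q \<Rightarrow> 'a \<Rightarrow> real) \<Rightarrow> (nat \<Rightarrow> 'a measure \<Rightarrow> 'q) \<Rightarrow> bool"
where
  "is_estimator S \<Q> L Qn \<longleftrightarrow> (\<forall>n>0.
     (\<forall>x\<in>space (PiM {..<n} (\<lambda>_. S)). Qn n (emp S n x) \<in> \<Q>) \<and>
     (\<forall>z\<in>space S. (\<lambda>x. L (Qn n (emp S n x)) z) \<in> borel_measurable (PiM {..<n} (\<lambda>_. S))))"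

definition is_boot_estimator ::
  "'a measure \<Rightarrow> 'q set \<Rightarrow> ('q \<Rightarrow> 'a \<Rightarrow> real) \<Rightarrow> (nat \<Rightarrow> 'a measure \<Rightarrow> 'a measure \<Rightarrow> 'q) \<Rightarrow> bool"
where
  "is_boot_estimator S \<Q> L Qs \<longleftrightarrow> (\<forall>n>0.
     (\<forall>x\<in>space (PiM {..<n} (\<lambda>_. S)). \<forall>y\<in>space (PiM {..<n} (\<lambda>_. S)).
        Qs n (emp S n x) (emp S n y) \<in> \<Q>) \<and>
     (\<forall>z\<in>space S. (\<lambda>(x, y). L (Qs n (emp S n x) (emp S n y)) z)
        \<in> borel_measurable (PiM {..<n} (\<lambda>_. S) \<Otimes>\<^sub>M PiM {..<n} (\<lambda>_. S))))"


section \<open>Models whose components are cadlag functions of bounded sectional variation\<close>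

text \<open>A pair \<open>(s, u\<^sub>s)\<close> in \<open>A\<close> is given with \<open>u\<^sub>s\<close> embedded in \<^term>\<open>face \<tau> s\<close>; the element \<open>{0}\<close>
  is the pair \<open>({}, 0)\<close>. Functions on the cube are extensional.\<close>

definition component_space ::
  "real^'e::finite \<Rightarrow> ('e set \<times> (real^'e)) set \<Rightarrow> bool \<Rightarrow> ennreal \<Rightarrow> ennreal \<Rightarrow> (real^'e \<Rightarrow> real) set"
where
  "component_space \<tau> A nonneg Cl Cu = {F \<in> extensional (cbox 0 \<tau>).
     cadlag_on \<tau> F \<and> Cl \<le> sv_norm \<tau> F \<and> sv_norm \<tau> F \<le> Cu \<and>
     (\<forall>s. AE u in var_measure \<tau> s F. (s, u) \<in> A) \<and>
     (({}, 0) \<notin> A \<longrightarrow> F 0 = 0) \<and>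
     (nonneg \<longrightarrow> (\<forall>s. emeasure (neg_part \<tau> s F) (face \<tau> s) = 0) \<and> 0 \<le> F 0)}"

text \<open>\<open>comps\<close> lists the components of a parameter value. Its range being a full product is the
  variation independence of the components.\<close>

definition structured_parameter ::
  "'a set \<Rightarrow> 'q set \<Rightarrow> ('q \<Rightarrow> 'a \<Rightarrow> real) \<Rightarrow> ('q \<Rightarrow> 'k::finite \<Rightarrow> real^'e::finite \<Rightarrow> real) \<Rightarrow>
   ('k \<Rightarrow> real^'e) \<Rightarrow> ('k \<Rightarrow> ('e set \<times> (real^'e)) set) \<Rightarrow> ('k \<Rightarrow> bool) \<Rightarrow>
   ('k \<Rightarrow> ennreal) \<Rightarrow> ('k \<Rightarrow> ennreal) \<Rightarrow> bool"
where
  "structured_parameter Z \<Q> L comps \<tau> A nonneg Cl Cu \<longleftrightarrow>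
     (\<forall>k i. 0 \<le> \<tau> k $ i) \<and>
     (\<forall>k. Cu k < \<infinity> \<and> (Cl k < Cu k \<or> nonneg k \<and> Cl k = Cu k)) \<and>
     bij_betw comps \<Q> {F. \<forall>k. F k \<in> component_space (\<tau> k) (A k) (nonneg k) (Cl k) (Cu k)} \<and>
     (\<exists>l. \<forall>q\<in>\<Q>. \<forall>z\<in>Z. L q z = (\<Sum>k\<in>UNIV. l k (comps q k) z))"

definition comp_norm ::
  "('q \<Rightarrow> 'k \<Rightarrow> real^'e::finite \<Rightarrow> real) \<Rightarrow> ('k \<Rightarrow> real^'e) \<Rightarrow> 'q \<Rightarrow> 'k \<Rightarrow> ennreal"
where
  "comp_norm comps \<tau> q k = sv_norm (\<tau> k) (comps q k)"

definition comp_abs_cont ::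
  "('q \<Rightarrow> 'k \<Rightarrow> real^'e::finite \<Rightarrow> real) \<Rightarrow> ('k \<Rightarrow> real^'e) \<Rightarrow> 'q \<Rightarrow> 'q \<Rightarrow> bool"
where
  "comp_abs_cont comps \<tau> q q' \<longleftrightarrow>
     (\<forall>k s. absolutely_continuous (var_measure (\<tau> k) s (comps q' k)) (var_measure (\<tau> k) s (comps q k)))"

text \<open>Vectors of bounds are compared pointwise, by the order on functions.\<close>

definition bounded_mle ::
  "'q set \<Rightarrow> ('q \<Rightarrow> 'a \<Rightarrow> real) \<Rightarrow> ('q \<Rightarrow> 'k \<Rightarrow> real^'e::finite \<Rightarrow> real) \<Rightarrow> ('k \<Rightarrow> real^'e) \<Rightarrow>
   'a measure \<Rightarrow> ('k \<Rightarrow> ennreal) \<Rightarrow> 'q \<Rightarrow> bool"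
where
  "bounded_mle \<Q> L comps \<tau> P C q \<longleftrightarrow>
     is_arg_min (\<lambda>q'. \<integral>z. L q' z \<partial>P) (\<lambda>q'. q' \<in> \<Q> \<and> comp_norm comps \<tau> q' \<le> C) q"

definition bounded_boot_mle ::
  "'q set \<Rightarrow> ('q \<Rightarrow> 'a \<Rightarrow> real) \<Rightarrow> ('q \<Rightarrow> 'k \<Rightarrow> real^'e::finite \<Rightarrow> real) \<Rightarrow> ('k \<Rightarrow> real^'e) \<Rightarrow>
   'a measure \<Rightarrow> 'q \<Rightarrow> 'q \<Rightarrow> bool"
where
  "bounded_boot_mle \<Q> L comps \<tau> Ps q qs \<longleftrightarrow>
     is_arg_min (\<lambda>q'. \<integral>z. L q' z \<partial>Ps)
       (\<lambda>q'. q' \<in> \<Q> \<and> comp_abs_cont comps \<tau> q' q \<and> comp_norm comps \<tau> q' \<le> comp_norm comps \<tau> q) qs"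

end

theory Submission
  imports Defs
begin

text \<open>The two basic inequalities bound the excess risk of \<open>Q\<^sub>n\<^sup>#\<close> by
  \<open>|(P\<^sub>n - P\<^sub>0) f\<^sub>n\<^sup>#| + |(P\<^sub>n\<^sup># - P\<^sub>n) f\<^sub>n\<^sup>#| + |(P\<^sub>n\<^sup># - P\<^sub>n) f\<^sub>n|\<close>, where \<open>f\<^sub>n\<close> and
  \<open>f\<^sub>n\<^sup>#\<close> are the loss differences of \<open>Q\<^sub>n\<close> and \<open>Q\<^sub>n\<^sup>#\<close> with respect to \<open>Q\<^sub>0\<close>. Since the class has a
  finite entropy integral, each term is \<open>O\<^sub>P(n powr (-1/2))\<close>; by the quadratic bound the \<open>L\<^sup>2\<close>-norms of the
  loss differences are then \<open>O\<^sub>P(n powr (-1/4))\<close>, and the modulus of continuity \<open>\<delta> powr \<alpha> / sqrt n\<close>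
  of the empirical processes gives the rate. No supremum over the class is ever formed:
  the estimators are jointly measurable selections because cadlag functions are limits of
  discretizations, and for a selection the symmetrization with a ghost sample leads to a finite
  average over signs that chaining bounds pointwise, with respect to the empirical measure of the
  double sample.\<close>

section \<open>Rademacher averages and chaining\<close>

text \<open>The function selected by the bootstrapped estimator depends on the data and on the
  bootstrap sample, so neither empirical process is evaluated at an independent function. Two
  different conditionings deal with this. Given the data, \<open>P_n\<close> takes the place of the
  sampling distribution; the entropy bound is uniform over all finite point configurations, so its
  constants do not depend on the data. For \<open>P_n - P_0\<close> the resampled indices are held
  fixed instead: the bootstrap sample, and with it the selected function, is then a function of the
  i.i.d. data alone. Localization involves two second moments, the one under the sampling
  distribution, which controls the ghost sample, and the empirical one, which controls the other
  half of the double sample. The quadratic bound supplies only the moment under \<open>P_0\<close>;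
  the moments under \<open>P_n\<close> and \<open>P_n^#\<close> are recovered by applying the crude
  rate to the squares of the loss differences. The power \<open>\<delta> powr \<alpha>\<close> is
  the sum over dyadic scales of radius times root entropy,
  \<open>(\<delta> / 2 ^ j) powr \<alpha>\<close>.\<close>

definition signs :: "nat \<Rightarrow> (nat \<Rightarrow> real) set" where
  "signs n = PiE {..<n} (\<lambda>_. {- 1, 1})"

text \<open>A plain finite average instead of an expectation: the integrand may depend on the sign
  vector in any way, with no measurability to be checked.\<close>

definition sign_avg :: "nat \<Rightarrow> ((nat \<Rightarrow> real) \<Rightarrow> real) \<Rightarrow> real" where
  "sign_avg n h = (\<Sum>e\<in>signs n. h e) / 2 ^ n"

lemma finite_signs [simp]: "finite (signs n)"
  unfolding signs_def by (intro finite_PiE) auto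

lemma card_signs [simp]: "card (signs n) = 2 ^ n"
  unfolding signs_def by (subst card_PiE) (auto simp: numeral_2_eq_2)

lemma sign_avg_mono: "(\<And>e. e \<in> signs n \<Longrightarrow> h e \<le> k e) \<Longrightarrow> sign_avg n h \<le> sign_avg n k"
  unfolding sign_avg_def by (intro divide_right_mono sum_mono) auto

lemma sign_avg_add: "sign_avg n (\<lambda>e. h e + k e) = sign_avg n h + sign_avg n k"
  unfolding sign_avg_def by (simp add: sum.distrib add_divide_distrib)

lemma sign_avg_sum: "sign_avg n (\<lambda>e. \<Sum>i\<in>I. h i e) = (\<Sum>i\<in>I. sign_avg n (h i))"
  unfolding sign_avg_def by (subst sum.swap) (simp add: sum_divide_distrib)

lemma sign_avg_const [simp]: "sign_avg n (\<lambda>_. c) = c"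
  unfolding sign_avg_def by simp

section \<open>Sub-Gaussian bounds for Rademacher sums\<close>

lemma cosh_le_exp_square: "cosh (x::real) \<le> exp (x\<^sup>2 / 2)"
proof -
  have *: "cosh x \<le> exp (x\<^sup>2 / 2)" if "x \<ge> 0" for x :: real
  proof -
    \<comment> \<open>Hoeffding's estimate for the two-point law with weight \<open>1/2\<close> and
      range \<open>2 * x\<close>; factoring \<open>exp x\<close> out of the moment generating
      function leaves \<open>cosh x\<close>.\<close>
    have "- (2 * x) * (1/2) + ln (1 + 1/2 * (exp (2 * x) - 1)) \<le> (2 * x)\<^sup>2 / 8"
      by (rule Hoeffdings_lemma_aux) (use that in auto)
    moreover have "1 + 1/2 * (exp (2 * x) - 1) = exp x * cosh x"
      by (simp add: cosh_field_def field_simps flip: exp_add)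
    ultimately have "ln (cosh x) \<le> x\<^sup>2 / 2"
      by (simp add: ln_mult cosh_real_pos power2_eq_square)
    then show ?thesis
      using cosh_real_pos[of x] by (simp add: ln_le_cancel_iff[symmetric] del: ln_le_cancel_iff)
  qed
  show ?thesis
    using *[of x] *[of "- x"] by (cases "x \<ge> 0") auto
qed

text \<open>Independence of the signs is the expansion of a product of sums over
  \<open>signs n\<close>; each coordinate contributes a factor \<open>cosh (a i)\<close>, which is
  at most the Gaussian one.\<close>

lemma rademacher_mgf:
  "sign_avg n (\<lambda>e. exp (\<Sum>i<n. e i * a i)) \<le> exp ((\<Sum>i<n. (a i)\<^sup>2) / 2)"
proof -
  have "(\<Sum>e\<in>signs n. exp (\<Sum>i<n. e i * a i)) = (\<Sum>e\<in>signs n. \<Prod>i<n. exp (e i * a i))"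
    by (simp add: exp_sum)
  also have "\<dots> = (\<Prod>i<n. \<Sum>s\<in>{- 1, 1}. exp (s * a i))"
    unfolding signs_def by (subst prod_sum_PiE) auto
  also have "\<dots> = (\<Prod>i<n. 2 * cosh (a i))"
    by (intro prod.cong) (auto simp: cosh_field_def)
  also have "\<dots> = 2 ^ n * (\<Prod>i<n. cosh (a i))"
    by (simp add: prod.distrib)
  finally have "sign_avg n (\<lambda>e. exp (\<Sum>i<n. e i * a i)) = (\<Prod>i<n. cosh (a i))"
    by (simp add: sign_avg_def)
  also have "\<dots> \<le> (\<Prod>i<n. exp ((a i)\<^sup>2 / 2))"
    by (intro prod_mono) (auto intro: cosh_le_exp_square)
  also have "\<dots> = exp ((\<Sum>i<n. (a i)\<^sup>2) / 2)"
    by (simp add: exp_sum sum_divide_distrib)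
  finally show ?thesis .
qed

text \<open>Jensen's inequality from the tangent of \<open>exp\<close> at the average:
  \<open>1 + x \<le> exp x\<close> for \<open>x = h e - sign_avg n h\<close>, averaged over the
  signs.\<close>

lemma exp_sign_avg_le: "exp (sign_avg n h) \<le> sign_avg n (\<lambda>e. exp (h e))"
proof -
  let ?m = "sign_avg n h"
  have "exp ?m = exp ?m * sign_avg n (\<lambda>e. 1 + (h e + - ?m))"
    unfolding sign_avg_add sign_avg_const by simp
  also have "\<dots> = sign_avg n (\<lambda>e. exp ?m * (1 + (h e + - ?m)))"
    by (simp add: sign_avg_def sum_distrib_left)
  also have "\<dots> \<le> sign_avg n (\<lambda>e. exp ?m * exp (h e + - ?m))"
    by (intro sign_avg_mono mult_left_mono) auto
  also have "\<dots> = sign_avg n (\<lambda>e. exp (h e))"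
    by (simp add: exp_diff)
  finally show ?thesis .
qed

text \<open>The vector \<open>v e\<close> may change with the signs, so its exponential is bounded
  by the sum over all of \<open>A\<close>, with both signs of the exponent because of the absolute
  value. This is the origin of \<open>2 * N\<close>.\<close>

lemma rademacher_maximal:
  fixes A :: "(nat \<Rightarrow> real) set"
  assumes A: "finite A" "real (card A) \<le> N" and s: "s \<ge> 0"
    and norm: "\<And>a. a \<in> A \<Longrightarrow> L2_set a {..<n} \<le> s"
    and sel: "\<And>e. e \<in> signs n \<Longrightarrow> v e \<in> A"
  shows "sign_avg n (\<lambda>e. \<bar>\<Sum>i<n. e i * v e i\<bar>) \<le> s * sqrt (2 * ln (2 * N))"
proof (cases "s = 0")
  case True
  have "v e i = 0" if "e \<in> signs n" "i < n" for e i
  proof -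
    have "L2_set (v e) {..<n} = 0"
      using norm[OF sel[OF that(1)]] True by (simp add: antisym)
    then show ?thesis using that(2) by (simp add: L2_set_eq_0_iff)
  qed
  then have "sign_avg n (\<lambda>e. \<bar>\<Sum>i<n. e i * v e i\<bar>) \<le> sign_avg n (\<lambda>_. 0)"
    by (intro sign_avg_mono) simp
  then show ?thesis using True by simp
next
  case False
  with s have s: "s > 0" by simp
  have "signs n \<noteq> {}" using card_signs[of n] by (metis card.empty power_not_zero zero_neq_numeral)
  then have "A \<noteq> {}" using sel by blast
  then have N: "N \<ge> 1" using A by (metis One_nat_def Suc_leI card_gt_0_iff dual_order.trans of_nat_1 of_nat_mono)
  \<comment> \<open>The minimizer of \<open>ln (2 * N) / l + l * s\<^sup>2 / 2\<close>; it exists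
    because \<open>s > 0\<close> and \<open>N \<ge> 1\<close>.\<close>
  define l where "l = sqrt (2 * ln (2 * N)) / s"
  have l: "l > 0" using N s by (simp add: l_def)
  let ?X = "\<lambda>a e. \<Sum>i<n. e i * a i"
  let ?m = "sign_avg n (\<lambda>e. \<bar>?X (v e) e\<bar>)"
  have mgf: "sign_avg n (\<lambda>e. exp (c * ?X a e)) \<le> exp (l\<^sup>2 * s\<^sup>2 / 2)" if "a \<in> A" "\<bar>c\<bar> = l" for a c
  proof -
    have "sign_avg n (\<lambda>e. exp (c * ?X a e)) = sign_avg n (\<lambda>e. exp (\<Sum>i<n. e i * (c * a i)))"
      by (simp add: sum_distrib_left mult_ac)
    also have "\<dots> \<le> exp ((\<Sum>i<n. (c * a i)\<^sup>2) / 2)"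
      by (rule rademacher_mgf)
    also have "(\<Sum>i<n. (c * a i)\<^sup>2) = l\<^sup>2 * (L2_set a {..<n})\<^sup>2"
      using that(2) by (auto simp: L2_set_def sum_nonneg power_mult_distrib sum_distrib_left)
    also have "\<dots> \<le> l\<^sup>2 * s\<^sup>2"
      using norm[OF that(1)] by (intro mult_left_mono power_mono) auto
    finally show ?thesis by simp
  qed
  have "exp (l * ?m) = exp (sign_avg n (\<lambda>e. l * \<bar>?X (v e) e\<bar>))"
    by (simp add: sign_avg_def sum_distrib_left)
  also have "\<dots> \<le> sign_avg n (\<lambda>e. exp (l * \<bar>?X (v e) e\<bar>))"
    by (rule exp_sign_avg_le)
  also have "\<dots> \<le> sign_avg n (\<lambda>e. \<Sum>a\<in>A. exp (l * ?X a e) + exp (- l * ?X a e))"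
  proof (rule sign_avg_mono)
    fix e assume "e \<in> signs n"
    then have "exp (l * ?X (v e) e) + exp (- l * ?X (v e) e) \<le> (\<Sum>a\<in>A. exp (l * ?X a e) + exp (- l * ?X a e))"
      using sel A(1) by (intro member_le_sum) (auto intro: add_nonneg_nonneg)
    moreover have "exp (l * \<bar>?X (v e) e\<bar>) \<le> exp (l * ?X (v e) e) + exp (- l * ?X (v e) e)"
      by (cases "?X (v e) e \<ge> 0") auto
    ultimately show "exp (l * \<bar>?X (v e) e\<bar>) \<le> (\<Sum>a\<in>A. exp (l * ?X a e) + exp (- l * ?X a e))"
      by linarith
  qed
  also have "\<dots> \<le> (\<Sum>a\<in>A. 2 * exp (l\<^sup>2 * s\<^sup>2 / 2))"
    unfolding sign_avg_sum sign_avg_add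
  proof (rule sum_mono)
    fix a assume "a \<in> A"
    then show "sign_avg n (\<lambda>e. exp (l * ?X a e)) + sign_avg n (\<lambda>e. exp (- l * ?X a e)) \<le> 2 * exp (l\<^sup>2 * s\<^sup>2 / 2)"
      using mgf[of a l] mgf[of a "- l"] l by linarith
  qed
  also have "\<dots> \<le> 2 * N * exp (l\<^sup>2 * s\<^sup>2 / 2)"
    using A(2) by simp
  also have "\<dots> = exp (ln (2 * N) + l\<^sup>2 * s\<^sup>2 / 2)"
    using N by (simp add: exp_add)
  finally have "l * ?m \<le> ln (2 * N) + l\<^sup>2 * s\<^sup>2 / 2" by simp
  also have "l\<^sup>2 * s\<^sup>2 = 2 * ln (2 * N)"
    using s N by (simp add: l_def power_divide)
  also have "ln (2 * N) + 2 * ln (2 * N) / 2 = l * (s * sqrt (2 * ln (2 * N)))"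
    using s N by (simp add: l_def)
  finally show ?thesis using l by simp
qed

section \<open>Chaining through dyadic covers\<close>

lemma L2_set_diff_triangle:
  "L2_set (\<lambda>i. f i - h i) A \<le> L2_set (\<lambda>i. f i - g i) A + L2_set (\<lambda>i. g i - h i) (A :: 'a set)"
  using L2_set_triangle_ineq[of "\<lambda>i. f i - g i" "\<lambda>i. g i - h i" A] by simp

lemma L2_set_diff_commute: "L2_set (\<lambda>i. f i - g i) A = L2_set (\<lambda>i. g i - f i) A"
  by (simp add: L2_set_def power2_commute)

text \<open>Each link of the chain costs \<open>6 * sqrt 2\<close> times its scale to the power
  \<open>\<alpha>\<close>; the denominator sums the geometric series of ratio
  \<open>2 powr (- \<alpha>)\<close> over the dyadic scales.\<close>

definition chaining_const :: "real \<Rightarrow> real" where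
  "chaining_const \<alpha> = 6 * sqrt 2 / (1 - 2 powr (- \<alpha>))"

lemma chaining_const_pos: "0 < \<alpha> \<Longrightarrow> 0 < chaining_const \<alpha>"
  unfolding chaining_const_def by (intro divide_pos_pos) (auto intro: powr_less_one)

text \<open>A link takes at most \<open>card (C (Suc j)) * card (C j)\<close> values, so the maximal
  inequality applies. Under the root the two logarithms split, and both are bounded by the entropy
  at the finer scale, whence the factor \<open>3 * sqrt 2 * 2\<close>. The exponent
  \<open>\<alpha>\<close> is radius times root entropy,
  \<open>\<epsilon> * \<epsilon> powr (\<alpha> - 1)\<close>.\<close>

lemma rademacher_chaining_step:
  fixes v :: "(nat \<Rightarrow> real) \<Rightarrow> nat \<Rightarrow> nat \<Rightarrow> real"
  assumes \<alpha>: "\<alpha> < 1" and \<delta>: "0 < \<delta>" and s: "0 \<le> s" and K: "0 \<le> K"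
    and C: "\<And>j. finite (C j)" "\<And>j. C j \<noteq> {}"
      "\<And>j. sqrt (ln (2 * real (card (C j)))) \<le> K * (\<delta> / 2 ^ j) powr (\<alpha> - 1)"
    and mem: "\<And>e j. e \<in> signs n \<Longrightarrow> v e j \<in> C j"
    and dist: "\<And>e. e \<in> signs n \<Longrightarrow> L2_set (\<lambda>i. v e (Suc j) i - v e j i) {..<n} \<le> 3 * s * (\<delta> / 2 ^ Suc j)"
  shows "sign_avg n (\<lambda>e. \<bar>\<Sum>i<n. e i * (v e (Suc j) i - v e j i)\<bar>)
    \<le> 6 * sqrt 2 * s * K * (\<delta> / 2 ^ Suc j) powr \<alpha>"
proof -
  let ?e = "\<lambda>j. \<delta> / 2 ^ j"
  \<comment> \<open>Only the short differences are kept: the maximal inequality asks for the norm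
    bound on the whole set, while arbitrary pairs of centers may be far apart.\<close>
  let ?D = "{a \<in> (\<lambda>(c', c) i. c' i - c i) ` (C (Suc j) \<times> C j). L2_set a {..<n} \<le> 3 * s * ?e (Suc j)}"
  have card1: "1 \<le> card (C j)" for j using C by (simp add: Suc_leI card_gt_0_iff)
  have "card ?D \<le> card ((\<lambda>(c', c) i. c' i - c i) ` (C (Suc j) \<times> C j))"
    using C by (intro card_mono) auto
  also have "\<dots> \<le> card (C (Suc j) \<times> C j)"
    using C by (intro card_image_le) auto
  finally have cardD: "real (card ?D) \<le> real (card (C (Suc j))) * real (card (C j))"
    by (simp add: card_cartesian_product flip: of_nat_mult)
  have max: "sign_avg n (\<lambda>e. \<bar>\<Sum>i<n. e i * (\<lambda>i. v e (Suc j) i - v e j i) i\<bar>)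
     \<le> 3 * s * ?e (Suc j) * sqrt (2 * ln (2 * (real (card (C (Suc j))) * real (card (C j)))))"
  proof (rule rademacher_maximal[where A = ?D])
    show "finite ?D" using C by auto
    show "(\<lambda>i. v e (Suc j) i - v e j i) \<in> ?D" if "e \<in> signs n" for e
    proof -
      have "(v e (Suc j), v e j) \<in> C (Suc j) \<times> C j" using mem[OF that] by simp
      then have "(\<lambda>(c', c) i. c' i - c i) (v e (Suc j), v e j) \<in> (\<lambda>(c', c) i. c' i - c i) ` (C (Suc j) \<times> C j)"
        by (rule imageI)
      then show ?thesis using dist[OF that] by simp
    qed
  qed (use cardD s \<delta> in auto)
  have "sqrt (2 * ln (2 * (real (card (C (Suc j))) * real (card (C j)))))
      \<le> sqrt 2 * (sqrt (ln (2 * real (card (C (Suc j))))) + sqrt (ln (2 * real (card (C j)))))"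
  proof -
    have pos: "0 < real (card (C j))" "1 \<le> real (card (C j))" for j
      using card1[of j] by linarith+
    have "ln (2 * (real (card (C (Suc j))) * real (card (C j))))
        \<le> ln (2 * real (card (C (Suc j)))) + ln (2 * real (card (C j)))"
      using pos by (simp add: ln_mult)
    moreover have "0 \<le> ln (2 * real (card (C j)))" for j
      using pos[of j] by simp
    ultimately have "sqrt (ln (2 * (real (card (C (Suc j))) * real (card (C j)))))
        \<le> sqrt (ln (2 * real (card (C (Suc j))))) + sqrt (ln (2 * real (card (C j))))"
      using sqrt_add_le_add_sqrt by (meson dual_order.trans real_sqrt_le_iff)
    then show ?thesis by (simp add: real_sqrt_mult)
  qed
  also have "\<dots> \<le> sqrt 2 * (K * ?e (Suc j) powr (\<alpha> - 1) + K * ?e (Suc j) powr (\<alpha> - 1))"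
  proof -
    have "?e j powr (\<alpha> - 1) \<le> ?e (Suc j) powr (\<alpha> - 1)"
      using \<alpha> \<delta> by (intro powr_mono2') (auto simp: field_simps)
    then have "K * ?e j powr (\<alpha> - 1) \<le> K * ?e (Suc j) powr (\<alpha> - 1)"
      using K by (rule mult_left_mono)
    then show ?thesis
      using C(3)[of j] C(3)[of "Suc j"] by (intro mult_left_mono add_mono) auto
  qed
  finally have "3 * s * ?e (Suc j) * sqrt (2 * ln (2 * (real (card (C (Suc j))) * real (card (C j)))))
      \<le> 3 * s * ?e (Suc j) * (sqrt 2 * (K * ?e (Suc j) powr (\<alpha> - 1) + K * ?e (Suc j) powr (\<alpha> - 1)))"
    using s \<delta> by (intro mult_left_mono) auto
  also have "3 * s * ?e (Suc j) * (sqrt 2 * (K * ?e (Suc j) powr (\<alpha> - 1) + K * ?e (Suc j) powr (\<alpha> - 1)))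
      = 6 * sqrt 2 * s * K * (?e (Suc j) * ?e (Suc j) powr (\<alpha> - 1))"
    by (simp add: algebra_simps)
  also have "?e (Suc j) * ?e (Suc j) powr (\<alpha> - 1) = ?e (Suc j) powr \<alpha>"
    using \<delta> by (subst powr_mult_base) (auto simp: )
  finally show ?thesis
    using max by linarith
qed

text \<open>Dudley's entropy bound for root entropies of order
  \<open>\<epsilon> powr (\<alpha> - 1)\<close>, which are integrable at 0. The chain depends on the
  sign vector because \<open>v e\<close> does, and the maximal inequality permits this.\<close>

lemma rademacher_chaining:
  fixes V :: "(nat \<Rightarrow> real) set"
  assumes \<alpha>: "0 < \<alpha>" "\<alpha> < 1" and \<delta>: "0 < \<delta>" "\<delta> \<le> R" and s: "0 \<le> s" and K: "0 \<le> K"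
    and cover: "\<And>\<epsilon>. 0 < \<epsilon> \<Longrightarrow> \<epsilon> \<le> R \<Longrightarrow> \<exists>C. finite C \<and> C \<noteq> {} \<and>
      sqrt (ln (2 * real (card C))) \<le> K * \<epsilon> powr (\<alpha> - 1) \<and>
      (\<forall>v\<in>V. \<exists>c\<in>C. L2_set (\<lambda>i. v i - c i) {..<n} \<le> s * \<epsilon>)"
    and v: "\<And>e. e \<in> signs n \<Longrightarrow> v e \<in> V" "\<And>e. e \<in> signs n \<Longrightarrow> L2_set (v e) {..<n} \<le> s * \<delta>"
  shows "sign_avg n (\<lambda>e. \<bar>\<Sum>i<n. e i * v e i\<bar>) \<le> chaining_const \<alpha> * s * K * \<delta> powr \<alpha>"
proof -
  let ?e = "\<lambda>j. \<delta> / 2 ^ j"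
  let ?nrm = "\<lambda>a. L2_set a {..<n}"
  have e: "0 < ?e j" "?e j \<le> R" for j
  proof -
    have "\<delta> * 1 \<le> \<delta> * 2 ^ j" using \<delta> by (intro mult_left_mono) auto
    then have "?e j \<le> \<delta>" by (simp add: field_simps)
    then show "0 < ?e j" "?e j \<le> R" using \<delta> by auto
  qed
  have "\<exists>C. \<forall>j. finite (C j) \<and> C j \<noteq> {} \<and> sqrt (ln (2 * real (card (C j)))) \<le> K * ?e j powr (\<alpha> - 1) \<and>
      (\<forall>v\<in>V. \<exists>c\<in>C j. ?nrm (\<lambda>i. v i - c i) \<le> s * ?e j)"
    by (intro choice allI cover e)
  then obtain C where C: "\<And>j. finite (C j)" "\<And>j. C j \<noteq> {}"
      "\<And>j. sqrt (ln (2 * real (card (C j)))) \<le> K * ?e j powr (\<alpha> - 1)"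
      "\<And>j v. v \<in> V \<Longrightarrow> \<exists>c\<in>C j. ?nrm (\<lambda>i. v i - c i) \<le> s * ?e j"
    by blast
  \<comment> \<open>Level 0 is the zero vector alone, an admissible center because every
    \<open>v e\<close> has norm at most \<open>s * \<delta>\<close>. The chain thus starts at radius
    \<open>\<delta>\<close>, and the bound scales with
    \<open>\<delta> powr \<alpha>\<close>.\<close>
  define C' where "C' j = (if j = 0 then {\<lambda>_. 0} else C j)" for j
  have C': "finite (C' j)" "C' j \<noteq> {}"
    "sqrt (ln (2 * real (card (C' j)))) \<le> K * ?e j powr (\<alpha> - 1)" for j
  proof -
    show "finite (C' j)" "C' j \<noteq> {}" using C by (auto simp: C'_def)
    have "real (card (C' j)) \<le> real (card (C j))"
      using card_gt_0_iff[of "C j"] C(1)[of j] C(2)[of j] by (cases "j = 0") (auto simp: C'_def)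
    moreover have "0 < card (C' j)" using C(1)[of j] C(2)[of j] by (simp add: C'_def card_gt_0_iff)
    ultimately have "sqrt (ln (2 * real (card (C' j)))) \<le> sqrt (ln (2 * real (card (C j))))"
      by (intro real_sqrt_le_mono ln_mono) auto
    then show "sqrt (ln (2 * real (card (C' j)))) \<le> K * ?e j powr (\<alpha> - 1)" using C(3)[of j] by linarith
  qed
  have "\<exists>p. \<forall>e\<in>signs n. \<forall>j. p e j \<in> C' j \<and> ?nrm (\<lambda>i. v e i - p e j i) \<le> s * ?e j"
  proof (intro bchoice ballI choice allI)
    fix e j assume e: "e \<in> signs n"
    show "\<exists>c. c \<in> C' j \<and> ?nrm (\<lambda>i. v e i - c i) \<le> s * ?e j"
      using v(2)[OF e] C(4)[OF v(1)[OF e], of j] by (auto simp: C'_def)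
  qed
  then obtain p where p: "\<And>e j. e \<in> signs n \<Longrightarrow> p e j \<in> C' j"
      "\<And>e j. e \<in> signs n \<Longrightarrow> ?nrm (\<lambda>i. v e i - p e j i) \<le> s * ?e j"
    by blast
  have p0: "p e 0 = (\<lambda>_. 0)" if "e \<in> signs n" for e
    using p(1)[OF that, of 0] by (simp add: C'_def)
  let ?B = "6 * sqrt 2 * s * K"
  have step: "sign_avg n (\<lambda>e. \<bar>\<Sum>i<n. e i * (p e (Suc j) i - p e j i)\<bar>) \<le> ?B * ?e (Suc j) powr \<alpha>" for j
  proof (rule rademacher_chaining_step[OF \<alpha>(2) \<delta>(1) s K C' p(1)])
    fix e assume e: "e \<in> signs n"
    \<comment> \<open>Both ends of the link are compared with \<open>v e\<close>; the coarser radius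
      is twice the finer one, hence the factor 3.\<close>
    have "?nrm (\<lambda>i. p e (Suc j) i - p e j i) \<le> s * ?e (Suc j) + s * ?e j"
      using L2_set_diff_triangle[of "p e (Suc j)" "p e j" "{..<n}" "v e"]
        p(2)[OF e, of j] p(2)[OF e, of "Suc j"] L2_set_diff_commute[of "v e" "p e (Suc j)" "{..<n}"] by linarith
    then show "?nrm (\<lambda>i. p e (Suc j) i - p e j i) \<le> 3 * s * ?e (Suc j)" by (simp add: field_simps)
  qed
  let ?q = "2 powr (- \<alpha>)"
  have q: "0 < ?q" "?q < 1" using \<alpha> by (auto intro: powr_less_one)
  have ej: "?e j powr \<alpha> = \<delta> powr \<alpha> * ?q ^ j" for j
  proof -
    have "(2 ^ j) powr \<alpha> = (2 powr \<alpha>) ^ j"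
      by (simp add: powr_powr mult.commute flip: powr_realpow)
    moreover have "?e j powr \<alpha> = \<delta> powr \<alpha> / (2 ^ j) powr \<alpha>"
      by (rule powr_divide)
    ultimately show ?thesis by (simp add: powr_minus power_inverse divide_inverse)
  qed
  \<comment> \<open>The chain is cut at level \<open>J\<close>. The remainder is bounded by
    Cauchy-Schwarz with the norm \<open>sqrt n\<close> of a sign vector, and it vanishes as
    \<open>J\<close> grows with \<open>n\<close> fixed.\<close>
  have bound: "sign_avg n (\<lambda>e. \<bar>\<Sum>i<n. e i * v e i\<bar>)
     \<le> chaining_const \<alpha> * s * K * \<delta> powr \<alpha> + sqrt (real n) * s * \<delta> * (1 / 2) ^ J" for J
  proof -
    have "sign_avg n (\<lambda>e. \<bar>\<Sum>i<n. e i * v e i\<bar>) \<le>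
      sign_avg n (\<lambda>e. sqrt (real n) * s * ?e J + (\<Sum>j<J. \<bar>\<Sum>i<n. e i * (p e (Suc j) i - p e j i)\<bar>))"
    proof (rule sign_avg_mono)
      fix e assume e: "e \<in> signs n"
      have tel: "v e i = (v e i - p e J i) + (\<Sum>j<J. p e (Suc j) i - p e j i)" for i
        using sum_lessThan_telescope[of "\<lambda>j. p e j i" J] p0[OF e] by simp
      have "(\<Sum>i<n. e i * v e i) = (\<Sum>i<n. e i * (v e i - p e J i)) + (\<Sum>j<J. \<Sum>i<n. e i * (p e (Suc j) i - p e j i))"
      proof -
        have "(\<Sum>i<n. e i * v e i) = (\<Sum>i<n. e i * (v e i - p e J i) + (\<Sum>j<J. e i * (p e (Suc j) i - p e j i)))"
          by (intro sum.cong refl, subst tel) (simp only: distrib_left sum_distrib_left)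
        also have "\<dots> = (\<Sum>i<n. e i * (v e i - p e J i)) + (\<Sum>i<n. \<Sum>j<J. e i * (p e (Suc j) i - p e j i))"
          by (rule sum.distrib)
        also have "(\<Sum>i<n. \<Sum>j<J. e i * (p e (Suc j) i - p e j i)) = (\<Sum>j<J. \<Sum>i<n. e i * (p e (Suc j) i - p e j i))"
          by (rule sum.swap)
        finally show ?thesis .
      qed
      then have "\<bar>\<Sum>i<n. e i * v e i\<bar> \<le> \<bar>\<Sum>i<n. e i * (v e i - p e J i)\<bar> + (\<Sum>j<J. \<bar>\<Sum>i<n. e i * (p e (Suc j) i - p e j i)\<bar>)"
        using abs_triangle_ineq[of "\<Sum>i<n. e i * (v e i - p e J i)" "\<Sum>j<J. \<Sum>i<n. e i * (p e (Suc j) i - p e j i)"]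
          sum_abs[of "\<lambda>j. \<Sum>i<n. e i * (p e (Suc j) i - p e j i)" "{..<J}"] by linarith
      moreover have "\<bar>\<Sum>i<n. e i * (v e i - p e J i)\<bar> \<le> sqrt (real n) * s * ?e J"
      proof -
        have "\<bar>\<Sum>i<n. e i * (v e i - p e J i)\<bar> \<le> (\<Sum>i<n. \<bar>e i * (v e i - p e J i)\<bar>)"
          by (rule sum_abs)
        also have "\<dots> = (\<Sum>i<n. \<bar>e i\<bar> * \<bar>v e i - p e J i\<bar>)"
          by (simp add: abs_mult)
        also have "\<dots> \<le> L2_set e {..<n} * ?nrm (\<lambda>i. v e i - p e J i)"
          by (rule L2_set_mult_ineq)
        also have "L2_set e {..<n} = sqrt (real n)"
        proof -
          have "(e i)\<^sup>2 = 1" if "i < n" for i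
          proof -
            have "e i \<in> {- 1, 1}"
              using e that unfolding signs_def by (auto dest: PiE_mem)
            then show ?thesis by auto
          qed
          then show ?thesis by (simp add: L2_set_def)
        qed
        also have "sqrt (real n) * ?nrm (\<lambda>i. v e i - p e J i) \<le> sqrt (real n) * (s * ?e J)"
          using p(2)[OF e] by (intro mult_left_mono) auto
        finally show ?thesis by (simp add: mult.assoc)
      qed
      ultimately show "\<bar>\<Sum>i<n. e i * v e i\<bar> \<le> sqrt (real n) * s * ?e J + (\<Sum>j<J. \<bar>\<Sum>i<n. e i * (p e (Suc j) i - p e j i)\<bar>)"
        by linarith
    qed
    also have "\<dots> \<le> sqrt (real n) * s * ?e J + (\<Sum>j<J. ?B * ?e (Suc j) powr \<alpha>)"
      unfolding sign_avg_add sign_avg_sum sign_avg_const by (intro add_left_mono sum_mono step)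
    finally have le: "sign_avg n (\<lambda>e. \<bar>\<Sum>i<n. e i * v e i\<bar>)
      \<le> sqrt (real n) * s * ?e J + (\<Sum>j<J. ?B * ?e (Suc j) powr \<alpha>)" .
    have "(\<Sum>j<J. ?B * ?e (Suc j) powr \<alpha>) = ?B * \<delta> powr \<alpha> * (?q * (\<Sum>j<J. ?q ^ j))"
      unfolding ej by (simp add: sum_distrib_left mult_ac)
    also have "\<dots> \<le> ?B * \<delta> powr \<alpha> * (1 * (1 / (1 - ?q)))"
    proof (intro mult_left_mono mult_mono)
      show "(\<Sum>j<J. ?q ^ j) \<le> 1 / (1 - ?q)"
        using q sum_le_suminf[of "\<lambda>j. ?q ^ j" "{..<J}"] suminf_geometric[of ?q] by (simp add: summable_geometric)
    qed (use q s K in \<open>auto intro: sum_nonneg\<close>)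
    also have "\<dots> = chaining_const \<alpha> * s * K * \<delta> powr \<alpha>"
      by (simp add: chaining_const_def)
    finally show ?thesis
      using le by (simp add: power_divide mult.assoc)
  qed
  have "(\<lambda>J. chaining_const \<alpha> * s * K * \<delta> powr \<alpha> + sqrt (real n) * s * \<delta> * (1 / 2) ^ J)
      \<longlonglongrightarrow> chaining_const \<alpha> * s * K * \<delta> powr \<alpha> + sqrt (real n) * s * \<delta> * 0"
    by (intro tendsto_intros LIMSEQ_realpow_zero) auto
  then show ?thesis
    using bound by (intro LIMSEQ_le_const[of "\<lambda>J. chaining_const \<alpha> * s * K * \<delta> powr \<alpha> + sqrt (real n) * s * \<delta> * (1 / 2) ^ J"]) auto
qed

section \<open>Empirical measures, measurability and covers\<close>

lemma space_cubeM [simp]: "space (cubeM \<tau>) = cbox 0 \<tau>"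
  by (simp add: cubeM_def space_restrict_space)

lemma measurable_into_uniform_count [simp]:
  "z \<in> measurable (uniform_count_measure A) S \<longleftrightarrow> z \<in> A \<rightarrow> space S"
  by (auto simp: measurable_def space_uniform_count_measure sets_uniform_count_measure)

lemma sets_emp [simp, measurable_cong]: "sets (emp S n x) = sets S"
  by (simp add: emp_def)

lemma space_emp [simp]: "space (emp S n x) = space S"
  by (simp add: emp_def)

lemma emp_cong: "(\<And>i. i < n \<Longrightarrow> x i = y i) \<Longrightarrow> emp S n x = emp S n y"
  unfolding emp_def by (rule distr_cong) (auto simp: space_uniform_count_measure)

lemma prob_space_emp:
  assumes "n > 0" "\<And>i. i < n \<Longrightarrow> x i \<in> space S"
  shows "prob_space (emp S n x)"
  unfolding emp_def using assms
  by (intro prob_space.prob_space_distr prob_space_uniform_count_measure) auto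

lemma integral_emp:
  fixes f :: "'a \<Rightarrow> real"
  assumes "\<And>i. i < n \<Longrightarrow> x i \<in> space S" "f \<in> borel_measurable S"
  shows "(\<integral>z. f z \<partial>emp S n x) = (\<Sum>i<n. f (x i)) / real n"
  unfolding emp_def using assms
  by (subst integral_distr) (auto simp: integral_uniform_count_measure)

section \<open>Grid approximation and joint measurability of cadlag functions\<close>

definition grid_point :: "real^'d::finite \<Rightarrow> nat \<Rightarrow> ('d \<Rightarrow> int) \<Rightarrow> real^'d" where
  "grid_point \<tau> m h = (\<chi> i. max 0 (min (\<tau> $ i) ((of_int (h i) + 1) / real (Suc m))))"

lemma grid_point_mem: "(\<And>i. 0 \<le> \<tau> $ i) \<Longrightarrow> grid_point \<tau> m h \<in> cbox 0 \<tau>"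
  by (auto simp: grid_point_def mem_box_cart)

text \<open>The grid points lie to the upper right of \<open>z\<close>, the side on which a cadlag
  function is continuous; hence the floor plus one in \<open>grid_point\<close>. Clipping to the
  cube keeps them above \<open>z\<close> because \<open>z\<close> lies in the cube.\<close>

lemma grid_point_floor:
  fixes z \<tau> :: "real^'d::finite"
  assumes "z \<in> cbox 0 \<tau>"
  defines "y \<equiv> \<lambda>m. grid_point \<tau> m (\<lambda>i. \<lfloor>real (Suc m) * z $ i\<rfloor>)"
  shows "z $ i \<le> y m $ i" "y \<longlonglongrightarrow> z"
proof -
  have z: "0 \<le> z $ i" "z $ i \<le> \<tau> $ i" for i
    using assms by (auto simp: mem_box_cart)
  have *: "z $ i \<le> (of_int \<lfloor>real (Suc m) * z $ i\<rfloor> + 1) / real (Suc m)"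
    "(of_int \<lfloor>real (Suc m) * z $ i\<rfloor> + 1) / real (Suc m) \<le> z $ i + 1 / real (Suc m)" for m i
  proof -
    have "real (Suc m) * z $ i \<le> of_int \<lfloor>real (Suc m) * z $ i\<rfloor> + 1"
      "of_int \<lfloor>real (Suc m) * z $ i\<rfloor> + 1 \<le> real (Suc m) * z $ i + 1" by linarith+
    then show "z $ i \<le> (of_int \<lfloor>real (Suc m) * z $ i\<rfloor> + 1) / real (Suc m)"
      "(of_int \<lfloor>real (Suc m) * z $ i\<rfloor> + 1) / real (Suc m) \<le> z $ i + 1 / real (Suc m)"
      by (simp_all add: field_simps del: of_nat_Suc)
  qed
  show ge: "z $ i \<le> y m $ i" for i m
    using *(1)[of i m] z[of i] by (simp add: y_def grid_point_def)
  have le: "y m $ i \<le> z $ i + 1 / real (Suc m)" for i m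
  proof -
    have "0 \<le> 1 / real (Suc m)" by simp
    then show ?thesis
      using *(2)[of m i] z[of i] by (auto simp: y_def grid_point_def max_def min_def simp del: of_nat_Suc)
  qed
  show "y \<longlonglongrightarrow> z"
  proof (rule vec_tendstoI)
    fix i
    have "(\<lambda>m. z $ i + 1 / real (Suc m)) \<longlonglongrightarrow> z $ i + 0"
      by (intro tendsto_intros LIMSEQ_Suc[OF lim_1_over_n])
    then show "(\<lambda>m. y m $ i) \<longlonglongrightarrow> z $ i"
      using ge le by (intro tendsto_sandwich[of "\<lambda>_. z $ i" "\<lambda>m. y m $ i" _ "\<lambda>m. z $ i + 1 / real (Suc m)"]) auto
  qed
qed

lemma measurable_component_cubeM [measurable]: "(\<lambda>z. z $ i) \<in> borel_measurable (cubeM \<tau>)"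
  unfolding cubeM_def
  by (intro measurable_restrict_space1 borel_measurable_continuous_onI continuous_intros)

text \<open>Right-continuity makes a cadlag function the pointwise limit of its discretizations on grids.\<close>

lemma cadlag_joint_measurable:
  fixes g :: "'x \<Rightarrow> real^'d::finite \<Rightarrow> real"
  assumes \<tau>: "\<And>i. 0 \<le> \<tau> $ i"
    and cadlag: "\<And>x. x \<in> space M \<Longrightarrow> cadlag_on \<tau> (g x)"
    and meas: "\<And>z. z \<in> cbox 0 \<tau> \<Longrightarrow> (\<lambda>x. g x z) \<in> borel_measurable M"
  shows "(\<lambda>(x, z). g x z) \<in> borel_measurable (M \<Otimes>\<^sub>M cubeM \<tau>)"
proof (rule borel_measurable_LIMSEQ_real)
  let ?h = "\<lambda>m p i. \<lfloor>real (Suc m) * snd p $ i\<rfloor>"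
  fix p assume p: "p \<in> space (M \<Otimes>\<^sub>M cubeM \<tau>)"
  then obtain x z where xz: "p = (x, z)" "x \<in> space M" "z \<in> cbox 0 \<tau>"
    by (auto simp: space_pair_measure)
  let ?Y = "{y\<in>cbox 0 \<tau>. \<forall>i. z $ i \<le> y $ i}"
  have "continuous (at z within ?Y) (g x)"
    using cadlag[OF xz(2)] xz(3) by (auto simp: cadlag_on_def continuous_within)
  then have "(g x \<circ> (\<lambda>m. grid_point \<tau> m (\<lambda>i. \<lfloor>real (Suc m) * z $ i\<rfloor>))) \<longlonglongrightarrow> g x z"
    by (rule continuous_within_sequentially[THEN iffD1, rule_format])
      (use grid_point_floor[OF xz(3)] grid_point_mem[OF \<tau>] in auto)
  then show "(\<lambda>m. g (fst p) (grid_point \<tau> m (?h m p))) \<longlonglongrightarrow> (case p of (x, z) \<Rightarrow> g x z)"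
    by (simp add: xz comp_def)
next
  fix m
  show "(\<lambda>p. g (fst p) (grid_point \<tau> m (\<lambda>i. \<lfloor>real (Suc m) * snd p $ i\<rfloor>))) \<in> borel_measurable (M \<Otimes>\<^sub>M cubeM \<tau>)"
  \<comment> \<open>For a fixed integer vector the evaluation point is constant, so pointwise
    measurability suffices; the integer vector itself takes countably many values.\<close>
  proof (rule measurable_compose_countable[where f = "\<lambda>h p. g (fst p) (grid_point \<tau> m h)"])
    show "(\<lambda>p. g (fst p) (grid_point \<tau> m h)) \<in> borel_measurable (M \<Otimes>\<^sub>M cubeM \<tau>)" for h
      using meas[OF grid_point_mem[OF \<tau>], of m h] by (rule measurable_compose[OF measurable_fst])
    show "(\<lambda>p i. \<lfloor>real (Suc m) * snd p $ i\<rfloor>) \<in> M \<Otimes>\<^sub>M cubeM \<tau> \<rightarrow>\<^sub>M count_space UNIV"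
    proof (subst measurable_count_space_eq_countable, simp, intro conjI ballI)
      fix h :: "'d \<Rightarrow> int"
      have "(\<lambda>p i. \<lfloor>real (Suc m) * snd p $ i\<rfloor>) -` {h} \<inter> space (M \<Otimes>\<^sub>M cubeM \<tau>)
        = {p \<in> space (M \<Otimes>\<^sub>M cubeM \<tau>). \<forall>i\<in>UNIV. \<lfloor>real (Suc m) * snd p $ i\<rfloor> = h i}"
        by (auto simp: fun_eq_iff)
      also have "\<dots> \<in> sets (M \<Otimes>\<^sub>M cubeM \<tau>)"
        by measurable
      finally show "(\<lambda>p i. \<lfloor>real (Suc m) * snd p $ i\<rfloor>) -` {h} \<inter> space (M \<Otimes>\<^sub>M cubeM \<tau>) \<in> sets (M \<Otimes>\<^sub>M cubeM \<tau>)" .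
    qed auto
  qed
qed

text \<open>Joint measurability over a one-point parameter space.\<close>

lemma cadlag_measurable:
  assumes "\<And>i. 0 \<le> \<tau> $ i" "cadlag_on \<tau> f"
  shows "f \<in> borel_measurable (cubeM \<tau>)"
proof -
  let ?T = "count_space {()}"
  have "(\<lambda>(x, z). f z) \<in> borel_measurable (?T \<Otimes>\<^sub>M cubeM \<tau>)"
    using assms by (intro cadlag_joint_measurable) auto
  then have "(\<lambda>z. case ((), z) of (x, z) \<Rightarrow> f z) \<in> borel_measurable (cubeM \<tau>)"
    by (rule measurable_compose[OF measurable_Pair1', rotated]) simp
  then show ?thesis by simp
qed

section \<open>Covers uniform over finite point configurations\<close>

text \<open>The entropy condition in the form used by chaining. Quantifying over finite tuples
  covers all empirical measures, in particular those of double samples, with one constant; the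
  factor \<open>sqrt m\<close> relates \<open>L2_set\<close> to the normalized norm. Centers lie in
  \<open>F\<close>, so that maps that are Lipschitz on \<open>F\<close> carry covers along. The 2
  under the logarithm is that of the maximal inequality.\<close>

definition uniform_cover :: "'a set \<Rightarrow> ('a \<Rightarrow> real) set \<Rightarrow> real \<Rightarrow> real \<Rightarrow> real \<Rightarrow> bool" where
  "uniform_cover Z F R \<alpha> K \<longleftrightarrow> (\<forall>m>0. \<forall>z. (\<forall>i<m. z i \<in> Z) \<longrightarrow> (\<forall>\<epsilon>. 0 < \<epsilon> \<and> \<epsilon> \<le> R \<longrightarrow>
     (\<exists>C\<subseteq>F. finite C \<and> C \<noteq> {} \<and> sqrt (ln (2 * real (card C))) \<le> K * \<epsilon> powr (\<alpha> - 1) \<and>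
       (\<forall>f\<in>F. \<exists>g\<in>C. L2_set (\<lambda>i. f (z i) - g (z i)) {..<m::nat} \<le> sqrt (real m) * \<epsilon>))))"

text \<open>A nonempty cover makes the left side at least \<open>sqrt (ln 2)\<close>, so a
  configuration of one point already forces the sign of \<open>K\<close>.\<close>

lemma uniform_cover_nonneg:
  assumes "uniform_cover Z F R \<alpha> K" "0 < R" "Z \<noteq> {}"
  shows "0 \<le> K"
proof -
  obtain z where z: "z \<in> Z" using assms by blast
  have "\<exists>C\<subseteq>F. finite C \<and> C \<noteq> {} \<and> sqrt (ln (2 * real (card C))) \<le> K * R powr (\<alpha> - 1) \<and>
       (\<forall>f\<in>F. \<exists>g\<in>C. L2_set (\<lambda>i. f z - g z) {..<1::nat} \<le> sqrt (real 1) * R)"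
    using assms(2) z by (intro assms(1)[unfolded uniform_cover_def, rule_format]) auto
  then have "\<exists>C::('a \<Rightarrow> real) set. finite C \<and> C \<noteq> {} \<and> sqrt (ln (2 * real (card C))) \<le> K * R powr (\<alpha> - 1)"
    by (rule ex_forward) (elim conjE, intro conjI)
  then obtain C :: "('a \<Rightarrow> real) set" where C: "finite C" "C \<noteq> {}" "sqrt (ln (2 * real (card C))) \<le> K * R powr (\<alpha> - 1)"
    by blast
  have "1 \<le> card C" using C by (simp add: Suc_leI card_gt_0_iff)
  then have "1 \<le> real (card C)" by linarith
  then have "0 \<le> sqrt (ln (2 * real (card C)))" by simp
  then have "0 \<le> K * R powr (\<alpha> - 1)" using C by linarith
  then show ?thesis using assms(2) by (simp add: zero_le_mult_iff)
qed

text \<open>A cover at radius \<open>\<epsilon> / c\<close> is mapped to one at radius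
  \<open>\<epsilon>\<close>. Used with \<open>c = 1\<close> to subtract the loss of the true
  parameter and with \<open>c = 2 * b\<close> for squares of functions bounded by
  \<open>b\<close>.\<close>

lemma uniform_cover_image:
  assumes F: "uniform_cover Z F R \<alpha> K" and c: "0 < c"
    and lip: "\<And>f g z. f \<in> F \<Longrightarrow> g \<in> F \<Longrightarrow> z \<in> Z \<Longrightarrow> \<bar>T f z - T g z\<bar> \<le> c * \<bar>f z - g z\<bar>"
  shows "uniform_cover Z (T ` F) (c * R) \<alpha> (K * c powr (1 - \<alpha>))"
  unfolding uniform_cover_def
proof (intro allI impI)
  fix m :: nat and z and \<epsilon> :: real
  assume m: "0 < m" and z: "\<forall>i<m. z i \<in> Z" and \<epsilon>: "0 < \<epsilon> \<and> \<epsilon> \<le> c * R"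
  have "0 < \<epsilon> / c" "\<epsilon> / c \<le> R" using \<epsilon> c by (auto simp: field_simps)
  then obtain C where C: "C \<subseteq> F" "finite C" "C \<noteq> {}"
      "sqrt (ln (2 * real (card C))) \<le> K * (\<epsilon> / c) powr (\<alpha> - 1)"
      "\<And>f. f \<in> F \<Longrightarrow> \<exists>g\<in>C. L2_set (\<lambda>i. f (z i) - g (z i)) {..<m} \<le> sqrt (real m) * (\<epsilon> / c)"
    using F[unfolded uniform_cover_def, rule_format, OF m, of z "\<epsilon> / c"] z by meson
  have card: "0 < card (T ` C)" "card (T ` C) \<le> card C"
    using C by (auto simp: card_gt_0_iff intro: card_image_le)
  have "sqrt (ln (2 * real (card (T ` C)))) \<le> sqrt (ln (2 * real (card C)))"
    using card by (intro real_sqrt_le_mono ln_mono) auto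
  also have "\<dots> \<le> K * (\<epsilon> / c) powr (\<alpha> - 1)" by (rule C)
  also have "(\<epsilon> / c) powr (\<alpha> - 1) = c powr (1 - \<alpha>) * \<epsilon> powr (\<alpha> - 1)"
  proof -
    have "(\<epsilon> / c) powr (\<alpha> - 1) = \<epsilon> powr (\<alpha> - 1) / c powr (- (1 - \<alpha>))"
      by (simp add: powr_divide)
    then show ?thesis by (simp only: powr_minus) (simp add: field_simps)
  qed
  finally have ln: "sqrt (ln (2 * real (card (T ` C)))) \<le> K * c powr (1 - \<alpha>) * \<epsilon> powr (\<alpha> - 1)"
    by (simp add: mult.assoc)
  have cov: "\<exists>g\<in>T ` C. L2_set (\<lambda>i. f (z i) - g (z i)) {..<m} \<le> sqrt (real m) * \<epsilon>" if f: "f \<in> T ` F" for f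
  proof -
    obtain f0 where f0: "f0 \<in> F" "f = T f0" using f by blast
    obtain g where g: "g \<in> C" "L2_set (\<lambda>i. f0 (z i) - g (z i)) {..<m} \<le> sqrt (real m) * (\<epsilon> / c)"
      using C(5)[OF f0(1)] by blast
    have "L2_set (\<lambda>i. f (z i) - T g (z i)) {..<m} = L2_set (\<lambda>i. \<bar>T f0 (z i) - T g (z i)\<bar>) {..<m}"
      by (simp add: f0 L2_set_def)
    also have "\<dots> \<le> L2_set (\<lambda>i. c * \<bar>f0 (z i) - g (z i)\<bar>) {..<m}"
      using lip f0 g(1) C(1) z by (intro L2_set_mono) auto
    also have "\<dots> = c * L2_set (\<lambda>i. \<bar>f0 (z i) - g (z i)\<bar>) {..<m}"
      using c by (simp add: L2_set_right_distrib)
    also have "\<dots> = c * L2_set (\<lambda>i. f0 (z i) - g (z i)) {..<m}"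
      by (simp add: L2_set_def)
    also have "\<dots> \<le> c * (sqrt (real m) * (\<epsilon> / c))" using g c by (intro mult_left_mono) auto
    also have "\<dots> = sqrt (real m) * \<epsilon>" using c by simp
    finally show ?thesis using g by blast
  qed
  show "\<exists>C\<subseteq>T ` F. finite C \<and> C \<noteq> {} \<and> sqrt (ln (2 * real (card C))) \<le> K * c powr (1 - \<alpha>) * \<epsilon> powr (\<alpha> - 1) \<and>
       (\<forall>f\<in>T ` F. \<exists>g\<in>C. L2_set (\<lambda>i. f (z i) - g (z i)) {..<m} \<le> sqrt (real m) * \<epsilon>)"
    using C ln cov by (intro exI[of _ "T ` C"]) auto
qed

text \<open>A finite entropy excludes an empty set of cover sizes, whose infimum would be infinite;
  and the infimum of a nonempty set of extended naturals is attained.\<close>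

lemma finite_cover_of_unif_entropy:
  assumes \<Lambda>: "prob_space \<Lambda>" "sets \<Lambda> = sets S" and ent: "unif_entropy S \<F> \<epsilon> \<le> ennreal k" and k: "0 \<le> k"
  shows "\<exists>C. finite C \<and> (\<forall>g\<in>C. square_integrable \<Lambda> g) \<and>
    (\<forall>f\<in>\<F>. \<exists>g\<in>C. L2_norm \<Lambda> (\<lambda>x. f x - g x) < \<epsilon>) \<and> sqrt (ln (real (card C))) \<le> k"
proof -
  let ?X = "{enat (card C) | C. finite C \<and>
     (\<forall>g\<in>C. square_integrable \<Lambda> g) \<and> (\<forall>f\<in>\<F>. \<exists>g\<in>C. L2_norm \<Lambda> (\<lambda>x. f x - g x) < \<epsilon>)}"
  have "sqrt_log (covering_number \<epsilon> \<F> \<Lambda>) \<le> unif_entropy S \<F> \<epsilon>"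
    unfolding unif_entropy_def using \<Lambda> by (intro SUP_upper) auto
  then have le: "sqrt_log (Inf ?X) \<le> ennreal k"
    using ent unfolding covering_number_def by (rule order_trans)
  have "?X \<noteq> {}"
  proof
    assume "?X = {}"
    then have "Inf ?X = \<infinity>" by (simp only: Inf_empty top_enat_def)
    then show False using le by (simp add: sqrt_log_def top_unique)
  qed
  then have "Inf ?X \<in> ?X" by (rule wellorder_InfI[OF some_in_eq[THEN iffD2]])
  then obtain C where C: "Inf ?X = enat (card C)" "finite C" "\<forall>g\<in>C. square_integrable \<Lambda> g"
      "\<forall>f\<in>\<F>. \<exists>g\<in>C. L2_norm \<Lambda> (\<lambda>x. f x - g x) < \<epsilon>" by auto
  have "sqrt (ln (real (card C))) \<le> k"
    using le k unfolding C(1) by (simp add: sqrt_log_def)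
  then show ?thesis using C by blast
qed

text \<open>The entropy assumption concerns small radii and admits centers outside the class,
  whereas \<open>uniform_cover\<close> asks for all radii up to \<open>R\<close> and for centers in
  \<open>F\<close>. Shrinking the radius by a constant factor \<open>c\<close> repairs both, at the
  price of a larger constant.\<close>

lemma uniform_cover_of_entropy:
  assumes ent: "\<forall>\<^sub>F \<epsilon> in at_right 0. unif_entropy S \<F> \<epsilon> \<le> ennreal (K0 * \<epsilon> powr (- (1 - \<alpha>)))"
    and \<alpha>: "\<alpha> < 1" and R: "0 < R"
    and F: "F \<subseteq> \<F>" "F \<noteq> {}" "\<And>f. f \<in> F \<Longrightarrow> f \<in> borel_measurable S"
  shows "\<exists>K. uniform_cover (space S) F R \<alpha> K"
proof -
  obtain e0 where e0: "e0 > 0" "\<And>\<epsilon>. 0 < \<epsilon> \<Longrightarrow> \<epsilon> < e0 \<Longrightarrow> unif_entropy S \<F> \<epsilon> \<le> ennreal (K0 * \<epsilon> powr (- (1 - \<alpha>)))"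
    using ent by (auto simp: eventually_at_right_field)
  \<comment> \<open>\<open>e0 / (2 * R)\<close> brings every \<open>c * \<epsilon>\<close> with
    \<open>\<epsilon> \<le> R\<close> into the range of the assumption; \<open>1 / 2\<close> leaves
    room for the doubling of the radius when centers are moved into \<open>F\<close>.\<close>
  define c where "c = min (1 / 2) (e0 / (2 * R))"
  have c: "0 < c" "c \<le> 1 / 2" "c * R < e0"
    using e0 R by (auto simp: c_def min_def field_simps)
  \<comment> \<open>The first summand pays for the 2 under the logarithm, since \<open>R powr (1 -
    \<alpha>) * \<epsilon> powr (\<alpha> - 1) \<ge> 1\<close> for
    \<open>\<epsilon> \<le> R\<close>; the second is the entropy at radius
    \<open>c * \<epsilon>\<close>.\<close>
  define K where "K = R powr (1 - \<alpha>) + \<bar>K0\<bar> * c powr (\<alpha> - 1)"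
  have "uniform_cover (space S) F R \<alpha> K"
    unfolding uniform_cover_def
  proof (intro allI impI)
    fix m :: nat and z and \<epsilon> :: real
    assume m: "0 < m" and z: "\<forall>i<m. z i \<in> space S" and \<epsilon>: "0 < \<epsilon> \<and> \<epsilon> \<le> R"
    let ?\<Lambda> = "emp S m z"
    let ?d = "\<lambda>f g. L2_set (\<lambda>i. f (z i) - g (z i)) {..<m}"
    have "c * \<epsilon> \<le> c * R" using c \<epsilon> by (intro mult_left_mono) auto
    then have c\<epsilon>: "0 < c * \<epsilon>" "c * \<epsilon> < e0" using c \<epsilon> by (simp_all, linarith)
    have "unif_entropy S \<F> (c * \<epsilon>) \<le> ennreal (K0 * (c * \<epsilon>) powr (- (1 - \<alpha>)))"
      using c\<epsilon> by (rule e0)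
    also have "\<dots> \<le> ennreal (\<bar>K0\<bar> * (c * \<epsilon>) powr (\<alpha> - 1))"
      by (intro ennreal_leI) (auto intro!: mult_right_mono)
    finally have "unif_entropy S \<F> (c * \<epsilon>) \<le> ennreal (\<bar>K0\<bar> * (c * \<epsilon>) powr (\<alpha> - 1))" .
    then have "\<exists>C. finite C \<and> (\<forall>g\<in>C. square_integrable ?\<Lambda> g) \<and>
        (\<forall>f\<in>\<F>. \<exists>g\<in>C. L2_norm ?\<Lambda> (\<lambda>x. f x - g x) < c * \<epsilon>) \<and>
        sqrt (ln (real (card C))) \<le> \<bar>K0\<bar> * (c * \<epsilon>) powr (\<alpha> - 1)"
      using m z by (intro finite_cover_of_unif_entropy[OF prob_space_emp sets_emp]) auto
    then obtain C where C: "finite C" "\<And>g. g \<in> C \<Longrightarrow> square_integrable ?\<Lambda> g"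
      "\<And>f. f \<in> \<F> \<Longrightarrow> \<exists>g\<in>C. L2_norm ?\<Lambda> (\<lambda>x. f x - g x) < c * \<epsilon>"
      "sqrt (ln (real (card C))) \<le> \<bar>K0\<bar> * (c * \<epsilon>) powr (\<alpha> - 1)"
      by blast
    have dist: "?d f g = sqrt (real m) * L2_norm ?\<Lambda> (\<lambda>x. f x - g x)"
      if "f \<in> borel_measurable S" "g \<in> borel_measurable S" for f g
      using that z m by (simp add: L2_norm_def integral_emp L2_set_def real_sqrt_divide)
    have Cm: "g \<in> borel_measurable S" if "g \<in> C" for g
      using C(2)[OF that] by (simp add: square_integrable_def cong: measurable_cong_sets)
    have near: "\<exists>g\<in>C. ?d f g \<le> sqrt (real m) * (c * \<epsilon>)" if "f \<in> F" for f
      using C(3)[of f] that F(1) dist[OF F(3)[OF that] Cm] m by (auto intro!: mult_left_mono less_imp_le)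
    \<comment> \<open>Centers far from all of \<open>F\<close> are dropped; each remaining one is
      then replaced by a member \<open>h g\<close> of \<open>F\<close> close to it.\<close>
    define C1 where "C1 = {g \<in> C. \<exists>f\<in>F. ?d f g \<le> sqrt (real m) * (c * \<epsilon>)}"
    have "\<forall>g\<in>C1. \<exists>f. f \<in> F \<and> ?d f g \<le> sqrt (real m) * (c * \<epsilon>)" by (auto simp: C1_def)
    then obtain h where h: "\<And>g. g \<in> C1 \<Longrightarrow> h g \<in> F" "\<And>g. g \<in> C1 \<Longrightarrow> ?d (h g) g \<le> sqrt (real m) * (c * \<epsilon>)"
      using bchoice[of C1 "\<lambda>g f. f \<in> F \<and> ?d f g \<le> sqrt (real m) * (c * \<epsilon>)"] by blast
    have near': "\<exists>g\<in>h ` C1. ?d f g \<le> sqrt (real m) * \<epsilon>" if f: "f \<in> F" for f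
    proof -
      obtain g where g: "g \<in> C" "?d f g \<le> sqrt (real m) * (c * \<epsilon>)" using near[OF f] by blast
      then have g1: "g \<in> C1" using f by (auto simp: C1_def)
      have "?d f (h g) \<le> ?d f g + ?d g (h g)" by (rule L2_set_diff_triangle)
      also have "?d g (h g) = ?d (h g) g" by (rule L2_set_diff_commute)
      also have "?d f g + ?d (h g) g \<le> sqrt (real m) * (c * \<epsilon>) + sqrt (real m) * (c * \<epsilon>)"
        using g h(2)[OF g1] by linarith
      also have "\<dots> = sqrt (real m) * ((2 * c) * \<epsilon>)" by simp
      also have "\<dots> \<le> sqrt (real m) * (1 * \<epsilon>)" using c \<epsilon> by (intro mult_left_mono mult_right_mono) auto
      finally show ?thesis using g1 by auto
    qed
    have ne: "h ` C1 \<noteq> {}" using near' F(2) by blast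
    have fin: "finite C1" using C(1) by (simp add: C1_def)
    have card: "0 < card (h ` C1)" "card (h ` C1) \<le> card C"
      using ne fin C(1) card_image_le[OF fin, of h] card_mono[of C C1] by (auto simp: card_gt_0_iff C1_def)
    then have card1: "1 \<le> real (card (h ` C1))" "real (card (h ` C1)) \<le> real (card C)" by linarith+
    have "ln (2 * real (card (h ` C1))) \<le> ln (2 * real (card C))"
      using card1 by (intro ln_mono) auto
    also have "\<dots> = ln 2 + ln (real (card C))" using card1 by (simp add: ln_mult)
    also have "\<dots> \<le> 1 + ln (real (card C))" using ln_2_less_1 by simp
    finally have "sqrt (ln (2 * real (card (h ` C1)))) \<le> sqrt (1 + ln (real (card C)))"
      by (rule real_sqrt_le_mono)
    also have "\<dots> \<le> sqrt 1 + sqrt (ln (real (card C)))"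
      using card1 by (intro sqrt_add_le_add_sqrt) auto
    also have "\<dots> \<le> R powr (1 - \<alpha>) * \<epsilon> powr (\<alpha> - 1) + \<bar>K0\<bar> * (c * \<epsilon>) powr (\<alpha> - 1)"
    proof (intro add_mono C(4))
      have "R powr (1 - \<alpha>) * R powr (\<alpha> - 1) \<le> R powr (1 - \<alpha>) * \<epsilon> powr (\<alpha> - 1)"
        using \<epsilon> \<alpha> by (intro mult_left_mono powr_mono2') auto
      moreover have "R powr (1 - \<alpha>) * R powr (\<alpha> - 1) = 1"
        using R by (simp flip: powr_add)
      ultimately show "sqrt 1 \<le> R powr (1 - \<alpha>) * \<epsilon> powr (\<alpha> - 1)" by simp
    qed
    also have "\<dots> = K * \<epsilon> powr (\<alpha> - 1)"
      by (simp add: K_def powr_mult distrib_right mult.assoc)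
    finally show "\<exists>C\<subseteq>F. finite C \<and> C \<noteq> {} \<and> sqrt (ln (2 * real (card C))) \<le> K * \<epsilon> powr (\<alpha> - 1) \<and>
       (\<forall>f\<in>F. \<exists>g\<in>C. ?d f g \<le> sqrt (real m) * \<epsilon>)"
      using h(1) fin ne near' by (intro exI[of _ "h ` C1"]) auto
  qed
  then show ?thesis by blast
qed

section \<open>Symmetrization\<close>

abbreviation samples :: "nat \<Rightarrow> 'a measure \<Rightarrow> (nat \<Rightarrow> 'a) measure" where
  "samples n S \<equiv> PiM {..<n} (\<lambda>_. S)"

section \<open>Second moments and the ghost sample\<close>

lemma iid_second_moment:
  fixes g :: "'a \<Rightarrow> real"
  assumes P: "prob_space P" and J: "finite (J :: nat set)"
    and g [measurable]: "g \<in> borel_measurable P" and b: "\<And>z. z \<in> space P \<Longrightarrow> \<bar>g z\<bar> \<le> b"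
    and mean: "(\<integral>z. g z \<partial>P) = 0"
  shows "(\<integral>w. (\<Sum>i\<in>J. g (w i))\<^sup>2 \<partial>PiM J (\<lambda>_. P)) = real (card J) * (\<integral>z. (g z)\<^sup>2 \<partial>P)"
proof -
  interpret P: prob_space P by (rule P)
  interpret product_sigma_finite "\<lambda>_. P" by unfold_locales
  let ?N = "PiM J (\<lambda>_. P)"
  interpret N: prob_space ?N by (intro prob_space_PiM P)
  have sq: "integrable P (\<lambda>z. (g z)\<^sup>2)"
  proof (rule P.integrable_const_bound[where B = "b\<^sup>2"])
    show "AE z in P. norm ((g z)\<^sup>2) \<le> b\<^sup>2"
      using b by (intro AE_I2) (metis abs_ge_zero norm_power power_mono real_norm_def)
  qed measurable
  have gi: "integrable P g"
    by (rule P.integrable_const_bound[where B = b]) (auto intro!: AE_I2 b)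
  have comp [measurable]: "(\<lambda>w. g (w i)) \<in> borel_measurable ?N" if "i \<in> J" for i
    using that by measurable
  have bw: "\<bar>g (w i)\<bar> \<le> b" if "i \<in> J" "w \<in> space ?N" for i w
    using that by (intro b) (auto simp: space_PiM)
  have b0: "0 \<le> b"
    using P.not_empty b by (meson abs_ge_zero ex_in_conv order_trans)
  have int: "integrable ?N (\<lambda>w. g (w i) * g (w k))" if "i \<in> J" "k \<in> J" for i k
    using that bw[of i] bw[of k] b0
    by (intro N.integrable_const_bound[where B = "b * b"] AE_I2) (auto simp: abs_mult intro!: mult_mono borel_measurable_times)
  have diag: "(\<integral>w. g (w i) * g (w i) \<partial>?N) = (\<integral>z. (g z)\<^sup>2 \<partial>P)" if i: "i \<in> J" for i
  proof -
    have "(\<integral>z. (g z)\<^sup>2 \<partial>P) = (\<integral>z. (g z)\<^sup>2 \<partial>distr ?N P (\<lambda>w. w i))"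
      using i P by (subst distr_PiM_component) auto
    also have "\<dots> = (\<integral>w. (g (w i))\<^sup>2 \<partial>?N)"
      using i by (intro integral_distr) auto
    finally show ?thesis by (simp add: power2_eq_square)
  qed
  have cross: "(\<integral>w. g (w i) * g (w k) \<partial>?N) = 0" if ik: "i \<in> J" "k \<in> J" "i \<noteq> k" for i k
  proof -
    \<comment> \<open>The factor 1 at the other coordinates makes the integrand a product over all
      of \<open>J\<close>; the mean zero of coordinate \<open>i\<close> then annihilates the
      integral.\<close>
    let ?f = "\<lambda>l. if l \<in> {i, k} then g else (\<lambda>_. 1)"
    have "(\<integral>w. g (w i) * g (w k) \<partial>?N) = (\<integral>w. (\<Prod>l\<in>J. ?f l (w l)) \<partial>?N)"
    proof (rule Bochner_Integration.integral_cong[OF refl])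
      fix w
      have "(\<Prod>l\<in>J. ?f l (w l)) = (\<Prod>l\<in>{i, k}. ?f l (w l))"
        using ik J by (intro prod.mono_neutral_right) auto
      then show "g (w i) * g (w k) = (\<Prod>l\<in>J. ?f l (w l))" using ik by simp
    qed
    also have "\<dots> = (\<Prod>l\<in>J. integral\<^sup>L P (?f l))"
      using J gi by (intro product_integral_prod) auto
    also have "\<dots> = 0"
      using J ik mean by (intro prod_zero) (auto intro!: bexI[of _ i])
    finally show ?thesis .
  qed
  have "(\<integral>w. (\<Sum>i\<in>J. g (w i))\<^sup>2 \<partial>?N) = (\<integral>w. (\<Sum>i\<in>J. \<Sum>k\<in>J. g (w i) * g (w k)) \<partial>?N)"
    by (simp add: power2_eq_square sum_product)
  also have "\<dots> = (\<Sum>i\<in>J. \<Sum>k\<in>J. \<integral>w. g (w i) * g (w k) \<partial>?N)"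
    by (subst Bochner_Integration.integral_sum, intro Bochner_Integration.integrable_sum int, assumption, assumption,
        intro sum.cong refl, rule Bochner_Integration.integral_sum, rule int)
  also have "\<dots> = (\<Sum>i\<in>J. \<Sum>k\<in>J. if k = i then (\<integral>z. (g z)\<^sup>2 \<partial>P) else 0)"
    by (intro sum.cong refl) (auto simp: diag cross)
  also have "\<dots> = real (card J) * (\<integral>z. (g z)\<^sup>2 \<partial>P)"
    using J by simp
  finally show ?thesis .
qed

lemma iid_mean:
  fixes g :: "'a \<Rightarrow> real"
  assumes P: "prob_space P" and i: "i \<in> J" and g [measurable]: "g \<in> borel_measurable P"
  shows "(\<integral>w. g (w i) \<partial>PiM J (\<lambda>_. P)) = (\<integral>z. g z \<partial>P)"
proof -
  have "(\<integral>z. g z \<partial>P) = (\<integral>z. g z \<partial>distr (PiM J (\<lambda>_. P)) P (\<lambda>w. w i))"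
    using i P by (subst distr_PiM_component) auto
  also have "\<dots> = (\<integral>w. g (w i) \<partial>PiM J (\<lambda>_. P))"
    using i by (intro integral_distr) auto
  finally show ?thesis by simp
qed

text \<open>Chebyshev's inequality for the mean and Markov's for the second moment, each failing
  with probability at most \<open>1 / 4\<close>. The function \<open>g\<close> is fixed because the
  ghost sample is independent of the data that select it; \<open>J\<close> will be the second half
  of the double sample.\<close>

lemma ghost_sample_prob:
  fixes g :: "'a \<Rightarrow> real"
  assumes P: "prob_space P" and J: "finite (J :: nat set)" "card J = n" "0 < n"
    and g [measurable]: "g \<in> borel_measurable P" and b: "\<And>z. z \<in> space P \<Longrightarrow> \<bar>g z\<bar> \<le> b"
    and \<delta>: "0 < \<delta>" "(\<integral>z. (g z)\<^sup>2 \<partial>P) \<le> \<delta>\<^sup>2"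
  shows "1 / 2 \<le> measure (PiM J (\<lambda>_. P)) {w \<in> space (PiM J (\<lambda>_. P)).
    \<bar>(\<Sum>i\<in>J. g (w i)) / n - (\<integral>z. g z \<partial>P)\<bar> \<le> 2 * \<delta> / sqrt n \<and> (\<Sum>i\<in>J. (g (w i))\<^sup>2) / n \<le> 4 * \<delta>\<^sup>2}"
    (is "_ \<le> measure ?N ?G")
proof -
  interpret P: prob_space P by (rule P)
  interpret N: prob_space ?N by (intro prob_space_PiM P)
  let ?\<mu> = "\<integral>z. g z \<partial>P"
  have comp [measurable]: "(\<lambda>w. g (w i)) \<in> borel_measurable ?N" if "i \<in> J" for i
    using that by measurable
  have bw: "\<bar>g (w i)\<bar> \<le> b" if "i \<in> J" "w \<in> space ?N" for i w
    using that by (intro b) (auto simp: space_PiM)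
  have bsq: "(g z)\<^sup>2 \<le> b\<^sup>2" if "z \<in> space P" for z
    using b[OF that] by (metis abs_ge_zero power2_abs power_mono)
  have gi: "integrable P g"
    by (rule P.integrable_const_bound[where B = b]) (auto intro!: AE_I2 b)
  have gsq: "integrable P (\<lambda>z. (g z)\<^sup>2)"
    by (rule P.integrable_const_bound[where B = "b\<^sup>2"]) (auto intro!: AE_I2 bsq)
  have gw: "integrable ?N (\<lambda>w. (g (w i))\<^sup>2)" if "i \<in> J" for i
    using that bsq
    by (intro N.integrable_const_bound[where B = "b\<^sup>2"] AE_I2 borel_measurable_power comp) (auto simp: space_PiM)
  let ?X = "\<lambda>w. \<Sum>i\<in>J. g (w i) - ?\<mu>"
  let ?Y = "\<lambda>w. \<Sum>i\<in>J. (g (w i))\<^sup>2"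
  have Xmeas [measurable]: "?X \<in> borel_measurable ?N" "?Y \<in> borel_measurable ?N"
    by (intro borel_measurable_sum borel_measurable_diff borel_measurable_power comp borel_measurable_const; assumption)+
  have var: "(\<integral>w. (?X w)\<^sup>2 \<partial>?N) \<le> real n * \<delta>\<^sup>2"
  proof -
    have \<mu>b: "\<bar>?\<mu>\<bar> \<le> b"
    proof -
      have "\<bar>?\<mu>\<bar> \<le> (\<integral>z. \<bar>g z\<bar> \<partial>P)" by (rule integral_abs_bound)
      also have "\<dots> \<le> (\<integral>z. b \<partial>P)" using gi b by (intro integral_mono) auto
      finally show ?thesis by (simp add: P.prob_space)
    qed
    have "(\<integral>w. (\<Sum>i\<in>J. (\<lambda>z. g z - ?\<mu>) (w i))\<^sup>2 \<partial>?N) = real (card J) * (\<integral>z. (g z - ?\<mu>)\<^sup>2 \<partial>P)"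
    proof (rule iid_second_moment[where b = "2 * b"])
      show "\<bar>g z - ?\<mu>\<bar> \<le> 2 * b" if "z \<in> space P" for z
        using b[OF that] \<mu>b by linarith
    qed (use P J gi in \<open>auto simp: P.prob_space\<close>)
    also have "(\<integral>z. (g z - ?\<mu>)\<^sup>2 \<partial>P) = (\<integral>z. (g z)\<^sup>2 \<partial>P) - ?\<mu>\<^sup>2"
      using P.variance_eq[OF gi gsq] .
    also have "\<dots> \<le> \<delta>\<^sup>2" using \<delta> by (smt (verit) zero_le_power2)
    finally show ?thesis using J by (simp add: mult_left_mono)
  qed
  have Xi: "integrable ?N (\<lambda>w. (?X w)\<^sup>2)"
  proof (rule N.integrable_const_bound[where B = "(\<Sum>i\<in>J. b + \<bar>?\<mu>\<bar>)\<^sup>2"])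
    show "AE w in ?N. norm ((?X w)\<^sup>2) \<le> (\<Sum>i\<in>J. b + \<bar>?\<mu>\<bar>)\<^sup>2"
    proof (rule AE_I2)
      fix w assume w: "w \<in> space ?N"
      have "\<bar>?X w\<bar> \<le> (\<Sum>i\<in>J. \<bar>g (w i) - ?\<mu>\<bar>)" by (rule sum_abs)
      also have "\<dots> \<le> (\<Sum>i\<in>J. b + \<bar>?\<mu>\<bar>)"
        by (intro sum_mono order_trans[OF abs_triangle_ineq4] add_mono bw w order_refl)
      finally have "\<bar>?X w\<bar>\<^sup>2 \<le> (\<Sum>i\<in>J. b + \<bar>?\<mu>\<bar>)\<^sup>2" by (intro power_mono) auto
      then show "norm ((?X w)\<^sup>2) \<le> (\<Sum>i\<in>J. b + \<bar>?\<mu>\<bar>)\<^sup>2" by simp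
    qed
  qed measurable
  have pX: "measure ?N {w\<in>space ?N. (?X w)\<^sup>2 \<ge> 4 * real n * \<delta>\<^sup>2} \<le> 1 / 4"
  proof -
    have "measure ?N {w\<in>space ?N. (?X w)\<^sup>2 \<ge> 4 * real n * \<delta>\<^sup>2} \<le> (\<integral>w. (?X w)\<^sup>2 \<partial>?N) / (4 * real n * \<delta>\<^sup>2)"
      using J \<delta> by (intro integral_Markov_inequality_measure[OF Xi sets.empty_sets]) auto
    also have "\<dots> \<le> (real n * \<delta>\<^sup>2) / (4 * real n * \<delta>\<^sup>2)"
      using var by (intro divide_right_mono) auto
    finally show ?thesis using J \<delta> by simp
  qed
  have pY: "measure ?N {w\<in>space ?N. ?Y w \<ge> 4 * real n * \<delta>\<^sup>2} \<le> 1 / 4"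
  proof -
    have "measure ?N {w\<in>space ?N. ?Y w \<ge> 4 * real n * \<delta>\<^sup>2} \<le> (\<integral>w. ?Y w \<partial>?N) / (4 * real n * \<delta>\<^sup>2)"
      using J \<delta> by (intro integral_Markov_inequality_measure[OF _ sets.empty_sets] Bochner_Integration.integrable_sum gw)
        (auto intro!: sum_nonneg)
    also have "(\<integral>w. ?Y w \<partial>?N) = (\<Sum>i\<in>J. \<integral>w. (g (w i))\<^sup>2 \<partial>?N)"
      by (intro Bochner_Integration.integral_sum gw)
    also have "\<dots> = (\<Sum>i\<in>J. \<integral>z. (g z)\<^sup>2 \<partial>P)"
      using P by (intro sum.cong refl iid_mean[of P _ J "\<lambda>z. (g z)\<^sup>2"]) auto
    also have "\<dots> / (4 * real n * \<delta>\<^sup>2) \<le> (real n * \<delta>\<^sup>2) / (4 * real n * \<delta>\<^sup>2)"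
      using J \<delta> by (intro divide_right_mono) (auto intro: mult_left_mono)
    finally show ?thesis using J \<delta> by simp
  qed
  have sub: "space ?N - {w\<in>space ?N. (?X w)\<^sup>2 \<ge> 4 * real n * \<delta>\<^sup>2} - {w\<in>space ?N. ?Y w \<ge> 4 * real n * \<delta>\<^sup>2} \<subseteq> ?G"
  proof
    fix w assume w: "w \<in> space ?N - {w\<in>space ?N. (?X w)\<^sup>2 \<ge> 4 * real n * \<delta>\<^sup>2} - {w\<in>space ?N. ?Y w \<ge> 4 * real n * \<delta>\<^sup>2}"
    have X: "?X w = (\<Sum>i\<in>J. g (w i)) - real n * ?\<mu>"
      using J by (simp add: sum_subtractf)
    have "sqrt ((?X w)\<^sup>2) \<le> sqrt (4 * real n * \<delta>\<^sup>2)"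
      using w by (intro real_sqrt_le_mono) auto
    then have "\<bar>?X w\<bar> \<le> 2 * sqrt (real n) * \<delta>"
      using \<delta> by (simp add: real_sqrt_mult)
    then have "\<bar>?X w\<bar> / n \<le> 2 * sqrt (real n) * \<delta> / n" by (intro divide_right_mono) auto
    also have "2 * sqrt (real n) * \<delta> / n = 2 * \<delta> / sqrt n"
      using J by (simp add: real_div_sqrt field_simps)
    also have "\<bar>?X w\<bar> / n = \<bar>(\<Sum>i\<in>J. g (w i)) / n - ?\<mu>\<bar>"
    proof -
      have "(\<Sum>i\<in>J. g (w i)) / n - ?\<mu> = ?X w / n"
        using J unfolding X by (simp add: diff_divide_distrib)
      then show ?thesis by (simp add: abs_divide)
    qed
    finally show "w \<in> ?G"
      using w J by (auto simp: field_simps)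
  qed
  have "1 / 2 \<le> measure ?N (space ?N) - 1 / 4 - 1 / 4" by (simp add: N.prob_space)
  also have "\<dots> \<le> measure ?N (space ?N - {w\<in>space ?N. (?X w)\<^sup>2 \<ge> 4 * real n * \<delta>\<^sup>2} - {w\<in>space ?N. ?Y w \<ge> 4 * real n * \<delta>\<^sup>2})"
  proof -
    have d: "measure ?N A - measure ?N B \<le> measure ?N (A - B)" if "A \<in> sets ?N" "B \<in> sets ?N" for A B
      using N.finite_measure_Diff'[OF that] N.finite_measure_mono[of "A \<inter> B" B] that by auto
    have m: "{w\<in>space ?N. (?X w)\<^sup>2 \<ge> 4 * real n * \<delta>\<^sup>2} \<in> sets ?N" "{w\<in>space ?N. ?Y w \<ge> 4 * real n * \<delta>\<^sup>2} \<in> sets ?N"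
      by measurable
    show ?thesis
      using d[OF sets.top m(1)] d[OF sets.Diff[OF sets.top m(1)] m(2)] pX pY by linarith
  qed
  also have "\<dots> \<le> measure ?N ?G"
  proof (rule N.finite_measure_mono[OF sub])
    have "?G = {w \<in> space ?N. \<bar>(?X w + real n * ?\<mu>) / n - ?\<mu>\<bar> \<le> 2 * \<delta> / sqrt n \<and> ?Y w / n \<le> 4 * \<delta>\<^sup>2}"
      using J by (simp add: sum_subtractf)
    then show "?G \<in> sets ?N" by simp
  qed
  finally show ?thesis .
qed

section \<open>Exchangeability of the double sample\<close>

text \<open>An involution that multiplies differences between the two halves by the signs and leaves
  sums over the double sample unchanged.\<close>

definition swap_index :: "nat \<Rightarrow> (nat \<Rightarrow> real) \<Rightarrow> nat \<Rightarrow> nat" where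
  "swap_index n e i = (if i < n then (if e i = 1 then i else i + n)
     else (if e (i - n) = 1 then i else i - n))"

lemma bij_betw_swap_index: "bij_betw (swap_index n e) {..<2 * n} {..<2 * n}"
  by (rule bij_betw_byWitness[where f' = "swap_index n e"]) (auto simp: swap_index_def)

lemma integral_PiM_swap:
  fixes h :: "(nat \<Rightarrow> 'a) \<Rightarrow> real"
  assumes "prob_space P" and [measurable]: "h \<in> borel_measurable (samples (2 * n) P)"
  shows "(\<integral>w. h (\<lambda>i\<in>{..<2 * n}. w (swap_index n e i)) \<partial>samples (2 * n) P) = (\<integral>w. h w \<partial>samples (2 * n) P)"
proof -
  let ?N = "samples (2 * n) P"
  let ?t = "\<lambda>w. \<lambda>i\<in>{..<2 * n}. w (swap_index n e i)"
  have b: "inj_on (swap_index n e) {..<2 * n}" "swap_index n e \<in> {..<2 * n} \<rightarrow> {..<2 * n}"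
    using bij_betw_swap_index[of n e] by (auto simp: bij_betw_def)
  have d: "distr ?N ?N ?t = ?N"
    using distr_PiM_reindex[OF _ b, of "\<lambda>_. P"] assms(1) by simp
  have t: "?t \<in> measurable ?N ?N"
    using b(2) by (intro measurable_restrict measurable_component_singleton) auto
  have "(\<integral>w. h w \<partial>?N) = (\<integral>w. h w \<partial>distr ?N ?N ?t)" by (simp only: d)
  also have "\<dots> = (\<integral>w. h (?t w) \<partial>?N)" using t by (intro integral_distr) auto
  finally show ?thesis by simp
qed

text \<open>From \<open>(a - b)\<^sup>2 \<le> 2 * (a\<^sup>2 + b\<^sup>2)\<close>. It leads from the
  norm of the double sample, in which covers are given, to the vectors of differences to which
  chaining is applied.\<close>

lemma L2_set_difference_halves:
  fixes n :: nat
  shows "L2_set (\<lambda>i. a i - a (i + n)) {..<n} \<le> sqrt 2 * L2_set a {..<2 * n}"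
proof -
  have "(\<Sum>i<n. (a i - a (i + n))\<^sup>2) \<le> (\<Sum>i<n. 2 * ((a i)\<^sup>2 + (a (i + n))\<^sup>2))"
  proof (rule sum_mono)
    fix i
    have "0 \<le> (a i + a (i + n))\<^sup>2" by simp
    then show "(a i - a (i + n))\<^sup>2 \<le> 2 * ((a i)\<^sup>2 + (a (i + n))\<^sup>2)"
      by (simp add: power2_sum power2_diff)
  qed
  also have "\<dots> = 2 * (\<Sum>i<2 * n. (a i)\<^sup>2)"
  proof -
    have "(\<Sum>i<2 * n. (a i)\<^sup>2) = (\<Sum>i\<in>{0..<n}. (a i)\<^sup>2) + (\<Sum>i\<in>{n..<n + n}. (a i)\<^sup>2)"
      by (simp add: sum.atLeastLessThan_concat lessThan_atLeast0 mult_2)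
    also have "(\<Sum>i\<in>{n..<n + n}. (a i)\<^sup>2) = (\<Sum>i\<in>{0..<n}. (a (i + n))\<^sup>2)"
      using sum.shift_bounds_nat_ivl[of "\<lambda>i. (a i)\<^sup>2" 0 n n] by simp
    finally show ?thesis by (simp add: sum.distrib sum_distrib_left lessThan_atLeast0)
  qed
  finally have "sqrt (\<Sum>i<n. (a i - a (i + n))\<^sup>2) \<le> sqrt (2 * (\<Sum>i<2 * n. (a i)\<^sup>2))"
    by (rule real_sqrt_le_mono)
  then show ?thesis by (simp add: L2_set_def real_sqrt_mult)
qed

text \<open>Averaging over the sign swaps bounds the swapped differences pointwise in the double sample:
  a measurable selection from the class suffices, and no supremum over the class is formed.\<close>

lemma swapped_average_le:
  assumes cov: "uniform_cover Z F R \<alpha> K" and \<alpha>: "0 < \<alpha>" "\<alpha> < 1" and K: "0 \<le> K" and n: "0 < n"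
    and \<delta>: "0 < \<delta>" "2 * \<delta> \<le> R" and w: "\<And>i. i < 2 * n \<Longrightarrow> w i \<in> Z"
    and u: "\<And>e. e \<in> signs n \<Longrightarrow> u e \<in> F"
  shows "sign_avg n (\<lambda>e. if (\<Sum>i<2 * n. (u e (w i))\<^sup>2) \<le> 5 * real n * \<delta>\<^sup>2
      then \<bar>\<Sum>i<n. e i * (u e (w i) - u e (w (i + n)))\<bar> else 0)
    \<le> 4 * chaining_const \<alpha> * K * sqrt (real n) * \<delta> powr \<alpha>"
proof -
  let ?good = "\<lambda>f. (\<Sum>i<2 * n. (f (w i))\<^sup>2) \<le> 5 * real n * \<delta>\<^sup>2"
  let ?v = "\<lambda>f i. f (w i) - f (w (i + n))"
  \<comment> \<open>Chaining with scale \<open>2 * sqrt n\<close> and radius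
    \<open>2 * \<delta>\<close>: a cover of radius \<open>\<epsilon>\<close> on the double sample
    becomes one of norm \<open>sqrt 2 * sqrt (2 * n) * \<epsilon>\<close> for the differences, and
    the squared norm \<open>5 * n * \<delta>\<^sup>2\<close>, rounded up to
    \<open>8 * n * \<delta>\<^sup>2\<close>, becomes a norm of at most
    \<open>4 * sqrt n * \<delta>\<close>.\<close>
  let ?B = "chaining_const \<alpha> * (2 * sqrt (real n)) * K * (2 * \<delta>) powr \<alpha>"
  have "2 powr \<alpha> \<le> 2 powr 1" using \<alpha> by (intro powr_mono) auto
  then have "(2 * \<delta>) powr \<alpha> \<le> 2 * \<delta> powr \<alpha>"
    using \<delta> by (simp add: powr_mult mult_right_mono)
  then have "?B \<le> chaining_const \<alpha> * (2 * sqrt (real n)) * K * (2 * \<delta> powr \<alpha>)"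
    using K chaining_const_pos[OF \<alpha>(1)] by (intro mult_left_mono) auto
  then have B: "?B \<le> 4 * chaining_const \<alpha> * K * sqrt (real n) * \<delta> powr \<alpha>"
    by (simp add: mult_ac)
  show ?thesis
  proof (cases "\<exists>e\<in>signs n. ?good (u e)")
    case False
    then have "sign_avg n (\<lambda>e. if ?good (u e) then \<bar>\<Sum>i<n. e i * ?v (u e) i\<bar> else 0) \<le> sign_avg n (\<lambda>e. 0)"
      by (intro sign_avg_mono) auto
    also have "\<dots> \<le> 4 * chaining_const \<alpha> * K * sqrt (real n) * \<delta> powr \<alpha>"
      using K chaining_const_pos[OF \<alpha>(1)] by simp
    finally show ?thesis .
  next
    case True
    then obtain e0 where e0: "e0 \<in> signs n" "?good (u e0)" by blast
    \<comment> \<open>Functions violating the norm restriction contribute 0. Replacing them by one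
      that satisfies it does not decrease the average and makes the norm bound hold for every sign
      vector.\<close>
    define u' where "u' e = (if ?good (u e) then u e else u e0)" for e
    have u': "u' e \<in> F" "?good (u' e)" if "e \<in> signs n" for e
      using e0 u that by (auto simp: u'_def)
    have "sign_avg n (\<lambda>e. if ?good (u e) then \<bar>\<Sum>i<n. e i * ?v (u e) i\<bar> else 0)
        \<le> sign_avg n (\<lambda>e. \<bar>\<Sum>i<n. e i * ?v (u' e) i\<bar>)"
      by (intro sign_avg_mono) (auto simp: u'_def)
    also have "\<dots> \<le> ?B"
    proof (rule rademacher_chaining[where V = "?v ` F" and R = R])
      fix \<epsilon> :: real assume \<epsilon>: "0 < \<epsilon>" "\<epsilon> \<le> R"
      have "\<exists>C\<subseteq>F. finite C \<and> C \<noteq> {} \<and> sqrt (ln (2 * real (card C))) \<le> K * \<epsilon> powr (\<alpha> - 1) \<and>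
         (\<forall>f\<in>F. \<exists>g\<in>C. L2_set (\<lambda>i. f (w i) - g (w i)) {..<2 * n} \<le> sqrt (real (2 * n)) * \<epsilon>)"
        using n w \<epsilon> by (intro cov[unfolded uniform_cover_def, rule_format]) auto
      then obtain C where "C \<subseteq> F \<and> finite C \<and> C \<noteq> {} \<and> sqrt (ln (2 * real (card C))) \<le> K * \<epsilon> powr (\<alpha> - 1) \<and>
         (\<forall>f\<in>F. \<exists>g\<in>C. L2_set (\<lambda>i. f (w i) - g (w i)) {..<2 * n} \<le> sqrt (real (2 * n)) * \<epsilon>)" ..
      then have C: "C \<subseteq> F" "finite C" "C \<noteq> {}" "sqrt (ln (2 * real (card C))) \<le> K * \<epsilon> powr (\<alpha> - 1)"
        and near: "\<And>f. f \<in> F \<Longrightarrow> \<exists>g\<in>C. L2_set (\<lambda>i. f (w i) - g (w i)) {..<2 * n} \<le> sqrt (real (2 * n)) * \<epsilon>"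
        by (simp_all del: of_nat_mult)
      have card: "0 < card (?v ` C)" "card (?v ` C) \<le> card C"
        using C by (auto simp: card_gt_0_iff intro: card_image_le)
      have "sqrt (ln (2 * real (card (?v ` C)))) \<le> sqrt (ln (2 * real (card C)))"
        using card by (intro real_sqrt_le_mono ln_mono) auto
      then have ln: "sqrt (ln (2 * real (card (?v ` C)))) \<le> K * \<epsilon> powr (\<alpha> - 1)"
        using C(4) by linarith
      have cover: "\<exists>c\<in>?v ` C. L2_set (\<lambda>i. v i - c i) {..<n} \<le> 2 * sqrt (real n) * \<epsilon>" if v: "v \<in> ?v ` F" for v
      proof -
        obtain f where f: "f \<in> F" "v = ?v f" using v by blast
        obtain g where g: "g \<in> C" "L2_set (\<lambda>i. f (w i) - g (w i)) {..<2 * n} \<le> sqrt (real (2 * n)) * \<epsilon>"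
          using near[OF f(1)] by blast
        have "L2_set (\<lambda>i. v i - ?v g i) {..<n}
            = L2_set (\<lambda>i. (f (w i) - g (w i)) - (f (w (i + n)) - g (w (i + n)))) {..<n}"
          by (simp add: f algebra_simps)
        also have "\<dots> \<le> sqrt 2 * L2_set (\<lambda>i. f (w i) - g (w i)) {..<2 * n}"
          by (rule L2_set_difference_halves[of "\<lambda>i. f (w i) - g (w i)"])
        also have "\<dots> \<le> sqrt 2 * (sqrt (real (2 * n)) * \<epsilon>)" using g by (intro mult_left_mono) auto
        also have "\<dots> = 2 * sqrt (real n) * \<epsilon>" by (simp add: real_sqrt_mult)
        finally show ?thesis using g(1) by (intro bexI[of _ "?v g"]) auto
      qed
      show "\<exists>C. finite C \<and> C \<noteq> {} \<and> sqrt (ln (2 * real (card C))) \<le> K * \<epsilon> powr (\<alpha> - 1) \<and>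
          (\<forall>v\<in>?v ` F. \<exists>c\<in>C. L2_set (\<lambda>i. v i - c i) {..<n} \<le> 2 * sqrt (real n) * \<epsilon>)"
        using C ln cover by (intro exI[of _ "?v ` C"]) auto
    next
      fix e assume e: "e \<in> signs n"
      show "?v (u' e) \<in> ?v ` F" using u'[OF e] by blast
      have "L2_set (?v (u' e)) {..<n} \<le> sqrt 2 * L2_set (\<lambda>i. u' e (w i)) {..<2 * n}"
        by (rule L2_set_difference_halves[of "\<lambda>i. u' e (w i)"])
      also have "\<dots> \<le> sqrt 2 * sqrt (8 * real n * \<delta>\<^sup>2)"
      proof -
        have "5 * real n * \<delta>\<^sup>2 \<le> 8 * real n * \<delta>\<^sup>2" by (intro mult_right_mono) auto
        then have "sqrt (\<Sum>i<2 * n. (u' e (w i))\<^sup>2) \<le> sqrt (8 * real n * \<delta>\<^sup>2)"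
          using u'(2)[OF e] by (intro real_sqrt_le_mono) linarith
        then show ?thesis by (simp add: L2_set_def mult_left_mono)
      qed
      also have "\<dots> = 2 * sqrt (real n) * (2 * \<delta>)"
        using \<delta> by (simp add: flip: real_sqrt_mult) (simp add: real_sqrt_mult)
      finally show "L2_set (?v (u' e)) {..<n} \<le> 2 * sqrt (real n) * (2 * \<delta>)" .
    qed (use \<alpha> \<delta> K in auto)
    finally show ?thesis using B by linarith
  qed
qed

text \<open>\<open>u w\<close> is selected from the first half of the double sample, so a swap
  changes the selected function as well. The average over swaps therefore involves a function
  depending on the signs, which is the situation of \<open>swapped_average_le\<close>. The
  truncation in \<open>h\<close> restricts to functions of small norm on the double sample.\<close>

lemma symmetrized_expectation_le:
  fixes f :: "(nat \<Rightarrow> 'a) \<Rightarrow> 'a \<Rightarrow> real"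
  assumes P: "prob_space P" and n: "0 < n" and \<alpha>: "0 < \<alpha>" "\<alpha> < 1" and K: "0 \<le> K"
    and cov: "uniform_cover (space P) F R \<alpha> K" and \<delta>: "0 < \<delta>" "2 * \<delta> \<le> R"
    and f: "\<And>y. y \<in> space (samples n P) \<Longrightarrow> f y \<in> F"
    and b: "\<And>g z. g \<in> F \<Longrightarrow> z \<in> space P \<Longrightarrow> \<bar>g z\<bar> \<le> b"
    and meas [measurable]: "(\<lambda>(y, z). f y z) \<in> borel_measurable (samples n P \<Otimes>\<^sub>M P)"
  defines "u \<equiv> \<lambda>w. f (restrict w {..<n})"
  defines "h \<equiv> \<lambda>w. if (\<Sum>i<2 * n. (u w (w i))\<^sup>2) \<le> 5 * real n * \<delta>\<^sup>2
      then \<bar>\<Sum>i<n. u w (w i) - u w (w (i + n))\<bar> else 0"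
  shows "integrable (samples (2 * n) P) h"
    "(\<integral>w. h w \<partial>samples (2 * n) P) \<le> 4 * chaining_const \<alpha> * K * sqrt (real n) * \<delta> powr \<alpha>"
proof -
  let ?N = "samples (2 * n) P"
  let ?B = "4 * chaining_const \<alpha> * K * sqrt (real n) * \<delta> powr \<alpha>"
  let ?t = "\<lambda>e w. \<lambda>i\<in>{..<2 * n}. w (swap_index n e i)"
  interpret N: prob_space ?N by (intro prob_space_PiM P)
  have res [measurable]: "(\<lambda>w. restrict w {..<n}) \<in> measurable ?N (samples n P)"
    by (intro measurable_restrict measurable_component_singleton) auto
  have um [measurable]: "(\<lambda>w. u w (w i)) \<in> borel_measurable ?N" if "i < 2 * n" for i
  proof -
    have "(\<lambda>w. (restrict w {..<n}, w i)) \<in> measurable ?N (samples n P \<Otimes>\<^sub>M P)"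
      using that by (intro measurable_Pair res measurable_component_singleton) auto
    from measurable_compose[OF this meas] show ?thesis by (simp add: u_def)
  qed
  have um' [measurable]: "(\<lambda>w. u w (w (i + n))) \<in> borel_measurable ?N" if "i < n" for i
    using um[of "i + n"] that by simp
  have [measurable]: "(\<lambda>w. \<Sum>i<2 * n. (u w (w i))\<^sup>2) \<in> borel_measurable ?N"
    "(\<lambda>w. \<Sum>i<n. u w (w i) - u w (w (i + n))) \<in> borel_measurable ?N"
    by (intro borel_measurable_sum borel_measurable_power borel_measurable_diff um um'; simp)+
  have hm [measurable]: "h \<in> borel_measurable ?N"
    unfolding h_def
    by measurable
  have swp: "swap_index n e i < 2 * n" if "i < 2 * n" for e i
    using that by (auto simp: swap_index_def)
  have u_mem: "u w \<in> F" if "w \<in> space ?N" for w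
    unfolding u_def using measurable_space[OF res that] by (rule f)
  have ub: "\<bar>u w (w i)\<bar> \<le> b" if "w \<in> space ?N" "i < 2 * n" for w i
    using that by (intro b u_mem) (auto simp: space_PiM)
  have hb: "\<bar>h w\<bar> \<le> (\<Sum>i<n. b + b)" if "w \<in> space ?N" for w
  proof -
    have "\<bar>h w\<bar> \<le> \<bar>\<Sum>i<n. u w (w i) - u w (w (i + n))\<bar>" by (simp add: h_def)
    also have "\<dots> \<le> (\<Sum>i<n. \<bar>u w (w i) - u w (w (i + n))\<bar>)" by (rule sum_abs)
    also have "\<dots> \<le> (\<Sum>i<n. b + b)"
      using that by (intro sum_mono order_trans[OF abs_triangle_ineq4] add_mono ub) auto
    finally show ?thesis .
  qed
  have tm [measurable]: "?t e \<in> measurable ?N ?N" for e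
    using swp by (intro measurable_restrict measurable_component_singleton) auto
  have int: "integrable ?N (\<lambda>w. h (?t e w))" for e
  proof (rule N.integrable_const_bound[where B = "\<Sum>i<n. b + b"])
    show "AE w in ?N. norm (h (?t e w)) \<le> (\<Sum>i<n. b + b)"
      unfolding real_norm_def by (intro AE_I2 hb measurable_space[OF tm])
  qed measurable
  show hi: "integrable ?N h"
    by (rule N.integrable_const_bound[where B = "\<Sum>i<n. b + b"], unfold real_norm_def, intro AE_I2 hb, assumption, rule hm)
  have pw: "sign_avg n (\<lambda>e. h (?t e w)) \<le> ?B" if w: "w \<in> space ?N" for w
  proof -
    have "sign_avg n (\<lambda>e. h (?t e w))
      \<le> sign_avg n (\<lambda>e. if (\<Sum>i<2 * n. (u (?t e w) (w i))\<^sup>2) \<le> 5 * real n * \<delta>\<^sup>2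
      then \<bar>\<Sum>i<n. e i * (u (?t e w) (w i) - u (?t e w) (w (i + n)))\<bar> else 0)"
    proof (rule sign_avg_mono)
      fix e assume e: "e \<in> signs n"
      \<comment> \<open>The function selected after the swap is frozen: the permutation leaves its
        sum of squares over the double sample unchanged and multiplies the \<open>i\<close>-th
        difference by \<open>e i\<close>.\<close>
      let ?g = "u (?t e w)"
      have "(\<Sum>i<2 * n. (?g (?t e w i))\<^sup>2) = (\<Sum>i<2 * n. (?g (w (swap_index n e i)))\<^sup>2)"
        by simp
      also have "\<dots> = (\<Sum>i<2 * n. (?g (w i))\<^sup>2)"
        using sum.reindex_bij_betw[OF bij_betw_swap_index, of "\<lambda>i. (?g (w i))\<^sup>2" n e] .
      finally have 1: "(\<Sum>i<2 * n. (?g (?t e w i))\<^sup>2) = (\<Sum>i<2 * n. (?g (w i))\<^sup>2)" .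
      have 2: "(\<Sum>i<n. ?g (?t e w i) - ?g (?t e w (i + n))) = (\<Sum>i<n. e i * (?g (w i) - ?g (w (i + n))))"
      proof (rule sum.cong[OF refl])
        fix i assume i: "i \<in> {..<n}"
        then have "e i \<in> {- 1, 1}" using e unfolding signs_def by (auto dest: PiE_mem)
        then show "?g (?t e w i) - ?g (?t e w (i + n)) = e i * (?g (w i) - ?g (w (i + n)))"
          using i by (auto simp: swap_index_def)
      qed
      show "h (?t e w) \<le> (if (\<Sum>i<2 * n. (?g (w i))\<^sup>2) \<le> 5 * real n * \<delta>\<^sup>2
         then \<bar>\<Sum>i<n. e i * (?g (w i) - ?g (w (i + n)))\<bar> else 0)"
        unfolding h_def 1 2 by (rule order_refl)
    qed
    also have "\<dots> \<le> ?B"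
    proof (rule swapped_average_le[OF cov \<alpha> K n \<delta>])
      show "w i \<in> space P" if "i < 2 * n" for i using w that by (auto simp: space_PiM)
      show "u (?t e w) \<in> F" for e by (rule u_mem[OF measurable_space[OF tm w]])
    qed
    finally show ?thesis .
  qed
  \<comment> \<open>Every swap preserves the law of the double sample, so the expectation equals its
    average over all swaps, and that average is bounded pointwise.\<close>
  have "(\<integral>w. h w \<partial>?N) = sign_avg n (\<lambda>e. \<integral>w. h (?t e w) \<partial>?N)"
    by (simp only: integral_PiM_swap[OF P hm] sign_avg_const)
  also have "\<dots> = (\<integral>w. sign_avg n (\<lambda>e. h (?t e w)) \<partial>?N)"
    using int by (simp add: sign_avg_def Bochner_Integration.integral_sum)
  also have "\<dots> \<le> (\<integral>w. ?B \<partial>?N)"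
    using int pw by (intro integral_mono) (auto simp: sign_avg_def)
  finally show "(\<integral>w. h w \<partial>?N) \<le> ?B" by (simp add: N.prob_space)
qed

text \<open>The 16 is the 4 of the expectation bound, doubled by Markov's inequality at level
  \<open>n * t / 2\<close> and doubled again by the ghost probability \<open>1 / 2\<close>. The
  second summand makes the tail bound at least 1 when
  \<open>t < 4 * \<delta> / sqrt n\<close>.\<close>

definition tail_const :: "real \<Rightarrow> real \<Rightarrow> real \<Rightarrow> real" where
  "tail_const \<alpha> R K = 16 * chaining_const \<alpha> * K + 4 * R powr (1 - \<alpha>)"

text \<open>Symmetrization in probability. On \<open>E\<close>, with probability at least
  \<open>1 / 2\<close>, the ghost mean is so close to the true mean that the two half-sample means
  differ by at least \<open>t / 2\<close>, and the double sample meets the norm restriction.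
  Integrating over the ghost sample compares \<open>E\<close> with an event of the double sample, to
  which Markov's inequality applies.\<close>

lemma localized_tail:
  fixes f :: "(nat \<Rightarrow> 'a) \<Rightarrow> 'a \<Rightarrow> real"
  assumes P: "prob_space P" and n: "0 < n" and \<alpha>: "0 < \<alpha>" "\<alpha> < 1" and K: "0 \<le> K"
    and cov: "uniform_cover (space P) F R \<alpha> K" and \<delta>: "0 < \<delta>" "2 * \<delta> \<le> R" and t: "0 < t"
    and f: "\<And>y. y \<in> space (samples n P) \<Longrightarrow> f y \<in> F"
    and b: "\<And>g z. g \<in> F \<Longrightarrow> z \<in> space P \<Longrightarrow> \<bar>g z\<bar> \<le> b"
    and meas [measurable]: "(\<lambda>(y, z). f y z) \<in> borel_measurable (samples n P \<Otimes>\<^sub>M P)"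
  defines "E \<equiv> {y \<in> space (samples n P). t < \<bar>(\<Sum>i<n. f y (y i)) / n - (\<integral>z. f y z \<partial>P)\<bar> \<and>
      (\<Sum>i<n. (f y (y i))\<^sup>2) / n \<le> \<delta>\<^sup>2 \<and> (\<integral>z. (f y z)\<^sup>2 \<partial>P) \<le> \<delta>\<^sup>2}"
  shows "E \<in> sets (samples n P)"
    "measure (samples n P) E \<le> tail_const \<alpha> R K * \<delta> powr \<alpha> / (sqrt n * t)"
proof -
  let ?I = "{..<n}" and ?J = "{n..<2 * n}" and ?I2 = "{..<2 * n}"
  let ?N = "\<lambda>I. PiM I (\<lambda>_::nat. P)"
  interpret P: prob_space P by (rule P)
  interpret N: prob_space "?N ?I" by (intro prob_space_PiM P)
  interpret J: prob_space "?N ?J" by (intro prob_space_PiM P)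
  interpret N2: prob_space "?N ?I2" by (intro prob_space_PiM P)
  interpret prod: product_sigma_finite "\<lambda>_::nat. P" by unfold_locales
  have fm [measurable]: "(\<lambda>y. f y (y i)) \<in> borel_measurable (?N ?I)" if "i < n" for i
  proof -
    have "(\<lambda>y. (y, y i)) \<in> measurable (?N ?I) (?N ?I \<Otimes>\<^sub>M P)"
      using that by (intro measurable_Pair measurable_component_singleton) auto
    from measurable_compose[OF this meas] show ?thesis by simp
  qed
  have sm [measurable]: "(\<lambda>y. \<Sum>i<n. f y (y i)) \<in> borel_measurable (?N ?I)"
    "(\<lambda>y. \<Sum>i<n. (f y (y i))\<^sup>2) \<in> borel_measurable (?N ?I)"
    by (intro borel_measurable_sum borel_measurable_power fm; simp)+
  have im [measurable]: "(\<lambda>y. \<integral>z. f y z \<partial>P) \<in> borel_measurable (?N ?I)"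
    "(\<lambda>y. \<integral>z. (f y z)\<^sup>2 \<partial>P) \<in> borel_measurable (?N ?I)"
    by measurable
  show E: "E \<in> sets (?N ?I)"
    unfolding E_def by measurable
  have C: "0 \<le> chaining_const \<alpha>" using chaining_const_pos[OF \<alpha>(1)] by simp
  have R: "0 < R" using \<delta> by simp
  show "measure (?N ?I) E \<le> tail_const \<alpha> R K * \<delta> powr \<alpha> / (sqrt n * t)"
  proof (cases "t < 4 * \<delta> / sqrt n")
    \<comment> \<open>For such small \<open>t\<close> the ghost mean is not close enough to the true
      mean, but the claimed bound is then at least 1.\<close>
    case True
    have "measure (?N ?I) E \<le> 1" by (rule N.prob_le_1)
    also have "1 = R powr (1 - \<alpha>) * R powr (\<alpha> - 1)" using R by (simp flip: powr_add)
    also have "\<dots> \<le> R powr (1 - \<alpha>) * \<delta> powr (\<alpha> - 1)"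
      using \<delta> \<alpha> by (intro mult_left_mono powr_mono2') auto
    also have "\<dots> = 4 * R powr (1 - \<alpha>) * \<delta> powr \<alpha> / (4 * \<delta>)"
      using \<delta> by (simp add: powr_diff)
    also have "\<dots> \<le> 4 * R powr (1 - \<alpha>) * \<delta> powr \<alpha> / (sqrt n * t)"
      using True n t \<delta> by (intro divide_left_mono) (auto simp: field_simps)
    also have "\<dots> \<le> tail_const \<alpha> R K * \<delta> powr \<alpha> / (sqrt n * t)"
      using C K t by (intro divide_right_mono mult_right_mono) (auto simp: tail_const_def)
    finally show ?thesis .
  next
    case False
    let ?u = "\<lambda>w. f (restrict w {..<n})"
    let ?h = "\<lambda>w. if (\<Sum>i<2 * n. (?u w (w i))\<^sup>2) \<le> 5 * real n * \<delta>\<^sup>2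
      then \<bar>\<Sum>i<n. ?u w (w i) - ?u w (w (i + n))\<bar> else 0"
    have h: "integrable (?N ?I2) ?h"
      "(\<integral>w. ?h w \<partial>?N ?I2) \<le> 4 * chaining_const \<alpha> * K * sqrt (real n) * \<delta> powr \<alpha>"
      by (rule symmetrized_expectation_le(1)[where b = b, OF P n \<alpha> K cov \<delta>]; (rule meas | erule f | erule (1) b))
        (rule symmetrized_expectation_le(2)[where b = b, OF P n \<alpha> K cov \<delta>]; (rule meas | erule f | erule (1) b))
    define A where "A = {w \<in> space (?N ?I2). n * t / 2 \<le> ?h w}"
    have A_sets: "A \<in> sets (?N ?I2)"
      unfolding A_def using borel_measurable_integrable[OF h(1)] by measurable
    have "measure (?N ?I2) A \<le> (\<integral>w. ?h w \<partial>?N ?I2) / (n * t / 2)"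
      unfolding A_def using n t by (intro integral_Markov_inequality_measure[OF h(1) sets.empty_sets]) auto
    also have "\<dots> \<le> (4 * chaining_const \<alpha> * K * sqrt (real n) * \<delta> powr \<alpha>) / (n * t / 2)"
      using n t by (intro divide_right_mono h(2)) auto
    also have "\<dots> = 8 * chaining_const \<alpha> * K * \<delta> powr \<alpha> / (sqrt n * t)"
      using n t by (simp add: field_simps)
    finally have mA: "measure (?N ?I2) A \<le> 8 * chaining_const \<alpha> * K * \<delta> powr \<alpha> / (sqrt n * t)" .
    \<comment> \<open>Conditionally on the first half: a point of \<open>E\<close> is completed to a
      point of \<open>A\<close> with ghost probability at least \<open>1 / 2\<close>.\<close>
    have section_: "(indicator E y / 2 :: real) \<le> (\<integral>x. indicator A (merge ?I ?J (y, x)) \<partial>?N ?J)"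
      if y: "y \<in> space (?N ?I)" for y
    proof (cases "y \<in> E")
      case yE: True
      let ?g = "f y"
      let ?G = "{x \<in> space (?N ?J). \<bar>(\<Sum>i\<in>?J. ?g (x i)) / n - (\<integral>z. ?g z \<partial>P)\<bar> \<le> 2 * \<delta> / sqrt n \<and>
        (\<Sum>i\<in>?J. (?g (x i))\<^sup>2) / n \<le> 4 * \<delta>\<^sup>2}"
      have gm: "?g \<in> borel_measurable P"
        using measurable_compose[OF measurable_Pair1'[OF y] meas] by simp
      have "1 / 2 \<le> measure (?N ?J) ?G"
        using yE n by (intro ghost_sample_prob[OF P _ _ n gm b[OF f[OF y]] \<delta>(1)]) (auto simp: E_def)
      also have "\<dots> \<le> measure (?N ?J) {x \<in> space (?N ?J). merge ?I ?J (y, x) \<in> A}"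
      proof (rule J.finite_measure_mono)
        show "{x \<in> space (?N ?J). merge ?I ?J (y, x) \<in> A} \<in> sets (?N ?J)"
        proof -
          have "(\<lambda>x. merge ?I ?J (y, x)) \<in> measurable (?N ?J) (?N (?I \<union> ?J))"
            by (rule measurable_compose[OF measurable_Pair1'[OF y] measurable_merge])
          moreover have "?I \<union> ?J = ?I2" by auto
          ultimately have "(\<lambda>x. merge ?I ?J (y, x)) \<in> measurable (?N ?J) (?N ?I2)" by simp
          from measurable_sets[OF this A_sets] show ?thesis by (simp add: vimage_def Int_def conj_commute)
        qed
        show "?G \<subseteq> {x \<in> space (?N ?J). merge ?I ?J (y, x) \<in> A}"
        proof
          fix x assume xG: "x \<in> ?G"
          let ?w = "merge ?I ?J (y, x)"
          have xs: "x \<in> space (?N ?J)" using xG by simp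
          have w: "?w \<in> space (?N ?I2)"
          proof -
            have "?w \<in> space (?N (?I \<union> ?J))"
              using y xs by (intro measurable_space[OF measurable_merge]) (auto simp: space_pair_measure)
            moreover have "?I \<union> ?J = ?I2" by auto
            ultimately show ?thesis by simp
          qed
          have "restrict ?w ?I = y"
            using y by (auto simp: space_PiM PiE_def extensional_def restrict_def merge_def fun_eq_iff)
          then have uw: "?u ?w = ?g" by simp
          have w1: "?w i = y i" if "i < n" for i using that by (simp add: merge_def)
          have w2: "?w (i + n) = x (i + n)" if "i < n" for i using that by (simp add: merge_def)
          have shift: "(\<Sum>i<n. p (x (i + n))) = (\<Sum>i\<in>?J. p (x i))" for p :: "'a \<Rightarrow> real"
            using sum.shift_bounds_nat_ivl[of "\<lambda>i. p (x i)" 0 n n] by (simp add: lessThan_atLeast0 mult_2)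
          have split: "(\<Sum>i<2 * n. p (?w i)) = (\<Sum>i<n. p (y i)) + (\<Sum>i\<in>?J. p (x i))" for p :: "'a \<Rightarrow> real"
          proof -
            have "(\<Sum>i<2 * n. p (?w i)) = (\<Sum>i<n. p (?w i)) + (\<Sum>i\<in>?J. p (?w i))"
              unfolding lessThan_atLeast0 by (rule sum.atLeastLessThan_concat[symmetric]) auto
            also have "(\<Sum>i<n. p (?w i)) = (\<Sum>i<n. p (y i))"
              using w1 by (intro sum.cong) auto
            also have "(\<Sum>i\<in>?J. p (?w i)) = (\<Sum>i\<in>?J. p (x i))"
              by (intro sum.cong refl) (simp add: merge_def)
            finally show ?thesis .
          qed
          have y1: "(\<Sum>i<n. (?g (y i))\<^sup>2) \<le> \<delta>\<^sup>2 * n" and y2: "(\<Sum>i\<in>?J. (?g (x i))\<^sup>2) \<le> 4 * \<delta>\<^sup>2 * n"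
            using yE xG n by (auto simp: E_def field_simps)
          \<comment> \<open>The 5 is \<open>1 + 4\<close>: the data contribute
            \<open>n * \<delta>\<^sup>2\<close> and the ghost sample
            \<open>4 * n * \<delta>\<^sup>2\<close>.\<close>
          have good: "(\<Sum>i<2 * n. (?g (?w i))\<^sup>2) \<le> 5 * real n * \<delta>\<^sup>2"
            unfolding split[of "\<lambda>z. (?g z)\<^sup>2"] using y1 y2 by (simp add: algebra_simps)
          have diff: "(\<Sum>i<n. ?g (?w i) - ?g (?w (i + n))) = (\<Sum>i<n. ?g (y i)) - (\<Sum>i\<in>?J. ?g (x i))"
            using w1 w2 by (simp add: sum_subtractf shift)
          have "2 * (2 * \<delta> / sqrt n) \<le> t" using False by simp
          then have "t / 2 \<le> \<bar>(\<Sum>i<n. ?g (y i)) / n - (\<Sum>i\<in>?J. ?g (x i)) / n\<bar>"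
            using yE xG unfolding E_def mem_Collect_eq by linarith
          also have "\<dots> = \<bar>(\<Sum>i<n. ?g (y i)) - (\<Sum>i\<in>?J. ?g (x i))\<bar> / n"
            by (simp flip: diff_divide_distrib)
          finally have "n * t / 2 \<le> \<bar>(\<Sum>i<n. ?g (y i)) - (\<Sum>i\<in>?J. ?g (x i))\<bar>"
            using n by (simp add: field_simps)
          then have "?w \<in> A"
            using w good by (simp add: A_def uw diff)
          then show "x \<in> {x \<in> space (?N ?J). merge ?I ?J (y, x) \<in> A}" using xs by blast
        qed
      qed
      also have "\<dots> = (\<integral>x. indicator {x \<in> space (?N ?J). merge ?I ?J (y, x) \<in> A} x \<partial>?N ?J)"
        unfolding Bochner_Integration.integral_indicator by (rule arg_cong[where f = "measure _"]) blast
      also have "\<dots> = (\<integral>x. indicator A (merge ?I ?J (y, x)) \<partial>?N ?J)"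
        by (intro Bochner_Integration.integral_cong refl) (auto simp: indicator_def)
      finally show ?thesis using yE by simp
    qed (auto intro!: Bochner_Integration.integral_nonneg)
    have indA: "integrable (?N ?I2) (indicator A :: _ \<Rightarrow> real)"
      using A_sets by (intro N2.integrable_const_bound[where B = 1]) (auto simp: indicator_def)
    have IJ: "?I \<union> ?J = ?I2" "?I \<inter> ?J = {}" by auto
    have "measure (?N ?I) E / 2 = (\<integral>y. indicator E y / 2 \<partial>?N ?I)"
      using E by (simp add: Int_absorb1 sets.sets_into_space)
    also have "\<dots> \<le> (\<integral>y. (\<integral>x. indicator A (merge ?I ?J (y, x)) \<partial>?N ?J) \<partial>?N ?I)"
    proof (rule integral_mono)
      show "integrable (?N ?I) (\<lambda>y. indicator E y / 2 :: real)"
        using E by (intro N.integrable_const_bound[where B = 1]) (auto simp: indicator_def)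
      have mm: "(\<lambda>(y, x). indicator A (merge ?I ?J (y, x)) :: real) \<in> borel_measurable (?N ?I \<Otimes>\<^sub>M ?N ?J)"
      proof -
        have "merge ?I ?J \<in> measurable (?N ?I \<Otimes>\<^sub>M ?N ?J) (?N ?I2)"
          using measurable_merge[of ?I ?J "\<lambda>_. P"] IJ by simp
        from measurable_compose[OF this borel_measurable_indicator[OF A_sets]] show ?thesis
          by (simp only: case_prod_unfold prod.collapse)
      qed
      show "integrable (?N ?I) (\<lambda>y. \<integral>x. indicator A (merge ?I ?J (y, x)) \<partial>?N ?J :: real)"
      proof (rule N.integrable_const_bound[where B = 1])
        show "(\<lambda>y. \<integral>x. indicator A (merge ?I ?J (y, x)) \<partial>?N ?J :: real) \<in> borel_measurable (?N ?I)"
          by (rule J.borel_measurable_lebesgue_integral[OF mm])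
        show "AE y in ?N ?I. norm (\<integral>x. indicator A (merge ?I ?J (y, x)) \<partial>?N ?J :: real) \<le> 1"
        proof (rule AE_I2)
          fix y
          have "(\<integral>x. indicator A (merge ?I ?J (y, x)) \<partial>?N ?J :: real) \<le> 1"
            by (cases "integrable (?N ?J) (\<lambda>x. indicator A (merge ?I ?J (y, x)) :: real)")
              (auto intro!: J.integral_le_const simp: not_integrable_integral_eq indicator_le_1)
          then show "norm (\<integral>x. indicator A (merge ?I ?J (y, x)) \<partial>?N ?J :: real) \<le> 1"
            by (simp add: Bochner_Integration.integral_nonneg)
        qed
      qed
    qed (rule section_)
    also have "\<dots> = (\<integral>w. indicator A w \<partial>?N ?I2)"
      using prod.product_integral_fold[of ?I ?J "indicator A :: _ \<Rightarrow> real"] indA unfolding IJ by simp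
    also have "\<dots> = measure (?N ?I2) A"
      using A_sets by (simp add: Int_absorb1 sets.sets_into_space)
    also note mA
    finally have "measure (?N ?I) E \<le> 16 * chaining_const \<alpha> * K * \<delta> powr \<alpha> / (sqrt n * t)" by simp
    also have "\<dots> \<le> tail_const \<alpha> R K * \<delta> powr \<alpha> / (sqrt n * t)"
      using t by (intro divide_right_mono mult_right_mono) (auto simp: tail_const_def)
    finally show ?thesis .
  qed
qed

section \<open>The joint law of the data and the bootstrap sample\<close>

abbreviation sample_pairs :: "nat \<Rightarrow> 'a measure \<Rightarrow> ((nat \<Rightarrow> 'a) \<times> (nat \<Rightarrow> 'a)) measure" where
  "sample_pairs n S \<equiv> samples n S \<Otimes>\<^sub>M samples n S"

abbreviation indices :: "nat \<Rightarrow> (nat \<Rightarrow> nat) measure" where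
  "indices n \<equiv> samples n (uniform_count_measure {..<n})"

lemma sets_samples_cong: "sets P = sets S \<Longrightarrow> sets (samples n P) = sets (samples n S)"
  by (intro sets_PiM_cong) auto

lemma samples_mem: "x \<in> space (samples n S) \<Longrightarrow> i < n \<Longrightarrow> x i \<in> space S"
  by (auto simp: space_PiM)

text \<open>The empirical measure is the pushforward of the uniform index law under
  \<open>x\<close>, and a product of pushforwards is the pushforward of the product.\<close>

lemma boot_law_emp:
  assumes n: "0 < n" and x: "x \<in> space (samples n S)"
  shows "boot_law n (emp S n x) =
    distr (indices n) (samples n S) (compose {..<n} x)"
proof -
  let ?U = "uniform_count_measure {..<n}"
  have U: "prob_space ?U" using n by (intro prob_space_uniform_count_measure) auto
  have E: "prob_space (emp S n x)" using n samples_mem[OF x] by (intro prob_space_emp) auto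
  have "distr (samples n ?U) (samples n (emp S n x)) (compose {..<n} x) = PiM {..<n} (\<lambda>i. distr ?U (emp S n x) x)"
    using U E samples_mem[OF x] by (intro distr_PiM_finite_prob_space') auto
  also have "distr ?U (emp S n x) x = emp S n x"
    unfolding emp_def by (rule distr_cong) auto
  also have "distr (samples n ?U) (samples n (emp S n x)) (compose {..<n} x) = distr (samples n ?U) (samples n S) (compose {..<n} x)"
    by (intro distr_cong refl sets_samples_cong) simp
  finally show ?thesis by (simp add: boot_law_def)
qed

lemma sets_boot_law_emp [simp]: "sets (boot_law n (emp S n x)) = sets (samples n S)"
  unfolding boot_law_def by (intro sets_samples_cong) simp

lemma space_boot_law_emp [simp]: "space (boot_law n (emp S n x)) = space (samples n S)"
  by (rule sets_eq_imp_space_eq) simp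

lemma prob_space_boot_law_emp:
  assumes "0 < n" "x \<in> space (samples n S)"
  shows "prob_space (boot_law n (emp S n x))"
  unfolding boot_law_def
  by (rule prob_space_PiM, rule prob_space_emp[OF assms(1)], rule samples_mem[OF assms(2)])

text \<open>The index at which the data are read is itself random, but it takes finitely many
  values, each giving a measurable coordinate projection.\<close>

lemma measurable_resample:
  "(\<lambda>(x, j). compose {..<n} x j) \<in> measurable (samples n S \<Otimes>\<^sub>M indices n) (samples n S)"
proof -
  let ?U = "uniform_count_measure {..<n}" and ?M = "samples n S \<Otimes>\<^sub>M indices n"
  have "(\<lambda>p. \<lambda>i\<in>{..<n}. fst p (snd p i)) \<in> measurable ?M (samples n S)"
  proof (rule measurable_restrict)
    fix i assume i: "i \<in> {..<n}"
    show "(\<lambda>p. fst p (snd p i)) \<in> measurable ?M S"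
    proof (rule measurable_compose_countable'[where I = "{..<n}" and f = "\<lambda>k p. fst p k" and g = "\<lambda>p. snd p i"])
      show "(\<lambda>p. fst p k) \<in> measurable ?M S" if "k \<in> {..<n}" for k
        by (rule measurable_compose[OF measurable_fst measurable_component_singleton[OF that]])
      have "(\<lambda>p. snd p i) \<in> measurable ?M ?U"
        by (rule measurable_compose[OF measurable_snd measurable_component_singleton[OF i]])
      moreover have "measurable ?M ?U = measurable ?M (count_space {..<n})"
        by (rule measurable_cong_sets) (simp_all add: sets_uniform_count_measure)
      ultimately show "(\<lambda>p. snd p i) \<in> measurable ?M (count_space {..<n})" by simp
    qed simp
  qed
  then show ?thesis by (simp add: compose_def case_prod_unfold)
qed

section \<open>The joint law on the underlying probability space\<close>

locale iid_bootstrap = prob_space \<Omega> for \<Omega> :: "'w measure" +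
  fixes S P0 :: "'a measure" and X :: "nat \<Rightarrow> 'w \<Rightarrow> 'a" and Xs :: "nat \<Rightarrow> nat \<Rightarrow> 'w \<Rightarrow> 'a"
  assumes P0: "prob_space P0" "sets P0 = sets S"
    and indep: "indep_vars (\<lambda>_. S) X UNIV" and law: "\<And>i. distr \<Omega> S (X i) = P0"
    and boot: "bootstrap_sample \<Omega> S X Xs"
begin

text \<open>Restriction to \<open>{..<n}\<close> makes the tuple extensional, that is, a point of
  the product space; the empirical measure does not see the difference.\<close>

definition sample :: "nat \<Rightarrow> 'w \<Rightarrow> nat \<Rightarrow> 'a" where
  "sample n w = (\<lambda>i\<in>{..<n}. X i w)"

definition boot_sample :: "nat \<Rightarrow> 'w \<Rightarrow> nat \<Rightarrow> 'a" where
  "boot_sample n w = (\<lambda>i\<in>{..<n}. Xs n i w)"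

lemma space_P0: "space P0 = space S"
  by (rule sets_eq_imp_space_eq) (rule P0)

lemma X_measurable: "X i \<in> measurable \<Omega> S"
  using indep by (auto simp: indep_vars_def)

lemma sample_measurable [measurable]: "sample n \<in> measurable \<Omega> (samples n S)"
  unfolding sample_def using X_measurable by (intro measurable_restrict) auto

lemma boot_sample_measurable:
  assumes "0 < n" shows "boot_sample n \<in> measurable \<Omega> (samples n S)"
proof -
  have "\<And>i. i < n \<Longrightarrow> Xs n i \<in> measurable \<Omega> S"
    using boot assms by (simp add: bootstrap_sample_def)
  then show ?thesis unfolding boot_sample_def by (intro measurable_restrict) auto
qed

lemma emp_sample: "emp S n (\<lambda>i. X i w) = emp S n (sample n w)"
  by (rule emp_cong) (simp add: sample_def)

lemma emp_boot_sample: "emp S n (\<lambda>i. Xs n i w) = emp S n (boot_sample n w)"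
  by (rule emp_cong) (simp add: boot_sample_def)

lemma distr_sample:
  assumes "0 < n" shows "distr \<Omega> (samples n S) (sample n) = samples n P0"
proof -
  have "indep_vars (\<lambda>_. S) X {..<n}" using indep by (rule indep_vars_subset) auto
  then have "distr \<Omega> (samples n S) (\<lambda>w. \<lambda>i\<in>{..<n}. X i w) = (\<Pi>\<^sub>M i\<in>{..<n}. distr \<Omega> S (X i))"
    using assms X_measurable by (subst (asm) indep_vars_iff_distr_eq_PiM) auto
  then show ?thesis by (simp add: law sample_def[abs_def])
qed

text \<open>The bootstrap laws form a kernel: pulling the event back to the index space replaces the
  varying law by the fixed measure \<open>indices n\<close>, under which the measure of a section
  depends measurably on \<open>x\<close>.\<close>

lemma boot_law_measurable:
  assumes n: "0 < n" and B: "B \<in> sets (sample_pairs n S)"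
  shows "(\<lambda>x. emeasure (boot_law n (emp S n x)) (Pair x -` B)) \<in> borel_measurable (samples n S)"
    and "x \<in> space (samples n S) \<Longrightarrow> emeasure (boot_law n (emp S n x)) (Pair x -` B) =
      emeasure (indices n)
        (Pair x -` ((\<lambda>(x, j). (x, compose {..<n} x j)) -` B \<inter> space (samples n S \<Otimes>\<^sub>M indices n)))"
    and "(\<lambda>(x, j). (x, compose {..<n} x j)) \<in> measurable (samples n S \<Otimes>\<^sub>M indices n)
      (sample_pairs n S)"
proof -
  let ?I = "indices n" and ?S = "samples n S"
  let ?T = "\<lambda>(x, j). (x, compose {..<n} x j)"
  interpret I: prob_space ?I
    using n by (intro prob_space_PiM prob_space_uniform_count_measure) auto
  show T: "?T \<in> measurable (?S \<Otimes>\<^sub>M ?I) (sample_pairs n S)"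
    using measurable_Pair[OF measurable_fst measurable_resample[of n S]] by (simp add: case_prod_unfold)
  have TB: "?T -` B \<inter> space (?S \<Otimes>\<^sub>M ?I) \<in> sets (?S \<Otimes>\<^sub>M ?I)"
    using T B by (rule measurable_sets)
  show eq: "emeasure (boot_law n (emp S n x)) (Pair x -` B) = emeasure ?I (Pair x -` (?T -` B \<inter> space (?S \<Otimes>\<^sub>M ?I)))"
    if x: "x \<in> space ?S" for x
  proof -
    have c: "compose {..<n} x \<in> measurable ?I ?S"
      using measurable_compose[OF measurable_Pair1'[OF x] measurable_resample] by simp
    have "emeasure (boot_law n (emp S n x)) (Pair x -` B) = emeasure ?I (compose {..<n} x -` (Pair x -` B) \<inter> space ?I)"
      unfolding boot_law_emp[OF n x] using c sets_Pair1[OF B] by (rule emeasure_distr)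
    also have "compose {..<n} x -` (Pair x -` B) \<inter> space ?I = Pair x -` (?T -` B \<inter> space (?S \<Otimes>\<^sub>M ?I))"
      using x by (auto simp: space_pair_measure)
    finally show ?thesis .
  qed
  have "(\<lambda>x. emeasure ?I (Pair x -` (?T -` B \<inter> space (?S \<Otimes>\<^sub>M ?I)))) \<in> borel_measurable ?S"
    by (rule I.measurable_emeasure_Pair[OF TB])
  then show "(\<lambda>x. emeasure (boot_law n (emp S n x)) (Pair x -` B)) \<in> borel_measurable ?S"
    by (subst measurable_cong[OF eq])
qed

lemma sets_samples_P0: "sets (samples n P0) = sets (samples n S)"
  by (rule sets_samples_cong[OF P0(2)])

lemma resampling_measurable:
  assumes "0 < n"
  shows "(\<lambda>(x, j). (x, compose {..<n} x j)) \<in> measurable (samples n P0 \<Otimes>\<^sub>M indices n) (sample_pairs n S)"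
proof -
  have eq: "sets (samples n P0 \<Otimes>\<^sub>M indices n) = sets (samples n S \<Otimes>\<^sub>M indices n)"
    by (intro sets_pair_measure_cong sets_samples_P0 refl)
  show ?thesis
    unfolding measurable_cong_sets[OF eq refl] by (rule boot_law_measurable(3)[OF assms sets.empty_sets])
qed

text \<open>Given the data, the bootstrap sample is the data composed with independent uniform indices.
  Fixing the indices turns a bootstrap estimator into a function of the i.i.d. data alone.\<close>

lemma joint_law:
  assumes n: "0 < n"
  shows "distr \<Omega> (sample_pairs n S) (\<lambda>w. (sample n w, boot_sample n w)) =
    distr (samples n P0 \<Otimes>\<^sub>M indices n) (sample_pairs n S)
      (\<lambda>(x, j). (x, compose {..<n} x j))"
    (is "?L = ?R")
proof -
  let ?I = "indices n" and ?S = "samples n S" and ?P = "samples n P0"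
  let ?T = "\<lambda>(x, j). (x, compose {..<n} x j)"
  interpret I: prob_space ?I
    using n by (intro prob_space_PiM prob_space_uniform_count_measure) auto
  interpret P: prob_space ?P by (intro prob_space_PiM P0)
  interpret PI: pair_prob_space ?P ?I ..
  note sP = sets_samples_P0 and T = resampling_measurable[OF n]
  have XX: "(\<lambda>w. (sample n w, boot_sample n w)) \<in> measurable \<Omega> (sample_pairs n S)"
    using sample_measurable boot_sample_measurable[OF n] by (rule measurable_Pair)
  interpret L: prob_space ?L by (rule prob_space_distr[OF XX])
  let ?E = "{a \<times> b |a b. a \<in> sets ?S \<and> b \<in> sets ?S}"
  show ?thesis
  \<comment> \<open>The hypothesis \<open>bootstrap_sample\<close> prescribes the probabilities of
    rectangles, which form an intersection-stable generator.\<close>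
  proof (rule measure_eqI_generator_eq[OF Int_stable_pair_measure_generator[of ?S ?S], where A = "\<lambda>_. space ?S \<times> space ?S"])
    show "?E \<subseteq> Pow (space (sample_pairs n S))"
      using sets.space_closed[of ?S] by (auto simp: space_pair_measure)
    show "sets ?L = sigma_sets (space (sample_pairs n S)) ?E" "sets ?R = sigma_sets (space (sample_pairs n S)) ?E"
      by (simp_all add: sets_pair_measure space_pair_measure)
    show "range (\<lambda>_. space ?S \<times> space ?S) \<subseteq> ?E" by auto
    show "(\<Union>i::nat. space ?S \<times> space ?S) = space (sample_pairs n S)" by (simp add: space_pair_measure)
    show "emeasure ?L (space ?S \<times> space ?S) \<noteq> \<infinity>" by simp
  next
    fix E assume "E \<in> ?E"
    then obtain a b where E: "E = a \<times> b" and a: "a \<in> sets ?S" and b: "b \<in> sets ?S" by auto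
    have Es: "E \<in> sets (sample_pairs n S)" using E a b by auto
    let ?k = "\<lambda>x. emeasure (boot_law n (emp S n x)) (Pair x -` E)"
    have k: "?k x = indicator a x * ennreal (measure (boot_law n (emp S n x)) b)" if "x \<in> space ?S" for x
    proof -
      interpret b: prob_space "boot_law n (emp S n x)" by (rule prob_space_boot_law_emp[OF n that])
      show ?thesis by (auto simp: E b.emeasure_eq_measure indicator_def)
    qed
    have km: "?k \<in> borel_measurable ?S" by (rule boot_law_measurable(1)[OF n Es])
    have "emeasure ?R E = emeasure (?P \<Otimes>\<^sub>M ?I) (?T -` E \<inter> space (?P \<Otimes>\<^sub>M ?I))"
      using T Es by (rule emeasure_distr)
    also have "\<dots> = (\<integral>\<^sup>+x. emeasure ?I (Pair x -` (?T -` E \<inter> space (?P \<Otimes>\<^sub>M ?I))) \<partial>?P)"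
      using measurable_sets[OF T Es] by (rule I.emeasure_pair_measure_alt)
    also have "\<dots> = (\<integral>\<^sup>+x. ?k x \<partial>?P)"
      using boot_law_measurable(2)[OF n Es]
      by (intro nn_integral_cong) (simp add: space_pair_measure sets_eq_imp_space_eq[OF sP])
    also have "\<dots> = (\<integral>\<^sup>+w. ?k (sample n w) \<partial>\<Omega>)"
      unfolding distr_sample[OF n, symmetric] using km by (intro nn_integral_distr) simp_all
    also have "\<dots> = (\<integral>\<^sup>+w. ennreal (indicator a (sample n w) * measure (boot_law n (emp S n (sample n w))) b) \<partial>\<Omega>)"
      using measurable_space[OF sample_measurable] by (intro nn_integral_cong) (simp add: k ennreal_mult ennreal_indicator)
    also have "\<dots> = ennreal (\<integral>w. indicator a (sample n w) * measure (boot_law n (emp S n (sample n w))) b \<partial>\<Omega>)"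
    proof (rule nn_integral_eq_integral)
      let ?r = "\<lambda>w. indicator a (sample n w) * measure (boot_law n (emp S n (sample n w))) b :: real"
      have "(\<lambda>w. enn2real (?k (sample n w))) \<in> borel_measurable \<Omega>"
        using measurable_compose[OF sample_measurable km] by measurable
      moreover have "enn2real (?k (sample n w)) = ?r w" if "w \<in> space \<Omega>" for w
        using measurable_space[OF sample_measurable that] by (simp add: k enn2real_mult indicator_def)
      ultimately have rm: "?r \<in> borel_measurable \<Omega>" by (subst (asm) measurable_cong) auto
      show "integrable \<Omega> ?r"
      proof (rule integrable_const_bound[where B = 1])
        show "AE w in \<Omega>. norm (?r w) \<le> 1"
        proof (rule AE_I2)
          fix w assume "w \<in> space \<Omega>"
          from prob_space_boot_law_emp[OF n measurable_space[OF sample_measurable this]]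
          interpret b: prob_space "boot_law n (emp S n (sample n w))" .
          show "norm (?r w) \<le> 1" by (simp add: indicator_def)
        qed
      qed (rule rm)
    qed simp
    also have "\<dots> = ennreal (measure \<Omega> {w\<in>space \<Omega>. sample n w \<in> a \<and> boot_sample n w \<in> b})"
      using boot n a b
      by (simp add: bootstrap_sample_def emp_sample flip: sample_def boot_sample_def)
    also have "\<dots> = emeasure \<Omega> ((\<lambda>w. (sample n w, boot_sample n w)) -` E \<inter> space \<Omega>)"
      unfolding emeasure_eq_measure by (intro arg_cong[where f = "\<lambda>A. ennreal (measure \<Omega> A)"]) (auto simp: E)
    also have "\<dots> = emeasure ?L E"
      using XX Es by (rule emeasure_distr[symmetric])
    finally show "emeasure ?L E = emeasure ?R E" by simp
  qed
qed

section \<open>Conditioning on the data or on the indices\<close>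

lemma pair_sample_measurable:
  "0 < n \<Longrightarrow> (\<lambda>w. (sample n w, boot_sample n w)) \<in> measurable \<Omega> (sample_pairs n S)"
  using sample_measurable boot_sample_measurable by (rule measurable_Pair)

text \<open>Fubini for the joint law in both orders. With the data as outer variable, the inner law
  is the bootstrap law given the data; with the indices as outer variable, the inner law is that of
  the i.i.d. data, and the bootstrap sample is a function of them.\<close>

lemma prob_conditional:
  assumes n: "0 < n" and B: "B \<in> sets (sample_pairs n S)"
  shows "emeasure \<Omega> {w\<in>space \<Omega>. (sample n w, boot_sample n w) \<in> B} =
    (\<integral>\<^sup>+w. emeasure (boot_law n (emp S n (sample n w))) (Pair (sample n w) -` B) \<partial>\<Omega>)"
    and "emeasure \<Omega> {w\<in>space \<Omega>. (sample n w, boot_sample n w) \<in> B} =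
    (\<integral>\<^sup>+j. emeasure (samples n P0) {x \<in> space (samples n S). (x, compose {..<n} x j) \<in> B}
      \<partial>indices n)"
proof -
  let ?I = "indices n" and ?S = "samples n S" and ?P = "samples n P0"
  let ?T = "\<lambda>(x, j). (x, compose {..<n} x j)"
  interpret I: prob_space ?I
    using n by (intro prob_space_PiM prob_space_uniform_count_measure) auto
  interpret P: prob_space ?P by (intro prob_space_PiM P0)
  interpret PI: pair_prob_space ?P ?I ..
  note sP = sets_samples_P0 and T = resampling_measurable[OF n]
  have "{w\<in>space \<Omega>. (sample n w, boot_sample n w) \<in> B} = (\<lambda>w. (sample n w, boot_sample n w)) -` B \<inter> space \<Omega>"
    by auto
  then have "emeasure \<Omega> {w\<in>space \<Omega>. (sample n w, boot_sample n w) \<in> B} =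
      emeasure (distr \<Omega> (sample_pairs n S) (\<lambda>w. (sample n w, boot_sample n w))) B"
    by (simp add: emeasure_distr[OF pair_sample_measurable[OF n] B])
  also have "\<dots> = emeasure (?P \<Otimes>\<^sub>M ?I) (?T -` B \<inter> space (?P \<Otimes>\<^sub>M ?I))"
    unfolding joint_law[OF n] using T B by (rule emeasure_distr)
  finally have *: "emeasure \<Omega> {w\<in>space \<Omega>. (sample n w, boot_sample n w) \<in> B} =
    emeasure (?P \<Otimes>\<^sub>M ?I) (?T -` B \<inter> space (?P \<Otimes>\<^sub>M ?I))" .
  have "\<dots> = (\<integral>\<^sup>+x. emeasure ?I (Pair x -` (?T -` B \<inter> space (?P \<Otimes>\<^sub>M ?I))) \<partial>?P)"
    using measurable_sets[OF T B] by (rule I.emeasure_pair_measure_alt)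
  also have "\<dots> = (\<integral>\<^sup>+x. emeasure (boot_law n (emp S n x)) (Pair x -` B) \<partial>?P)"
    using boot_law_measurable(2)[OF n B]
    by (intro nn_integral_cong) (simp add: space_pair_measure sets_eq_imp_space_eq[OF sP])
  also have "\<dots> = (\<integral>\<^sup>+w. emeasure (boot_law n (emp S n (sample n w))) (Pair (sample n w) -` B) \<partial>\<Omega>)"
    unfolding distr_sample[OF n, symmetric] using boot_law_measurable(1)[OF n B] by (intro nn_integral_distr) simp_all
  finally show "emeasure \<Omega> {w\<in>space \<Omega>. (sample n w, boot_sample n w) \<in> B} =
    (\<integral>\<^sup>+w. emeasure (boot_law n (emp S n (sample n w))) (Pair (sample n w) -` B) \<partial>\<Omega>)"
    using * by simp
  have "emeasure (?P \<Otimes>\<^sub>M ?I) (?T -` B \<inter> space (?P \<Otimes>\<^sub>M ?I))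
      = (\<integral>\<^sup>+j. emeasure ?P ((\<lambda>x. (x, j)) -` (?T -` B \<inter> space (?P \<Otimes>\<^sub>M ?I))) \<partial>?I)"
    using measurable_sets[OF T B] by (rule PI.emeasure_pair_measure_alt2)
  also have "\<dots> = (\<integral>\<^sup>+j. emeasure ?P {x \<in> space ?S. (x, compose {..<n} x j) \<in> B} \<partial>?I)"
    by (intro nn_integral_cong arg_cong[where f = "emeasure ?P"])
      (auto simp: space_pair_measure sets_eq_imp_space_eq[OF sP])
  finally show "emeasure \<Omega> {w\<in>space \<Omega>. (sample n w, boot_sample n w) \<in> B} =
    (\<integral>\<^sup>+j. emeasure ?P {x \<in> space ?S. (x, compose {..<n} x j) \<in> B} \<partial>?I)"
    using * by simp
qed

text \<open>For the error of \<open>P_n\<close> against \<open>P_0\<close> under a selection that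
  also sees the bootstrap sample: a bound valid for each fixed resampling pattern survives averaging
  over the patterns.\<close>

lemma prob_le_resampled:
  assumes n: "0 < n" and B: "B \<in> sets (sample_pairs n S)" and "0 \<le> \<beta>"
    and le: "\<And>j. j \<in> {..<n} \<rightarrow>\<^sub>E {..<n} \<Longrightarrow>
      measure (samples n P0) {x \<in> space (samples n S). (x, compose {..<n} x j) \<in> B} \<le> \<beta>"
  shows "prob {w\<in>space \<Omega>. (sample n w, boot_sample n w) \<in> B} \<le> \<beta>"
proof -
  let ?I = "indices n"
  interpret I: prob_space ?I
    using n by (intro prob_space_PiM prob_space_uniform_count_measure) auto
  interpret P: prob_space "samples n P0" by (intro prob_space_PiM P0)
  have "ennreal (prob {w\<in>space \<Omega>. (sample n w, boot_sample n w) \<in> B}) \<le> (\<integral>\<^sup>+j. ennreal \<beta> \<partial>?I)"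
    unfolding emeasure_eq_measure[symmetric] prob_conditional(2)[OF n B] P.emeasure_eq_measure
    by (intro nn_integral_mono ennreal_leI le) (auto simp: space_PiM space_uniform_count_measure)
  then show ?thesis using \<open>0 \<le> \<beta>\<close> by (simp add: I.emeasure_space_1)
qed

text \<open>For the error of the bootstrap measure against \<open>P_n\<close>: here the data are
  fixed, and the bound must hold uniformly in them.\<close>

lemma prob_le_given_sample:
  assumes n: "0 < n" and B: "B \<in> sets (sample_pairs n S)" and "0 \<le> \<beta>"
    and le: "\<And>x. x \<in> space (samples n S) \<Longrightarrow> measure (boot_law n (emp S n x)) (Pair x -` B) \<le> \<beta>"
  shows "prob {w\<in>space \<Omega>. (sample n w, boot_sample n w) \<in> B} \<le> \<beta>"
proof -
  have "ennreal (prob {w\<in>space \<Omega>. (sample n w, boot_sample n w) \<in> B}) \<le> (\<integral>\<^sup>+w. ennreal \<beta> \<partial>\<Omega>)"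
    unfolding emeasure_eq_measure[symmetric] prob_conditional(1)[OF n B]
  proof (rule nn_integral_mono)
    fix w assume "w \<in> space \<Omega>"
    then have x: "sample n w \<in> space (samples n S)" by (rule measurable_space[OF sample_measurable])
    interpret b: prob_space "boot_law n (emp S n (sample n w))" by (rule prob_space_boot_law_emp[OF n x])
    show "emeasure (boot_law n (emp S n (sample n w))) (Pair (sample n w) -` B) \<le> ennreal \<beta>"
      unfolding b.emeasure_eq_measure by (intro ennreal_leI le x)
  qed
  then show ?thesis using \<open>0 \<le> \<beta>\<close> by (simp add: emeasure_space_1)
qed

text \<open>The lower counterpart, for turning high conditional probability on many data sets into
  high probability.\<close>

lemma prob_ge_given_sample:
  assumes n: "0 < n" and B: "B \<in> sets (sample_pairs n S)" and A: "A \<in> events" and "0 \<le> \<beta>"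
    and ge: "\<And>w. w \<in> A \<Longrightarrow> \<beta> \<le> measure (boot_law n (emp S n (sample n w))) (Pair (sample n w) -` B)"
  shows "\<beta> * prob A \<le> prob {w\<in>space \<Omega>. (sample n w, boot_sample n w) \<in> B}"
proof -
  have "ennreal (\<beta> * prob A) = (\<integral>\<^sup>+w. ennreal \<beta> * indicator A w \<partial>\<Omega>)"
    using A \<open>0 \<le> \<beta>\<close> by (simp add: nn_integral_cmult_indicator emeasure_eq_measure ennreal_mult)
  also have "\<dots> \<le> (\<integral>\<^sup>+w. emeasure (boot_law n (emp S n (sample n w))) (Pair (sample n w) -` B) \<partial>\<Omega>)"
  proof (rule nn_integral_mono)
    fix w assume "w \<in> space \<Omega>"
    then have x: "sample n w \<in> space (samples n S)" by (rule measurable_space[OF sample_measurable])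
    interpret b: prob_space "boot_law n (emp S n (sample n w))" by (rule prob_space_boot_law_emp[OF n x])
    show "ennreal \<beta> * indicator A w \<le> emeasure (boot_law n (emp S n (sample n w))) (Pair (sample n w) -` B)"
      unfolding b.emeasure_eq_measure using ge[of w] by (auto simp: indicator_def intro: ennreal_leI)
  qed
  finally show ?thesis
    unfolding prob_conditional(1)[OF n B, symmetric] emeasure_eq_measure by simp
qed

end

section \<open>Stochastic order and rates\<close>

lemma integral_bounds:
  fixes f :: "'a \<Rightarrow> real"
  assumes P: "prob_space P" "sets P = sets S" and f: "f \<in> borel_measurable S" "\<And>z. z \<in> space S \<Longrightarrow> \<bar>f z\<bar> \<le> b"
  shows "integrable P f" "(\<integral>z. f z \<partial>P) \<le> b"
proof -
  interpret prob_space P by (rule P)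
  have sp: "space P = space S" by (rule sets_eq_imp_space_eq[OF P(2)])
  have m: "f \<in> borel_measurable P" unfolding measurable_cong_sets[OF P(2) refl] by (rule f)
  show i: "integrable P f"
    using f(2) m by (intro integrable_const_bound[where B = b] AE_I2) (auto simp: sp)
  show "(\<integral>z. f z \<partial>P) \<le> b"
    using f(2) by (intro integral_le_const i AE_I2) (auto simp: sp abs_le_iff)
qed

text \<open>A bound on outer probability by a measurable superset, the shape occurring in
  \<open>big_OP\<close>; inclusions and unions of events can then be used without measurability of
  the events themselves.\<close>

definition outer_le :: "'w measure \<Rightarrow> ('w \<Rightarrow> bool) \<Rightarrow> real \<Rightarrow> bool" where
  "outer_le M E \<beta> \<longleftrightarrow> (\<exists>A\<in>sets M. {w\<in>space M. E w} \<subseteq> A \<and> measure M A \<le> \<beta>)"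

lemma outer_le_mono:
  "outer_le M E \<beta> \<Longrightarrow> (\<And>w. w \<in> space M \<Longrightarrow> E' w \<Longrightarrow> E w) \<Longrightarrow> \<beta> \<le> \<beta>' \<Longrightarrow> outer_le M E' \<beta>'"
  unfolding outer_le_def by (elim bexE conjE, rule bexI) (auto intro: order_trans)

lemma outer_le_disj:
  assumes "outer_le M E \<beta>" "outer_le M E' \<beta>'"
  shows "outer_le M (\<lambda>w. E w \<or> E' w) (\<beta> + \<beta>')"
proof -
  obtain A where A: "A \<in> sets M" "{w\<in>space M. E w} \<subseteq> A" "measure M A \<le> \<beta>"
    using assms(1) by (auto simp: outer_le_def)
  obtain B where B: "B \<in> sets M" "{w\<in>space M. E' w} \<subseteq> B" "measure M B \<le> \<beta>'"
    using assms(2) by (auto simp: outer_le_def)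
  have "measure M (A \<union> B) \<le> \<beta> + \<beta>'" using measure_Un_le[OF A(1) B(1)] A(3) B(3) by linarith
  then show ?thesis unfolding outer_le_def using A B by (intro bexI[of _ "A \<union> B"]) auto
qed

text \<open>Using \<open>\<epsilon> / 2\<close> turns the weak inequality of \<open>outer_le\<close>
  into the strict one of \<open>big_OP\<close>.\<close>

lemma big_OP_iff:
  "big_OP M Z r \<longleftrightarrow> (\<forall>\<epsilon>>0. \<exists>K>0. \<forall>\<^sub>F n in sequentially. outer_le M (\<lambda>w. K * r n < \<bar>Z n w\<bar>) \<epsilon>)"
proof
  assume "big_OP M Z r"
  then show "\<forall>\<epsilon>>0. \<exists>K>0. \<forall>\<^sub>F n in sequentially. outer_le M (\<lambda>w. K * r n < \<bar>Z n w\<bar>) \<epsilon>"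
    unfolding big_OP_def outer_le_def
  proof (intro allI impI)
    fix \<epsilon> :: real assume *: "\<forall>\<epsilon>>0. \<exists>K>0. \<forall>\<^sub>F n in sequentially. \<exists>A\<in>sets M.
      {w\<in>space M. K * r n < \<bar>Z n w\<bar>} \<subseteq> A \<and> measure M A < \<epsilon>" and "0 < \<epsilon>"
    then obtain K where K: "0 < K" "\<forall>\<^sub>F n in sequentially. \<exists>A\<in>sets M. {w\<in>space M. K * r n < \<bar>Z n w\<bar>} \<subseteq> A \<and> measure M A < \<epsilon>"
      by blast
    from K(2) have "\<forall>\<^sub>F n in sequentially. \<exists>A\<in>sets M. {w\<in>space M. K * r n < \<bar>Z n w\<bar>} \<subseteq> A \<and> measure M A \<le> \<epsilon>"
      by eventually_elim (blast intro: less_imp_le)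
    then show "\<exists>K>0. \<forall>\<^sub>F n in sequentially. \<exists>A\<in>sets M. {w\<in>space M. K * r n < \<bar>Z n w\<bar>} \<subseteq> A \<and> measure M A \<le> \<epsilon>"
      using K(1) by blast
  qed
next
  assume *: "\<forall>\<epsilon>>0. \<exists>K>0. \<forall>\<^sub>F n in sequentially. outer_le M (\<lambda>w. K * r n < \<bar>Z n w\<bar>) \<epsilon>"
  show "big_OP M Z r"
    unfolding big_OP_def
  proof (intro allI impI)
    fix \<epsilon> :: real assume \<epsilon>: "0 < \<epsilon>"
    then obtain K where K: "K > 0" "\<forall>\<^sub>F n in sequentially. outer_le M (\<lambda>w. K * r n < \<bar>Z n w\<bar>) (\<epsilon> / 2)"
      using * half_gt_zero by blast
    from K(2) have "\<forall>\<^sub>F n in sequentially. \<exists>A\<in>sets M. {w\<in>space M. K * r n < \<bar>Z n w\<bar>} \<subseteq> A \<and> measure M A < \<epsilon>"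
    proof eventually_elim
      case (elim n)
      then obtain A where "A \<in> sets M" "{w\<in>space M. K * r n < \<bar>Z n w\<bar>} \<subseteq> A" "measure M A \<le> \<epsilon> / 2"
        unfolding outer_le_def by blast
      then show ?case using \<epsilon> by (intro bexI[of _ A] conjI) simp_all
    qed
    then show "\<exists>K>0. \<forall>\<^sub>F n in sequentially. \<exists>A\<in>sets M. {w\<in>space M. K * r n < \<bar>Z n w\<bar>} \<subseteq> A \<and> measure M A < \<epsilon>"
      using K(1) by blast
  qed
qed

abbreviation root_rate :: "nat \<Rightarrow> real" where
  "root_rate \<equiv> \<lambda>n. real n powr (- 1 / 2)"

abbreviation hal_rate :: "real \<Rightarrow> nat \<Rightarrow> real" where
  "hal_rate \<alpha> \<equiv> \<lambda>n. real n powr (- 1 / 2 - \<alpha> / 4)"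

lemma wp_to_1_mono:
  assumes "wp_to_1 M E" "\<And>n w. 0 < n \<Longrightarrow> w \<in> space M \<Longrightarrow> E n w \<Longrightarrow> E' n w"
  shows "wp_to_1 M E'"
proof -
  obtain A where A: "\<And>n. A n \<in> sets M" "\<And>n. A n \<subseteq> {w\<in>space M. E n w}" "(\<lambda>n. measure M (A n)) \<longlonglongrightarrow> 1"
    using assms(1) by (auto simp: wp_to_1_def)
  \<comment> \<open>The implication is available for \<open>n > 0\<close> only; emptying the event
    at \<open>n = 0\<close> leaves the limit unchanged.\<close>
  let ?A = "\<lambda>n. if n = 0 then {} else A n"
  have "\<forall>\<^sub>F n in sequentially. measure M (A n) = measure M (?A n)"
    using eventually_gt_at_top[of 0] by eventually_elim simp
  then have "(\<lambda>n. measure M (?A n)) \<longlonglongrightarrow> 1"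
    using A(3) by (rule Lim_transform_eventually[rotated])
  moreover have "?A n \<in> sets M \<and> ?A n \<subseteq> {w\<in>space M. E' n w}" for n
    using A(1,2)[of n] assms(2)[of n] by auto
  ultimately show ?thesis unfolding wp_to_1_def by (intro exI[of _ ?A] conjI allI) simp_all
qed

lemma boot_wp_to_1_mono:
  assumes "boot_wp_to_1 \<Omega> S Pn E"
    and "\<And>n w y. 0 < n \<Longrightarrow> w \<in> space \<Omega> \<Longrightarrow> y \<in> space (boot_law n (Pn n w)) \<Longrightarrow>
      E n (Pn n w) (emp S n y) \<Longrightarrow> E' n (Pn n w) (emp S n y)"
  shows "boot_wp_to_1 \<Omega> S Pn E'"
  unfolding boot_wp_to_1_def
proof (intro allI impI)
  fix \<epsilon> :: real assume "0 < \<epsilon>"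
  then have "wp_to_1 \<Omega> (\<lambda>n w. \<exists>B\<in>sets (boot_law n (Pn n w)). B \<subseteq> {y. E n (Pn n w) (emp S n y)} \<and>
        measure (boot_law n (Pn n w)) B > 1 - \<epsilon>)"
    using assms(1) unfolding boot_wp_to_1_def by blast
  then show "wp_to_1 \<Omega> (\<lambda>n w. \<exists>B\<in>sets (boot_law n (Pn n w)). B \<subseteq> {y. E' n (Pn n w) (emp S n y)} \<and>
        measure (boot_law n (Pn n w)) B > 1 - \<epsilon>)"
  proof (rule wp_to_1_mono, elim bexE conjE)
    fix n w B
    assume "0 < n" "w \<in> space \<Omega>" and B: "B \<in> sets (boot_law n (Pn n w))"
      "B \<subseteq> {y. E n (Pn n w) (emp S n y)}" "1 - \<epsilon> < measure (boot_law n (Pn n w)) B"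
    then show "\<exists>B\<in>sets (boot_law n (Pn n w)). B \<subseteq> {y. E' n (Pn n w) (emp S n y)} \<and>
        measure (boot_law n (Pn n w)) B > 1 - \<epsilon>"
      using assms(2) sets.sets_into_space[OF B(1)] by (intro bexI[of _ B] conjI subsetI CollectI) blast+
  qed
qed

context prob_space
begin

lemma wp_to_1_conj:
  assumes "wp_to_1 M E" "wp_to_1 M E'"
  shows "wp_to_1 M (\<lambda>n w. E n w \<and> E' n w)"
proof -
  obtain A where A: "\<And>n. A n \<in> events" "\<And>n. A n \<subseteq> {w\<in>space M. E n w}" "(\<lambda>n. prob (A n)) \<longlonglongrightarrow> 1"
    using assms(1) by (auto simp: wp_to_1_def)
  obtain B where B: "\<And>n. B n \<in> events" "\<And>n. B n \<subseteq> {w\<in>space M. E' n w}" "(\<lambda>n. prob (B n)) \<longlonglongrightarrow> 1"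
    using assms(2) by (auto simp: wp_to_1_def)
  have "(\<lambda>n. prob (A n \<inter> B n)) \<longlonglongrightarrow> 1"
  proof (rule tendsto_sandwich)
    show "\<forall>\<^sub>F n in sequentially. prob (A n) + prob (B n) - 1 \<le> prob (A n \<inter> B n)"
    proof (rule always_eventually, rule allI)
      fix n
      have "prob (A n \<union> B n) = prob (A n) + prob (B n) - prob (A n \<inter> B n)"
        using A(1)[of n] B(1)[of n] measure_Un3[of "A n" M "B n"] by (simp add: fmeasurable_eq_sets)
      then show "prob (A n) + prob (B n) - 1 \<le> prob (A n \<inter> B n)"
        using prob_le_1[of "A n \<union> B n"] by linarith
    qed
    show "(\<lambda>n. prob (A n) + prob (B n) - 1) \<longlonglongrightarrow> 1"
      using tendsto_diff[OF tendsto_add[OF A(3) B(3)] tendsto_const[of 1]] by simp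
    show "(\<lambda>_. 1::real) \<longlonglongrightarrow> 1" by simp
  qed simp
  then show ?thesis
    unfolding wp_to_1_def using A(1,2) B(1,2) by (intro exI[of _ "\<lambda>n. A n \<inter> B n"]) blast
qed

lemma wp_to_1_outer_le:
  assumes "wp_to_1 M E" "0 < \<epsilon>"
  shows "\<forall>\<^sub>F n in sequentially. outer_le M (\<lambda>w. \<not> E n w) \<epsilon>"
proof -
  obtain B where B: "\<And>n. B n \<in> events" "\<And>n. B n \<subseteq> {w\<in>space M. E n w}" "(\<lambda>n. prob (B n)) \<longlonglongrightarrow> 1"
    using assms(1) by (auto simp: wp_to_1_def)
  have "\<forall>\<^sub>F n in sequentially. 1 - \<epsilon> < prob (B n)"
    using B(3) assms(2) by (intro order_tendstoD(1)) auto
  then show ?thesis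
  proof eventually_elim
    case (elim n)
    then have "prob (space M - B n) \<le> \<epsilon>" using B(1) by (simp add: prob_compl)
    then show ?case unfolding outer_le_def using B(1,2)[of n] by (intro bexI[of _ "space M - B n"]) auto
  qed
qed

lemma big_OP_mono:
  assumes W: "big_OP M W r" and le: "wp_to_1 M (\<lambda>n w. \<bar>Z n w\<bar> \<le> W n w)"
  shows "big_OP M Z r"
  unfolding big_OP_iff
proof (intro allI impI)
  fix \<epsilon> :: real assume \<epsilon>: "0 < \<epsilon>"
  then obtain K where K: "K > 0" "\<forall>\<^sub>F n in sequentially. outer_le M (\<lambda>w. K * r n < \<bar>W n w\<bar>) (\<epsilon> / 2)"
    using W unfolding big_OP_iff by (meson half_gt_zero)
  have "\<forall>\<^sub>F n in sequentially. outer_le M (\<lambda>w. K * r n < \<bar>Z n w\<bar>) \<epsilon>"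
    using K(2) wp_to_1_outer_le[OF le half_gt_zero[OF \<epsilon>]]
    by eventually_elim (rule outer_le_mono[OF outer_le_disj], assumption+, auto)
  then show "\<exists>K>0. \<forall>\<^sub>F n in sequentially. outer_le M (\<lambda>w. K * r n < \<bar>Z n w\<bar>) \<epsilon>"
    using K(1) by blast
qed

lemma big_OP_abs: "big_OP M Z r \<Longrightarrow> big_OP M (\<lambda>n w. \<bar>Z n w\<bar>) r"
  by (simp add: big_OP_def)

lemma big_OP_add:
  assumes Z: "big_OP M Z r" and W: "big_OP M W r"
  shows "big_OP M (\<lambda>n w. Z n w + W n w) r"
  unfolding big_OP_iff
proof (intro allI impI)
  fix \<epsilon> :: real assume \<epsilon>: "0 < \<epsilon>"
  then obtain K K' where K: "K > 0" "\<forall>\<^sub>F n in sequentially. outer_le M (\<lambda>w. K * r n < \<bar>Z n w\<bar>) (\<epsilon> / 2)"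
    and K': "K' > 0" "\<forall>\<^sub>F n in sequentially. outer_le M (\<lambda>w. K' * r n < \<bar>W n w\<bar>) (\<epsilon> / 2)"
    using Z W unfolding big_OP_iff by (meson half_gt_zero)
  have "\<forall>\<^sub>F n in sequentially. outer_le M (\<lambda>w. (K + K') * r n < \<bar>Z n w + W n w\<bar>) \<epsilon>"
    using K(2) K'(2)
    by eventually_elim (rule outer_le_mono[OF outer_le_disj], assumption+, auto simp: distrib_right)
  then show "\<exists>K>0. \<forall>\<^sub>F n in sequentially. outer_le M (\<lambda>w. K * r n < \<bar>Z n w + W n w\<bar>) \<epsilon>"
    using K(1) K'(1) by (intro exI[of _ "K + K'"]) auto
qed

lemma big_OP_cmult:
  assumes Z: "big_OP M Z r" and r: "\<And>n. 0 \<le> r n"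
  shows "big_OP M (\<lambda>n w. c * Z n w) r"
  unfolding big_OP_iff
proof (intro allI impI)
  fix \<epsilon> :: real assume "0 < \<epsilon>"
  then obtain K where K: "K > 0" "\<forall>\<^sub>F n in sequentially. outer_le M (\<lambda>w. K * r n < \<bar>Z n w\<bar>) \<epsilon>"
    using Z unfolding big_OP_iff by blast
  have less: "K * r n < \<bar>Z n w\<bar>" if *: "(\<bar>c\<bar> + 1) * K * r n < \<bar>c * Z n w\<bar>" for n w
  proof -
    have "\<bar>c * Z n w\<bar> \<le> (\<bar>c\<bar> + 1) * \<bar>Z n w\<bar>" unfolding abs_mult by (intro mult_right_mono) auto
    then have "(\<bar>c\<bar> + 1) * (K * r n) < (\<bar>c\<bar> + 1) * \<bar>Z n w\<bar>" using * by (simp add: mult.assoc)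
    then show ?thesis by (simp add: mult_less_cancel_left)
  qed
  have "\<forall>\<^sub>F n in sequentially. outer_le M (\<lambda>w. (\<bar>c\<bar> + 1) * K * r n < \<bar>c * Z n w\<bar>) \<epsilon>"
    using K(2) by eventually_elim (rule outer_le_mono, assumption, rule less, auto)
  then show "\<exists>K>0. \<forall>\<^sub>F n in sequentially. outer_le M (\<lambda>w. K * r n < \<bar>c * Z n w\<bar>) \<epsilon>"
    using K(1) by (intro exI[of _ "(\<bar>c\<bar> + 1) * K"]) auto
qed

text \<open>The second claim uses the tail bound at a radius \<open>\<delta>\<close> of order \<open>n powr (-1/4)\<close>.\<close>

lemma big_OP_of_tail:
  assumes \<alpha>: "0 < \<alpha>" and C: "0 \<le> C" and D: "0 < D"
    and tail: "\<And>n t \<delta>. 0 < n \<Longrightarrow> 0 < t \<Longrightarrow> 0 < \<delta> \<Longrightarrow> \<delta> \<le> D \<Longrightarrow>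
      outer_le M (\<lambda>w. t < \<bar>Z n w\<bar> \<and> W n w \<le> \<delta>\<^sup>2) (C * \<delta> powr \<alpha> / (sqrt (real n) * t))"
  shows "(\<And>n w. 0 < n \<Longrightarrow> w \<in> space M \<Longrightarrow> W n w \<le> D\<^sup>2) \<Longrightarrow> big_OP M Z root_rate"
    and "big_OP M W root_rate \<Longrightarrow> big_OP M Z (hal_rate \<alpha>)"
proof -
  assume W: "\<And>n w. 0 < n \<Longrightarrow> w \<in> space M \<Longrightarrow> W n w \<le> D\<^sup>2"
  show "big_OP M Z root_rate"
    unfolding big_OP_iff
  proof (intro allI impI)
    fix \<epsilon> :: real assume \<epsilon>: "0 < \<epsilon>"
    \<comment> \<open>With \<open>t = K * n powr (-1/2)\<close> the tail bound becomes
      \<open>C * D powr \<alpha> / K\<close>, which is at most \<open>\<epsilon>\<close>; the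
      \<open>+ 1\<close> keeps \<open>K\<close> positive when \<open>C = 0\<close>.\<close>
    define K where "K = (C * D powr \<alpha> + 1) / \<epsilon>"
    have K: "0 < K" using C D \<epsilon> by (auto simp: K_def intro!: divide_pos_pos add_nonneg_pos)
    have "\<forall>\<^sub>F n in sequentially. outer_le M (\<lambda>w. K * real n powr (- 1 / 2) < \<bar>Z n w\<bar>) \<epsilon>"
      using eventually_gt_at_top[of 0]
    proof eventually_elim
      case (elim n)
      let ?t = "K * real n powr (- 1 / 2)"
      have t: "sqrt (real n) * ?t = K"
        using elim by (simp add: powr_minus powr_half_sqrt field_simps)
      have "outer_le M (\<lambda>w. ?t < \<bar>Z n w\<bar> \<and> W n w \<le> D\<^sup>2) (C * D powr \<alpha> / (sqrt (real n) * ?t))"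
        using K elim D by (intro tail) auto
      then show ?case
        unfolding t by (rule outer_le_mono) (use W elim K \<epsilon> in \<open>auto simp: K_def field_simps\<close>)
    qed
    then show "\<exists>K>0. \<forall>\<^sub>F n in sequentially. outer_le M (\<lambda>w. K * real n powr (- 1 / 2) < \<bar>Z n w\<bar>) \<epsilon>"
      using K by blast
  qed
next
  assume W: "big_OP M W root_rate"
  show "big_OP M Z (hal_rate \<alpha>)"
    unfolding big_OP_iff
  proof (intro allI impI)
    fix \<epsilon> :: real assume \<epsilon>: "0 < \<epsilon>"
    then obtain k where k: "k > 0" "\<forall>\<^sub>F n in sequentially. outer_le M (\<lambda>w. k * real n powr (- 1 / 2) < \<bar>W n w\<bar>) (\<epsilon> / 2)"
      using W unfolding big_OP_iff by (meson half_gt_zero)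
    let ?c = "sqrt k"
    \<comment> \<open>The square of the radius \<open>?c * n powr (-1/4)\<close> is the level
      \<open>k * n powr (-1/2)\<close> that \<open>W\<close> exceeds with outer probability at most
      \<open>\<epsilon> / 2\<close>. In the tail bound the powers of \<open>n\<close> cancel, and
      \<open>K\<close> makes it at most the other \<open>\<epsilon> / 2\<close>.\<close>
    define K where "K = 2 * (C * ?c powr \<alpha> + 1) / \<epsilon>"
    have K: "0 < K" using C \<epsilon> by (auto simp: K_def intro!: divide_pos_pos add_nonneg_pos)
    have "(\<lambda>n. ?c * real n powr (- 1 / 4)) \<longlonglongrightarrow> ?c * 0"
      by (intro tendsto_intros tendsto_neg_powr filterlim_real_sequentially) auto
    then have "\<forall>\<^sub>F n in sequentially. ?c * real n powr (- 1 / 4) < D"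
      using D by (intro order_tendstoD(2)) auto
    then have "\<forall>\<^sub>F n in sequentially. outer_le M (\<lambda>w. K * real n powr (- 1 / 2 - \<alpha> / 4) < \<bar>Z n w\<bar>) \<epsilon>"
      using k(2) eventually_gt_at_top[of 0]
    proof eventually_elim
      case (elim n)
      let ?t = "K * real n powr (- 1 / 2 - \<alpha> / 4)" and ?d = "?c * real n powr (- 1 / 4)"
      have "(real n powr (- 1 / 4))\<^sup>2 = real n powr (- 1 / 2)"
        using elim(3) by (simp add: power2_eq_square flip: powr_add)
      then have d2: "?d\<^sup>2 = k * real n powr (- 1 / 2)"
        using k(1) by (simp add: power_mult_distrib)
      have eq1: "sqrt (real n) * ?t = K * real n powr (- \<alpha> / 4)"
        using elim(3) by (simp add: powr_half_sqrt[symmetric] mult.left_commute flip: powr_add)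
      have eq2: "?d powr \<alpha> = ?c powr \<alpha> * real n powr (- \<alpha> / 4)"
        using k(1) by (simp add: powr_mult powr_powr)
      have "C * ?d powr \<alpha> / (sqrt (real n) * ?t) = C * (?c powr \<alpha> * real n powr (- \<alpha> / 4)) / (K * real n powr (- \<alpha> / 4))"
        by (simp only: eq1 eq2)
      also have "\<dots> = C * ?c powr \<alpha> / K" using elim(3) by simp
      also have "\<dots> \<le> \<epsilon> / 2" using K \<epsilon> C by (simp add: K_def field_simps)
      finally have le: "C * ?d powr \<alpha> / (sqrt (real n) * ?t) + \<epsilon> / 2 \<le> \<epsilon>" by linarith
      have "outer_le M (\<lambda>w. ?t < \<bar>Z n w\<bar> \<and> W n w \<le> ?d\<^sup>2) (C * ?d powr \<alpha> / (sqrt (real n) * ?t))"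
        using K k(1) elim(1,3) by (intro tail) auto
      from outer_le_disj[OF this[unfolded d2] elim(2)] show ?case
        by (rule outer_le_mono) (use le in auto)
    qed
    then show "\<exists>K>0. \<forall>\<^sub>F n in sequentially. outer_le M (\<lambda>w. K * real n powr (- 1 / 2 - \<alpha> / 4) < \<bar>Z n w\<bar>) \<epsilon>"
      using K by blast
  qed
qed

end

section \<open>Measurable selections and their errors\<close>

context iid_bootstrap
begin

text \<open>Empirical integrals are finite sums of evaluations at sample coordinates, and the
  integral under \<open>P0\<close> is a parametrized integral; joint measurability handles both. The
  last two claims concern the selections that remain when the data are fixed and when the bootstrap
  sample is a function \<open>c\<close> of the data.\<close>

lemma selection_measurable:
  fixes g :: "(nat \<Rightarrow> 'a) \<Rightarrow> (nat \<Rightarrow> 'a) \<Rightarrow> 'a \<Rightarrow> real"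
  assumes meas: "(\<lambda>((x, y), z). g x y z) \<in> borel_measurable (sample_pairs n S \<Otimes>\<^sub>M S)"
  shows "(\<lambda>p. \<integral>z. g (fst p) (snd p) z \<partial>emp S n (fst p)) \<in> borel_measurable (sample_pairs n S)"
    and "(\<lambda>p. \<integral>z. g (fst p) (snd p) z \<partial>emp S n (snd p)) \<in> borel_measurable (sample_pairs n S)"
    and "(\<lambda>p. \<integral>z. g (fst p) (snd p) z \<partial>P0) \<in> borel_measurable (sample_pairs n S)"
    and "x \<in> space (samples n S) \<Longrightarrow> y \<in> space (samples n S) \<Longrightarrow> g x y \<in> borel_measurable S"
    and "x \<in> space (samples n S) \<Longrightarrow> (\<lambda>(y, z). g x y z) \<in> borel_measurable (samples n S \<Otimes>\<^sub>M S)"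
    and "c \<in> measurable (samples n S) (samples n S) \<Longrightarrow> (\<lambda>(x, z). g x (c x) z) \<in> borel_measurable (samples n S \<Otimes>\<^sub>M S)"
proof -
  let ?S = "samples n S"
  let ?SS = "sample_pairs n S"
  interpret P0: prob_space P0 by (rule P0)
  have comp: "(\<lambda>w. g (fst (q w)) (snd (q w)) (z w)) \<in> borel_measurable M"
    if "q \<in> measurable M ?SS" "z \<in> measurable M S" for q z and M :: "'m measure"
    using measurable_compose[OF measurable_Pair[OF that] meas] by (simp add: case_prod_unfold)
  show gS: "g x y \<in> borel_measurable S" if "x \<in> space ?S" "y \<in> space ?S" for x y
    using comp[of "\<lambda>_. (x, y)" S "\<lambda>z. z"] that by (simp add: space_pair_measure)
  have emp: "(\<lambda>p. \<integral>z. g (fst p) (snd p) z \<partial>emp S n (v p)) \<in> borel_measurable ?SS" if v: "v \<in> measurable ?SS ?S" for v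
  proof -
    have m: "(\<lambda>p. (\<Sum>i<n. g (fst p) (snd p) (v p i)) / n) \<in> borel_measurable ?SS"
    proof (intro borel_measurable_divide borel_measurable_sum borel_measurable_const)
      fix i assume "i \<in> {..<n}"
      then have "(\<lambda>p. v p i) \<in> measurable ?SS S"
        by (rule measurable_compose[OF v measurable_component_singleton])
      from comp[OF measurable_ident_sets[OF refl] this]
      show "(\<lambda>p. g (fst p) (snd p) (v p i)) \<in> borel_measurable ?SS" by simp
    qed
    have eq: "(\<integral>z. g (fst p) (snd p) z \<partial>emp S n (v p)) = (\<Sum>i<n. g (fst p) (snd p) (v p i)) / n" if p: "p \<in> space ?SS" for p
    proof -
      have "fst p \<in> space ?S" "snd p \<in> space ?S" using p by (auto simp: space_pair_measure)
      from integral_emp[OF samples_mem[OF measurable_space[OF v p]] gS[OF this]] show ?thesis .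
    qed
    show ?thesis by (rule measurable_cong[THEN iffD2, OF eq m])
  qed
  show "(\<lambda>p. \<integral>z. g (fst p) (snd p) z \<partial>emp S n (fst p)) \<in> borel_measurable ?SS"
    "(\<lambda>p. \<integral>z. g (fst p) (snd p) z \<partial>emp S n (snd p)) \<in> borel_measurable ?SS"
    by (intro emp measurable_fst measurable_snd)+
  have eq: "sets (?SS \<Otimes>\<^sub>M P0) = sets (?SS \<Otimes>\<^sub>M S)"
    by (intro sets_pair_measure_cong refl P0)
  have "(\<lambda>(p, z). g (fst p) (snd p) z) \<in> borel_measurable (?SS \<Otimes>\<^sub>M P0)"
    unfolding measurable_cong_sets[OF eq refl] using meas by (simp add: case_prod_unfold)
  then show "(\<lambda>p. \<integral>z. g (fst p) (snd p) z \<partial>P0) \<in> borel_measurable ?SS"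
    by (rule P0.borel_measurable_lebesgue_integral)
  show "(\<lambda>(y, z). g x y z) \<in> borel_measurable (?S \<Otimes>\<^sub>M S)" if "x \<in> space ?S"
    using comp[OF measurable_Pair[OF measurable_const[OF that] measurable_fst] measurable_snd]
    by (simp add: case_prod_unfold)
  show "(\<lambda>(x, z). g x (c x) z) \<in> borel_measurable (?S \<Otimes>\<^sub>M S)" if "c \<in> measurable ?S ?S"
    using comp[OF measurable_Pair[OF measurable_fst measurable_compose[OF measurable_fst that]] measurable_snd]
    by (simp add: case_prod_unfold)
qed

text \<open>Conditional probability above \<open>1 - \<epsilon>\<close> on data of probability above
  \<open>1 - \<epsilon>\<close> gives unconditional probability at least
  \<open>(1 - \<epsilon>) * (1 - \<epsilon>)\<close>. Measurability of the joint event lets the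
  inner set \<open>B\<close> be replaced by the full section.\<close>

lemma boot_wp_imp_wp:
  assumes boot: "boot_wp_to_1 \<Omega> S (\<lambda>n w. emp S n (sample n w)) E"
    and meas: "\<And>n. 0 < n \<Longrightarrow> {p \<in> space (sample_pairs n S). E n (emp S n (fst p)) (emp S n (snd p))}
      \<in> sets (sample_pairs n S)"
  shows "wp_to_1 \<Omega> (\<lambda>n w. E n (emp S n (sample n w)) (emp S n (boot_sample n w)))"
proof -
  let ?B = "\<lambda>n. {p \<in> space (sample_pairs n S). E n (emp S n (fst p)) (emp S n (snd p))}"
  define A where "A n = (if n = 0 then {} else {w\<in>space \<Omega>. (sample n w, boot_sample n w) \<in> ?B n})" for n
  have A: "A n \<in> events" for n
  proof (cases "n = 0")
    case False
    then have "(\<lambda>w. (sample n w, boot_sample n w)) -` ?B n \<inter> space \<Omega> \<in> events"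
      by (intro measurable_sets[OF pair_sample_measurable] meas) auto
    then show ?thesis using False by (simp add: A_def vimage_def Int_def conj_commute)
  qed (simp add: A_def)
  have "(\<lambda>n. prob (A n)) \<longlonglongrightarrow> 1"
  proof (rule order_tendstoI)
    fix a :: real assume a: "a < 1"
    \<comment> \<open>\<open>a \<le> 1 - 3 * \<epsilon>\<close> is strictly below
      \<open>1 - 2 * \<epsilon>\<close>, a lower bound for
      \<open>(1 - \<epsilon>) * (1 - \<epsilon>)\<close>; the cap \<open>1 / 2\<close> keeps
      \<open>1 - \<epsilon>\<close> nonnegative.\<close>
    define \<epsilon> where "\<epsilon> = min (1 / 2) ((1 - a) / 3)"
    have \<epsilon>: "0 < \<epsilon>" "\<epsilon> \<le> 1 / 2" "a \<le> 1 - 3 * \<epsilon>" using a by (auto simp: \<epsilon>_def min_def field_simps)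
    have "wp_to_1 \<Omega> (\<lambda>n w. \<exists>B\<in>sets (boot_law n (emp S n (sample n w))).
        B \<subseteq> {y. E n (emp S n (sample n w)) (emp S n y)} \<and>
        measure (boot_law n (emp S n (sample n w))) B > 1 - \<epsilon>)"
      using boot \<epsilon>(1) unfolding boot_wp_to_1_def by blast
    from this[unfolded wp_to_1_def] obtain D where "(\<forall>n. D n \<in> events \<and> D n \<subseteq> {w \<in> space \<Omega>. \<exists>B\<in>sets (boot_law n (emp S n (sample n w))).
        B \<subseteq> {y. E n (emp S n (sample n w)) (emp S n y)} \<and>
        measure (boot_law n (emp S n (sample n w))) B > 1 - \<epsilon>}) \<and> (\<lambda>n. prob (D n)) \<longlonglongrightarrow> 1" ..
    then have D: "\<And>n. D n \<in> events" "(\<lambda>n. prob (D n)) \<longlonglongrightarrow> 1"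
      "\<And>n. D n \<subseteq> {w \<in> space \<Omega>. \<exists>B\<in>sets (boot_law n (emp S n (sample n w))).
        B \<subseteq> {y. E n (emp S n (sample n w)) (emp S n y)} \<and>
        measure (boot_law n (emp S n (sample n w))) B > 1 - \<epsilon>}"
      by simp_all
    have "\<forall>\<^sub>F n in sequentially. 1 - \<epsilon> < prob (D n)"
      using D(2) \<epsilon>(1) by (intro order_tendstoD(1)) auto
    then show "\<forall>\<^sub>F n in sequentially. a < prob (A n)"
      using eventually_gt_at_top[of 0]
    proof eventually_elim
      case (elim n)
      have "(1 - \<epsilon>) * prob (D n) \<le> prob {w\<in>space \<Omega>. (sample n w, boot_sample n w) \<in> ?B n}"
      proof (rule prob_ge_given_sample[OF elim(2) meas[OF elim(2)] D(1)])
        fix w assume wD: "w \<in> D n"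
        then have w: "w \<in> space \<Omega>" using D(3) by blast
        let ?x = "sample n w"
        have x: "?x \<in> space (samples n S)" by (rule measurable_space[OF sample_measurable w])
        interpret b: prob_space "boot_law n (emp S n ?x)" by (rule prob_space_boot_law_emp[OF elim(2) x])
        obtain B where B: "B \<in> sets (boot_law n (emp S n ?x))" "B \<subseteq> {y. E n (emp S n ?x) (emp S n y)}"
          "1 - \<epsilon> < measure (boot_law n (emp S n ?x)) B"
          using D(3)[of n] wD by blast
        have "B \<subseteq> space (samples n S)" using sets.sets_into_space[OF B(1)] by simp
        then have "B \<subseteq> Pair ?x -` ?B n" using B(2) x by (auto simp: space_pair_measure)
        then have "b.prob B \<le> b.prob (Pair ?x -` ?B n)"
          using sets_Pair1[OF meas[OF elim(2)]] by (intro b.finite_measure_mono) auto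
        then show "1 - \<epsilon> \<le> b.prob (Pair ?x -` ?B n)" using B(3) by linarith
      qed (use \<epsilon> in auto)
      moreover have "(1 - \<epsilon>) * (1 - \<epsilon>) \<le> (1 - \<epsilon>) * prob (D n)"
        using elim(1) \<epsilon> by (intro mult_left_mono) auto
      moreover have "1 - 2 * \<epsilon> \<le> (1 - \<epsilon>) * (1 - \<epsilon>)" by (simp add: algebra_simps)
      moreover have "prob (A n) = prob {w\<in>space \<Omega>. (sample n w, boot_sample n w) \<in> ?B n}"
        using elim(2) by (simp add: A_def)
      ultimately show "a < prob (A n)" using \<epsilon> by linarith
    qed
  next
    fix a :: real assume "1 < a"
    then show "\<forall>\<^sub>F n in sequentially. prob (A n) < a"
      by (intro always_eventually allI) (rule le_less_trans[OF prob_le_1])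
  qed
  then show ?thesis
    unfolding wp_to_1_def using A by (intro exI[of _ A] conjI allI) (auto simp: A_def)
qed

end

text \<open>An estimator enters through the function it selects from the class \<open>F\<close>; the selection may
  depend on both the data \<open>x\<close> and the bootstrap sample \<open>y\<close>.\<close>

locale selection = iid_bootstrap \<Omega> S P0 X Xs
  for \<Omega> :: "'w measure" and S P0 :: "'a measure" and X Xs +
  fixes F :: "('a \<Rightarrow> real) set" and b \<alpha> :: real and g :: "nat \<Rightarrow> (nat \<Rightarrow> 'a) \<Rightarrow> (nat \<Rightarrow> 'a) \<Rightarrow> 'a \<Rightarrow> real"
  assumes \<alpha>: "0 < \<alpha>" "\<alpha> < 1" and b: "0 < b"
    and cover: "\<And>R. 0 < R \<Longrightarrow> \<exists>K. uniform_cover (space S) F R \<alpha> K"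
    and mem: "\<And>n x y. 0 < n \<Longrightarrow> x \<in> space (samples n S) \<Longrightarrow> y \<in> space (samples n S) \<Longrightarrow> g n x y \<in> F"
    and bound: "\<And>f z. f \<in> F \<Longrightarrow> z \<in> space S \<Longrightarrow> \<bar>f z\<bar> \<le> b"
    and meas: "\<And>n. 0 < n \<Longrightarrow> (\<lambda>((x, y), z). g n x y z) \<in> borel_measurable (sample_pairs n S \<Otimes>\<^sub>M S)"
begin

abbreviation selected :: "nat \<Rightarrow> 'w \<Rightarrow> 'a \<Rightarrow> real" where
  "selected n w \<equiv> g n (sample n w) (boot_sample n w)"

abbreviation empirical_error :: "nat \<Rightarrow> 'w \<Rightarrow> real" where
  "empirical_error n w \<equiv> (\<integral>z. selected n w z \<partial>emp S n (sample n w)) - (\<integral>z. selected n w z \<partial>P0)"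

abbreviation bootstrap_error :: "nat \<Rightarrow> 'w \<Rightarrow> real" where
  "bootstrap_error n w \<equiv> (\<integral>z. selected n w z \<partial>emp S n (boot_sample n w)) - (\<integral>z. selected n w z \<partial>emp S n (sample n w))"

abbreviation moment0 :: "nat \<Rightarrow> 'w \<Rightarrow> real" where
  "moment0 n w \<equiv> \<integral>z. (selected n w z)\<^sup>2 \<partial>P0"

abbreviation empirical_moment :: "nat \<Rightarrow> 'w \<Rightarrow> real" where
  "empirical_moment n w \<equiv> \<integral>z. (selected n w z)\<^sup>2 \<partial>emp S n (sample n w)"

abbreviation bootstrap_moment :: "nat \<Rightarrow> 'w \<Rightarrow> real" where
  "bootstrap_moment n w \<equiv> \<integral>z. (selected n w z)\<^sup>2 \<partial>emp S n (boot_sample n w)"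

text \<open>Two instances of \<open>localized_tail\<close>. For the empirical error the indices are
  fixed and the sampling distribution is \<open>P0\<close>; for the bootstrap error the data are
  fixed and the sampling distribution is their empirical measure.\<close>

lemma tails:
  assumes n: "0 < n" and cov: "uniform_cover (space S) F R \<alpha> K" and \<delta>: "0 < \<delta>" "2 * \<delta> \<le> R" and t: "0 < t"
  shows empirical_tail: "outer_le \<Omega> (\<lambda>w.
      t < \<bar>empirical_error n w\<bar> \<and>
      empirical_moment n w + moment0 n w \<le> \<delta>\<^sup>2)
    (tail_const \<alpha> R K * \<delta> powr \<alpha> / (sqrt n * t))" (is ?empirical)
    and bootstrap_tail: "outer_le \<Omega> (\<lambda>w.
      t < \<bar>bootstrap_error n w\<bar> \<and>
      bootstrap_moment n w + empirical_moment n w \<le> \<delta>\<^sup>2)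
    (tail_const \<alpha> R K * \<delta> powr \<alpha> / (sqrt n * t))" (is ?bootstrap)
proof -
  let ?S = "samples n S" and ?\<beta> = "tail_const \<alpha> R K * \<delta> powr \<alpha> / (sqrt n * t)"
  let ?SS = "sample_pairs n S" and ?g = "g n"
  interpret P0: prob_space P0 by (rule P0)
  have K: "0 \<le> K"
    using uniform_cover_nonneg[OF cov] \<delta> P0.not_empty by (simp add: space_P0)
  have \<beta>: "0 \<le> ?\<beta>" using chaining_const_pos[OF \<alpha>(1)] K t by (simp add: tail_const_def)
  have "(\<lambda>((x, y), z). (?g x y z)\<^sup>2) \<in> borel_measurable (?SS \<Otimes>\<^sub>M S)"
    using borel_measurable_power[OF meas[OF n], of 2] by (simp add: case_prod_unfold)
  note gm = selection_measurable[OF meas[OF n]] and gm2 = selection_measurable[OF this]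
  note gm(1,2,3)[measurable] gm2(1,2,3)[measurable]
  have sums: "(\<integral>z. ?g x y z \<partial>emp S n v) = (\<Sum>i<n. ?g x y (v i)) / n"
      "(\<integral>z. (?g x y z)\<^sup>2 \<partial>emp S n v) = (\<Sum>i<n. (?g x y (v i))\<^sup>2) / n"
    if "x \<in> space ?S" "y \<in> space ?S" "v \<in> space ?S" for x y v
    using that gm(4) gm2(4) samples_mem[OF that(3)] by (simp_all add: integral_emp)
  have event: "outer_le \<Omega> (\<lambda>w. (sample n w, boot_sample n w) \<in> B) ?\<beta>"
    if "B \<in> sets ?SS" "prob {w\<in>space \<Omega>. (sample n w, boot_sample n w) \<in> B} \<le> ?\<beta>" for B
    unfolding outer_le_def using that measurable_sets[OF pair_sample_measurable[OF n] that(1)]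
    by (intro bexI[of _ "{w\<in>space \<Omega>. (sample n w, boot_sample n w) \<in> B}"])
      (simp_all add: vimage_def Int_def conj_commute)
  have pair: "(sample n w, boot_sample n w) \<in> space ?SS" if "w \<in> space \<Omega>" for w
    using measurable_space[OF pair_sample_measurable[OF n] that] .
  show ?empirical
  proof -
    define B where "B = {p \<in> space ?SS.
      t < \<bar>(\<integral>z. ?g (fst p) (snd p) z \<partial>emp S n (fst p)) - (\<integral>z. ?g (fst p) (snd p) z \<partial>P0)\<bar> \<and>
      (\<integral>z. (?g (fst p) (snd p) z)\<^sup>2 \<partial>emp S n (fst p)) + (\<integral>z. (?g (fst p) (snd p) z)\<^sup>2 \<partial>P0) \<le> \<delta>\<^sup>2}"
    have B: "B \<in> sets ?SS" unfolding B_def by measurable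
    have spP: "space (samples n P0) = space ?S" by (rule sets_eq_imp_space_eq[OF sets_samples_P0])
    interpret Pn: prob_space "samples n P0" by (intro prob_space_PiM P0)
    have "prob {w\<in>space \<Omega>. (sample n w, boot_sample n w) \<in> B} \<le> ?\<beta>"
    proof (rule prob_le_resampled[OF n B \<beta>])
      fix j assume "j \<in> {..<n} \<rightarrow>\<^sub>E {..<n}"
      then have j: "j \<in> space (indices n)"
        by (simp add: space_PiM space_uniform_count_measure)
      let ?c = "\<lambda>x. compose {..<n} x j"
      have c: "?c \<in> measurable ?S ?S"
        using measurable_compose[OF measurable_Pair2'[OF j] measurable_resample] by simp
      let ?f = "\<lambda>x. ?g x (?c x)"
      have eq: "sets (samples n P0 \<Otimes>\<^sub>M P0) = sets (?S \<Otimes>\<^sub>M S)"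
        by (intro sets_pair_measure_cong sets_samples_P0 P0)
      have fm: "(\<lambda>(x, z). ?f x z) \<in> borel_measurable (samples n P0 \<Otimes>\<^sub>M P0)"
        unfolding measurable_cong_sets[OF eq refl] by (rule gm(6)[OF c])
      have fF: "?f x \<in> F" if "x \<in> space (samples n P0)" for x
        using that measurable_space[OF c] by (intro mem n) (simp_all add: spP)
      let ?E = "{x \<in> space (samples n P0). t < \<bar>(\<Sum>i<n. ?f x (x i)) / n - (\<integral>z. ?f x z \<partial>P0)\<bar> \<and>
        (\<Sum>i<n. (?f x (x i))\<^sup>2) / n \<le> \<delta>\<^sup>2 \<and> (\<integral>z. (?f x z)\<^sup>2 \<partial>P0) \<le> \<delta>\<^sup>2}"
      have E: "?E \<in> sets (samples n P0)" "Pn.prob ?E \<le> ?\<beta>"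
        by (rule localized_tail(1)[OF P0(1) n \<alpha> K cov[folded space_P0] \<delta> t]; (rule fm | erule fF | erule (1) bound[folded space_P0]))
          (rule localized_tail(2)[OF P0(1) n \<alpha> K cov[folded space_P0] \<delta> t]; (rule fm | erule fF | erule (1) bound[folded space_P0]))
      have sub: "{x \<in> space ?S. (x, ?c x) \<in> B} \<subseteq> ?E"
      proof
        fix x assume "x \<in> {x \<in> space ?S. (x, ?c x) \<in> B}"
        then have x: "x \<in> space ?S" and xB: "(x, ?c x) \<in> B" by auto
        have "t < \<bar>(\<Sum>i<n. ?f x (x i)) / n - (\<integral>z. ?f x z \<partial>P0)\<bar> \<and> (\<Sum>i<n. (?f x (x i))\<^sup>2) / n + (\<integral>z. (?f x z)\<^sup>2 \<partial>P0) \<le> \<delta>\<^sup>2"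
          using xB unfolding B_def mem_Collect_eq fst_conv snd_conv sums[OF x measurable_space[OF c x] x] by (rule conjunct2)
        \<comment> \<open>Both moments are nonnegative, so the bound on their sum is a bound on
          each.\<close>
        moreover have "0 \<le> (\<Sum>i<n. (?f x (x i))\<^sup>2) / n" "0 \<le> (\<integral>z. (?f x z)\<^sup>2 \<partial>P0)"
          by (simp_all add: sum_nonneg)
        ultimately show "x \<in> ?E"
          using x unfolding mem_Collect_eq spP by linarith
      qed
      show "Pn.prob {x \<in> space ?S. (x, ?c x) \<in> B} \<le> ?\<beta>"
        by (rule order_trans[OF Pn.finite_measure_mono[OF sub E(1)] E(2)])
    qed
    from event[OF B this] show ?thesis
      by (rule outer_le_mono) (use pair in \<open>auto simp: B_def\<close>)
  qed
  show ?bootstrap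
  proof -
    define B where "B = {p \<in> space ?SS.
      t < \<bar>(\<integral>z. ?g (fst p) (snd p) z \<partial>emp S n (snd p)) - (\<integral>z. ?g (fst p) (snd p) z \<partial>emp S n (fst p))\<bar> \<and>
      (\<integral>z. (?g (fst p) (snd p) z)\<^sup>2 \<partial>emp S n (snd p)) + (\<integral>z. (?g (fst p) (snd p) z)\<^sup>2 \<partial>emp S n (fst p)) \<le> \<delta>\<^sup>2}"
    have B: "B \<in> sets ?SS" unfolding B_def by measurable
    have "prob {w\<in>space \<Omega>. (sample n w, boot_sample n w) \<in> B} \<le> ?\<beta>"
    proof (rule prob_le_given_sample[OF n B \<beta>])
      fix x assume x: "x \<in> space ?S"
      let ?P = "emp S n x"
      have P: "prob_space ?P" by (rule prob_space_emp[OF n samples_mem[OF x]])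
      interpret b: prob_space "samples n ?P" by (intro prob_space_PiM P)
      have sP: "sets (samples n ?P) = sets ?S" by (rule sets_samples_cong) simp
      have spP: "space (samples n ?P) = space ?S" by (rule sets_eq_imp_space_eq[OF sP])
      have eq: "sets (samples n ?P \<Otimes>\<^sub>M ?P) = sets (?S \<Otimes>\<^sub>M S)"
        by (intro sets_pair_measure_cong sP sets_emp)
      have fm: "(\<lambda>(y, z). ?g x y z) \<in> borel_measurable (samples n ?P \<Otimes>\<^sub>M ?P)"
        unfolding measurable_cong_sets[OF eq refl] by (rule gm(5)[OF x])
      have fF: "?g x y \<in> F" if "y \<in> space (samples n ?P)" for y
        using that x by (intro mem n) (simp_all add: spP)
      let ?E = "{y \<in> space (samples n ?P). t < \<bar>(\<Sum>i<n. ?g x y (y i)) / n - (\<integral>z. ?g x y z \<partial>?P)\<bar> \<and>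
        (\<Sum>i<n. (?g x y (y i))\<^sup>2) / n \<le> \<delta>\<^sup>2 \<and> (\<integral>z. (?g x y z)\<^sup>2 \<partial>?P) \<le> \<delta>\<^sup>2}"
      \<comment> \<open>Cover and bound refer only to points of \<open>space S\<close>, so they
        serve the empirical measure of any data with the same constants.\<close>
      note cov' = cov[folded space_emp[of S n x]] and bound' = bound[folded space_emp[of S n x]]
      have E: "?E \<in> sets (samples n ?P)" "b.prob ?E \<le> ?\<beta>"
        by (rule localized_tail(1)[OF P n \<alpha> K cov' \<delta> t]; (rule fm | erule fF | erule (1) bound'))
          (rule localized_tail(2)[OF P n \<alpha> K cov' \<delta> t]; (rule fm | erule fF | erule (1) bound'))
      have sub: "Pair x -` B \<subseteq> ?E"
      proof
        fix y assume "y \<in> Pair x -` B"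
        then have y: "y \<in> space ?S" and yB: "(x, y) \<in> B" by (auto simp: B_def space_pair_measure)
        have "t < \<bar>(\<Sum>i<n. ?g x y (y i)) / n - (\<integral>z. ?g x y z \<partial>?P)\<bar> \<and> (\<Sum>i<n. (?g x y (y i))\<^sup>2) / n + (\<integral>z. (?g x y z)\<^sup>2 \<partial>?P) \<le> \<delta>\<^sup>2"
          using yB unfolding B_def mem_Collect_eq fst_conv snd_conv sums[OF x y y] by (rule conjunct2)
        moreover have "0 \<le> (\<Sum>i<n. (?g x y (y i))\<^sup>2) / n" "0 \<le> (\<integral>z. (?g x y z)\<^sup>2 \<partial>?P)"
          by (simp_all add: sum_nonneg)
        ultimately show "y \<in> ?E"
          using y unfolding mem_Collect_eq spP by linarith
      qed
      show "measure (boot_law n (emp S n x)) (Pair x -` B) \<le> ?\<beta>"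
        unfolding boot_law_def by (rule order_trans[OF b.finite_measure_mono[OF sub E(1)] E(2)])
    qed
    from event[OF B this] show ?thesis
      by (rule outer_le_mono) (use pair in \<open>auto simp: B_def\<close>)
  qed
qed

text \<open>At radius \<open>2 * b\<close> the moment condition always holds, because two second
  moments of functions bounded by \<open>b\<close> add up to at most \<open>2 * b\<^sup>2\<close>;
  this yields the crude rates. The covers reach up to \<open>4 * b\<close> because the tail bounds
  ask for \<open>2 * \<delta> \<le> R\<close>.\<close>

lemma rates:
  shows crude_rate_empirical: "big_OP \<Omega> empirical_error root_rate"
    and crude_rate_bootstrap: "big_OP \<Omega> bootstrap_error root_rate"
    and rate_empirical_of_second_moments:
      "big_OP \<Omega> (\<lambda>n w. empirical_moment n w + moment0 n w) root_rate \<Longrightarrow>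
      big_OP \<Omega> empirical_error (hal_rate \<alpha>)"
    and rate_bootstrap_of_second_moments:
      "big_OP \<Omega> (\<lambda>n w. bootstrap_moment n w + empirical_moment n w) root_rate \<Longrightarrow>
      big_OP \<Omega> bootstrap_error (hal_rate \<alpha>)"
proof -
  interpret P0: prob_space P0 by (rule P0)
  have b4: "0 < 4 * b" "0 < 2 * b" "b\<^sup>2 + b\<^sup>2 \<le> (2 * b)\<^sup>2" using b by (simp_all add: power_mult_distrib)
  obtain K where K: "uniform_cover (space S) F (4 * b) \<alpha> K" using cover[OF b4(1)] by blast
  have "0 \<le> K" using uniform_cover_nonneg[OF K b4(1)] P0.not_empty by (simp add: space_P0)
  then have C: "0 \<le> tail_const \<alpha> (4 * b) K" using chaining_const_pos[OF \<alpha>(1)] by (simp add: tail_const_def)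
  have sq: "moment0 n w \<le> b\<^sup>2" "empirical_moment n w \<le> b\<^sup>2"
    "bootstrap_moment n w \<le> b\<^sup>2" if n: "0 < n" and w: "w \<in> space \<Omega>" for n w
  proof -
    have xy: "sample n w \<in> space (samples n S)" "boot_sample n w \<in> space (samples n S)"
      using measurable_space[OF sample_measurable w] measurable_space[OF boot_sample_measurable[OF n] w] .
    have m: "(\<lambda>z. (selected n w z)\<^sup>2) \<in> borel_measurable S"
      by (rule borel_measurable_power[OF selection_measurable(4)[OF meas[OF n] xy]])
    have le: "\<bar>(selected n w z)\<^sup>2\<bar> \<le> b\<^sup>2" if "z \<in> space S" for z
      using power_mono[OF bound[OF mem[OF n xy] that], of 2] by simp
    show "moment0 n w \<le> b\<^sup>2" "empirical_moment n w \<le> b\<^sup>2"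
      "bootstrap_moment n w \<le> b\<^sup>2"
      by (intro integral_bounds(2)[OF _ _ m le] P0 prob_space_emp[OF n] samples_mem[OF xy(1)] samples_mem[OF xy(2)] sets_emp; assumption)+
  qed
  have tail0: "outer_le \<Omega> (\<lambda>w.
      t < \<bar>empirical_error n w\<bar> \<and>
      empirical_moment n w + moment0 n w \<le> \<delta>\<^sup>2)
    (tail_const \<alpha> (4 * b) K * \<delta> powr \<alpha> / (sqrt (real n) * t))" if "0 < n" "0 < t" "0 < \<delta>" "\<delta> \<le> 2 * b" for n t \<delta>
    by (rule empirical_tail[OF that(1) K that(3) _ that(2)]) (use that in simp)
  have tail1: "outer_le \<Omega> (\<lambda>w.
      t < \<bar>bootstrap_error n w\<bar> \<and>
      bootstrap_moment n w + empirical_moment n w \<le> \<delta>\<^sup>2)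
    (tail_const \<alpha> (4 * b) K * \<delta> powr \<alpha> / (sqrt (real n) * t))" if "0 < n" "0 < t" "0 < \<delta>" "\<delta> \<le> 2 * b" for n t \<delta>
    by (rule bootstrap_tail[OF that(1) K that(3) _ that(2)]) (use that in simp)
  note T0 = big_OP_of_tail[OF \<alpha>(1) C b4(2) tail0] and T1 = big_OP_of_tail[OF \<alpha>(1) C b4(2) tail1]
  show "big_OP \<Omega> empirical_error root_rate"
  proof (rule T0(1))
    fix n :: nat and w assume "0 < n" "w \<in> space \<Omega>"
    then show "empirical_moment n w + moment0 n w \<le> (2 * b)\<^sup>2"
      using sq[of n w] b4(3) by linarith
  qed
  show "big_OP \<Omega> bootstrap_error
      root_rate"
  proof (rule T1(1))
    fix n :: nat and w assume "0 < n" "w \<in> space \<Omega>"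
    then show "bootstrap_moment n w + empirical_moment n w \<le> (2 * b)\<^sup>2"
      using sq[of n w] b4(3) by linarith
  qed
  show "big_OP \<Omega> (\<lambda>n w. empirical_moment n w + moment0 n w) root_rate \<Longrightarrow>
      big_OP \<Omega> empirical_error (hal_rate \<alpha>)"
    by (rule T0(2))
  show "big_OP \<Omega> (\<lambda>n w. bootstrap_moment n w + empirical_moment n w) root_rate \<Longrightarrow>
      big_OP \<Omega> bootstrap_error (hal_rate \<alpha>)"
    by (rule T1(2))
qed

text \<open>Applied to the class of squares, the crude rates turn a rate for \<open>P\<^sub>0 g\<^sup>2\<close> into rates for the
  empirical and bootstrap second moments.\<close>

lemma localized_rates:
  assumes v0: "big_OP \<Omega> moment0 root_rate"
  shows "big_OP \<Omega> empirical_error (hal_rate \<alpha>)"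
    and "big_OP \<Omega> bootstrap_error (hal_rate \<alpha>)"
proof -
  let ?sq = "\<lambda>f z. (f z)\<^sup>2 :: real"
  \<comment> \<open>Squaring is Lipschitz with constant \<open>2 * b\<close> on functions bounded by
    \<open>b\<close>, so the squares have covers with the same exponent and again form a
    selection.\<close>
  interpret sq: selection \<Omega> S P0 X Xs "?sq ` F" "b\<^sup>2" \<alpha> "\<lambda>n x y z. (g n x y z)\<^sup>2"
  proof (intro selection.intro selection_axioms.intro iid_bootstrap_axioms \<alpha>)
    show "0 < b\<^sup>2" using b by simp
    show "\<exists>K. uniform_cover (space S) (?sq ` F) R \<alpha> K" if "0 < R" for R
    proof -
      have "0 < R / (2 * b)" using b that by simp
      then obtain K where "uniform_cover (space S) F (R / (2 * b)) \<alpha> K" using cover by blast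
      then have "uniform_cover (space S) (?sq ` F) (2 * b * (R / (2 * b))) \<alpha> (K * (2 * b) powr (1 - \<alpha>))"
      proof (rule uniform_cover_image)
        fix f h z assume fh: "f \<in> F" "h \<in> F" "z \<in> space S"
        have "\<bar>f z + h z\<bar> \<le> 2 * b" using bound[OF fh(1,3)] bound[OF fh(2,3)] by linarith
        then have "\<bar>f z + h z\<bar> * \<bar>f z - h z\<bar> \<le> 2 * b * \<bar>f z - h z\<bar>" by (rule mult_right_mono) simp
        then show "\<bar>(f z)\<^sup>2 - (h z)\<^sup>2\<bar> \<le> 2 * b * \<bar>f z - h z\<bar>"
          by (simp add: power2_eq_square square_diff_square_factored abs_mult)
      qed (use b in simp)
      then show ?thesis using b by auto
    qed
    show "(\<lambda>z. (g n x y z)\<^sup>2) \<in> ?sq ` F" if "0 < n" "x \<in> space (samples n S)" "y \<in> space (samples n S)" for n x y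
      using mem[OF that] by (rule imageI)
    show "\<bar>f z\<bar> \<le> b\<^sup>2" if "f \<in> ?sq ` F" "z \<in> space S" for f z
      using that power_mono[OF bound, of _ z 2] by auto
    show "(\<lambda>((x, y), z). (g n x y z)\<^sup>2) \<in> borel_measurable (sample_pairs n S \<Otimes>\<^sub>M S)" if "0 < n" for n
      using borel_measurable_power[OF meas[OF that], of 2] by (simp add: case_prod_unfold)
  qed
  \<comment> \<open>The empirical moment is the moment under \<open>P0\<close> plus the empirical
    error of the squares, and the crude rate of that error has the order wanted. The bootstrap
    moment follows from the empirical one in the same way.\<close>
  have vn: "big_OP \<Omega> empirical_moment root_rate"
    using big_OP_add[OF v0 sq.crude_rate_empirical] by simp
  have vs: "big_OP \<Omega> bootstrap_moment root_rate"
    using big_OP_add[OF vn sq.crude_rate_bootstrap] by simp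
  show "big_OP \<Omega> empirical_error (hal_rate \<alpha>)"
    by (rule rate_empirical_of_second_moments[OF big_OP_add[OF vn v0]])
  show "big_OP \<Omega> bootstrap_error (hal_rate \<alpha>)"
    by (rule rate_bootstrap_of_second_moments[OF big_OP_add[OF vs vn]])
qed

end

section \<open>Excess risks of loss-based estimators\<close>

context iid_bootstrap
begin

text \<open>Two selections from the class of loss differences are treated together,
  \<open>g1\<close> for the estimator and \<open>g2\<close> for its bootstrap version. Both need
  localized rates, since the bootstrap error of \<open>g1\<close> enters the bound for
  \<open>g2\<close>.\<close>

lemma hal_rates:
  fixes L :: "'q \<Rightarrow> 'a \<Rightarrow> real"
  assumes \<alpha>: "0 < \<alpha>" "\<alpha> < 1"
    and cov: "\<And>R. 0 < R \<Longrightarrow> \<exists>K. uniform_cover (space S) (L ` \<Q>) R \<alpha> K"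
    and b: "\<And>q z. q \<in> \<Q> \<Longrightarrow> z \<in> space S \<Longrightarrow> \<bar>L q z\<bar> \<le> b"
    and Lm: "\<And>q. q \<in> \<Q> \<Longrightarrow> L q \<in> borel_measurable S"
    and q0: "q0 \<in> \<Q>" "\<And>q. q \<in> \<Q> \<Longrightarrow> (\<integral>z. L q0 z \<partial>P0) \<le> (\<integral>z. L q z \<partial>P0)"
    and quadratic: "\<And>q. q \<in> \<Q> \<Longrightarrow> (\<integral>z. (L q z - L q0 z)\<^sup>2 \<partial>P0) \<le> C * ((\<integral>z. L q z \<partial>P0) - (\<integral>z. L q0 z \<partial>P0))"
    and Qn: "\<And>n x. 0 < n \<Longrightarrow> x \<in> space (samples n S) \<Longrightarrow> Qn n (emp S n x) \<in> \<Q>"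
      "\<And>n. 0 < n \<Longrightarrow> (\<lambda>(x, z). L (Qn n (emp S n x)) z) \<in> borel_measurable (samples n S \<Otimes>\<^sub>M S)"
    and Qs: "\<And>n x y. 0 < n \<Longrightarrow> x \<in> space (samples n S) \<Longrightarrow> y \<in> space (samples n S) \<Longrightarrow>
        Qs n (emp S n x) (emp S n y) \<in> \<Q>"
      "\<And>n. 0 < n \<Longrightarrow> (\<lambda>((x, y), z). L (Qs n (emp S n x) (emp S n y)) z)
        \<in> borel_measurable (sample_pairs n S \<Otimes>\<^sub>M S)"
  defines "Pn \<equiv> \<lambda>n w. emp S n (\<lambda>i. X i w)" and "Ps \<equiv> \<lambda>n w. emp S n (\<lambda>i. Xs n i w)"
  assumes mle: "wp_to_1 \<Omega> (\<lambda>n w. (\<integral>z. L (Qn n (Pn n w)) z \<partial>Pn n w) \<le> (\<integral>z. L q0 z \<partial>Pn n w))"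
    and boot_mle: "boot_wp_to_1 \<Omega> S Pn (\<lambda>n P P'. (\<integral>z. L (Qs n P P') z \<partial>P') \<le> (\<integral>z. L (Qn n P) z \<partial>P'))"
  shows "big_OP \<Omega> (\<lambda>n w. \<integral>z. L (Qs n (Pn n w) (Ps n w)) z - L (Qn n (Pn n w)) z \<partial>Pn n w) (hal_rate \<alpha>) \<and>
    big_OP \<Omega> (\<lambda>n w. (\<integral>z. L (Qs n (Pn n w) (Ps n w)) z \<partial>P0) - (\<integral>z. L q0 z \<partial>P0)) (hal_rate \<alpha>)"
proof -
  let ?S = "\<lambda>n. samples n S"
  have PnD: "Pn = (\<lambda>n w. emp S n (sample n w))" and PsD: "Ps = (\<lambda>n w. emp S n (boot_sample n w))"
    by (simp_all add: Pn_def Ps_def emp_sample emp_boot_sample fun_eq_iff)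
  \<comment> \<open>Twice a bound on the losses, by the triangle inequality; the absolute value and
    the \<open>+ 1\<close> make it strictly positive.\<close>
  define B where "B = 2 * (\<bar>b\<bar> + 1)"
  have B: "0 < B" by (simp add: B_def)
  define F where "F = (\<lambda>f z. f z - L q0 z) ` L ` \<Q>"
  have covF: "\<exists>K. uniform_cover (space S) F R \<alpha> K" if R: "0 < R" for R
  proof -
    obtain K where K: "uniform_cover (space S) (L ` \<Q>) R \<alpha> K" using cov[OF R] ..
    have "uniform_cover (space S) F (1 * R) \<alpha> (K * 1 powr (1 - \<alpha>))"
      unfolding F_def by (rule uniform_cover_image[OF K]) auto
    then show ?thesis by auto
  qed
  have boundF: "\<bar>f z\<bar> \<le> B" if f: "f \<in> F" and z: "z \<in> space S" for f z
  proof -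
    obtain q where q: "q \<in> \<Q>" "f = (\<lambda>z. L q z - L q0 z)" using f by (auto simp: F_def)
    then show ?thesis using b[OF q(1) z] b[OF q0(1) z] by (simp add: B_def)
  qed
  define g1 where "g1 n x y z = L (Qn n (emp S n x)) z - L q0 z" for n and x y :: "nat \<Rightarrow> 'a" and z
  define g2 where "g2 n x y z = L (Qs n (emp S n x) (emp S n y)) z - L q0 z" for n and x y :: "nat \<Rightarrow> 'a" and z
  have q0m: "(\<lambda>p. L q0 (snd p)) \<in> borel_measurable (sample_pairs n S \<Otimes>\<^sub>M S)" for n
    by (rule measurable_compose[OF measurable_snd Lm[OF q0(1)]])
  have Qnm: "(\<lambda>((x, y), z). L (Qn n (emp S n x)) z) \<in> borel_measurable (sample_pairs n S \<Otimes>\<^sub>M S)" if n: "0 < n" for n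
  proof -
    have "(\<lambda>p. (fst (fst p), snd p)) \<in> measurable (sample_pairs n S \<Otimes>\<^sub>M S) (?S n \<Otimes>\<^sub>M S)"
      by measurable
    from measurable_compose[OF this Qn(2)[OF n]] show ?thesis by (simp add: case_prod_unfold)
  qed
  interpret s1: selection \<Omega> S P0 X Xs F B \<alpha> g1
  proof (intro selection.intro selection_axioms.intro iid_bootstrap_axioms \<alpha> B covF boundF)
    show "g1 n x y \<in> F" if "0 < n" "x \<in> space (?S n)" "y \<in> space (?S n)" for n x y
      unfolding F_def g1_def[abs_def] using Qn(1)[OF that(1,2)] by blast
    show "(\<lambda>((x, y), z). g1 n x y z) \<in> borel_measurable (sample_pairs n S \<Otimes>\<^sub>M S)" if n: "0 < n" for n
      using borel_measurable_diff[OF Qnm[OF n] q0m] by (simp add: g1_def case_prod_unfold)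
  qed
  interpret s2: selection \<Omega> S P0 X Xs F B \<alpha> g2
  proof (intro selection.intro selection_axioms.intro iid_bootstrap_axioms \<alpha> B covF boundF)
    show "g2 n x y \<in> F" if "0 < n" "x \<in> space (?S n)" "y \<in> space (?S n)" for n x y
      unfolding F_def g2_def[abs_def] using Qs(1)[OF that] by blast
    show "(\<lambda>((x, y), z). g2 n x y z) \<in> borel_measurable (sample_pairs n S \<Otimes>\<^sub>M S)" if n: "0 < n" for n
      using borel_measurable_diff[OF Qs(2)[OF n] q0m] by (simp add: g2_def case_prod_unfold)
  qed
  \<comment> \<open>The bootstrap risk inequality is assumed conditionally on the data; the basic
    inequalities use it with unconditional probability.\<close>
  have boot_le: "wp_to_1 \<Omega> (\<lambda>n w. (\<integral>z. L (Qs n (Pn n w) (Ps n w)) z \<partial>Ps n w) \<le> (\<integral>z. L (Qn n (Pn n w)) z \<partial>Ps n w))"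
    unfolding PnD PsD
  proof (rule boot_wp_imp_wp[OF boot_mle[unfolded PnD]])
    fix n :: nat assume n: "0 < n"
    note [measurable] = selection_measurable(2)[OF Qs(2)[OF n]] selection_measurable(2)[OF Qnm[OF n]]
    show "{p \<in> space (sample_pairs n S). (\<integral>z. L (Qs n (emp S n (fst p)) (emp S n (snd p))) z \<partial>emp S n (snd p))
        \<le> (\<integral>z. L (Qn n (emp S n (fst p))) z \<partial>emp S n (snd p))} \<in> sets (sample_pairs n S)"
      by measurable
  qed
  have splits: "(\<integral>z. s1.selected n w z \<partial>P) = (\<integral>z. L (Qn n (Pn n w)) z \<partial>P) - (\<integral>z. L q0 z \<partial>P)"
      "(\<integral>z. s2.selected n w z \<partial>P) = (\<integral>z. L (Qs n (Pn n w) (Ps n w)) z \<partial>P) - (\<integral>z. L q0 z \<partial>P)"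
      "(\<integral>z. L (Qs n (Pn n w) (Ps n w)) z - L (Qn n (Pn n w)) z \<partial>P) = (\<integral>z. s2.selected n w z \<partial>P) - (\<integral>z. s1.selected n w z \<partial>P)"
      "0 \<le> (\<integral>z. s1.selected n w z \<partial>P0)" "0 \<le> (\<integral>z. s2.selected n w z \<partial>P0)"
      "(\<integral>z. (s1.selected n w z)\<^sup>2 \<partial>P0) \<le> C * (\<integral>z. s1.selected n w z \<partial>P0)"
      "(\<integral>z. (s2.selected n w z)\<^sup>2 \<partial>P0) \<le> C * (\<integral>z. s2.selected n w z \<partial>P0)"
    if n: "0 < n" and w: "w \<in> space \<Omega>" and P: "P = P0 \<or> P = Pn n w \<or> P = Ps n w" for n w P
  proof -
    have xy: "sample n w \<in> space (?S n)" "boot_sample n w \<in> space (?S n)"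
      using measurable_space[OF sample_measurable w] measurable_space[OF boot_sample_measurable[OF n] w] .
    have qs: "Qn n (Pn n w) \<in> \<Q>" "Qs n (Pn n w) (Ps n w) \<in> \<Q>"
      unfolding PnD PsD using Qn(1)[OF n xy(1)] Qs(1)[OF n xy] .
    have PP: "prob_space P" "sets P = sets S"
      using P P0 prob_space_emp[OF n samples_mem[OF xy(1)]] prob_space_emp[OF n samples_mem[OF xy(2)]]
      by (auto simp: PnD PsD)
    have int: "integrable P' (L q)" if "q \<in> \<Q>" "prob_space P'" "sets P' = sets S" for q P'
      by (rule integral_bounds(1)[OF that(2,3) Lm[OF that(1)] b[OF that(1)]])
    have h: "s1.selected n w = (\<lambda>z. L (Qn n (Pn n w)) z - L q0 z)" "s2.selected n w = (\<lambda>z. L (Qs n (Pn n w) (Ps n w)) z - L q0 z)"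
      by (simp_all add: g1_def g2_def PnD PsD fun_eq_iff)
    show 1: "(\<integral>z. s1.selected n w z \<partial>P) = (\<integral>z. L (Qn n (Pn n w)) z \<partial>P) - (\<integral>z. L q0 z \<partial>P)"
      and 2: "(\<integral>z. s2.selected n w z \<partial>P) = (\<integral>z. L (Qs n (Pn n w) (Ps n w)) z \<partial>P) - (\<integral>z. L q0 z \<partial>P)"
      unfolding h by (intro Bochner_Integration.integral_diff int qs q0 PP)+
    show "(\<integral>z. L (Qs n (Pn n w) (Ps n w)) z - L (Qn n (Pn n w)) z \<partial>P) = (\<integral>z. s2.selected n w z \<partial>P) - (\<integral>z. s1.selected n w z \<partial>P)"
      unfolding 1 2 using Bochner_Integration.integral_diff[OF int[OF qs(2) PP] int[OF qs(1) PP]] by simp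
    have 3: "(\<integral>z. s1.selected n w z \<partial>P0) = (\<integral>z. L (Qn n (Pn n w)) z \<partial>P0) - (\<integral>z. L q0 z \<partial>P0)"
      and 4: "(\<integral>z. s2.selected n w z \<partial>P0) = (\<integral>z. L (Qs n (Pn n w) (Ps n w)) z \<partial>P0) - (\<integral>z. L q0 z \<partial>P0)"
      unfolding h by (intro Bochner_Integration.integral_diff int qs q0 P0)+
    show "0 \<le> (\<integral>z. s1.selected n w z \<partial>P0)" "0 \<le> (\<integral>z. s2.selected n w z \<partial>P0)"
      unfolding 3 4 using q0(2)[OF qs(1)] q0(2)[OF qs(2)] by simp_all
    show "(\<integral>z. (s1.selected n w z)\<^sup>2 \<partial>P0) \<le> C * (\<integral>z. s1.selected n w z \<partial>P0)"
      "(\<integral>z. (s2.selected n w z)\<^sup>2 \<partial>P0) \<le> C * (\<integral>z. s2.selected n w z \<partial>P0)"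
      unfolding 3 4 unfolding h using quadratic[OF qs(1)] quadratic[OF qs(2)] .
  qed
  define R where "R n w = \<bar>s2.empirical_error n w\<bar> + \<bar>s2.bootstrap_error n w\<bar> + \<bar>s1.bootstrap_error n w\<bar>" for n w
  have basic: "wp_to_1 \<Omega> (\<lambda>n w.
      (\<integral>z. s1.selected n w z \<partial>P0) \<le> \<bar>s1.empirical_error n w\<bar> \<and>
      (\<integral>z. s2.selected n w z \<partial>P0) \<le> R n w \<and>
      \<bar>\<integral>z. L (Qs n (Pn n w) (Ps n w)) z - L (Qn n (Pn n w)) z \<partial>Pn n w\<bar> \<le> R n w \<and>
      \<bar>(\<integral>z. L (Qs n (Pn n w) (Ps n w)) z \<partial>P0) - (\<integral>z. L q0 z \<partial>P0)\<bar> \<le> R n w)"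
  proof (rule wp_to_1_mono[OF wp_to_1_conj[OF mle boot_le]])
    fix n :: nat and w assume n: "0 < n" and w: "w \<in> space \<Omega>"
    note s = splits[OF n w]
    assume le: "(\<integral>z. L (Qn n (Pn n w)) z \<partial>Pn n w) \<le> (\<integral>z. L q0 z \<partial>Pn n w) \<and>
      (\<integral>z. L (Qs n (Pn n w) (Ps n w)) z \<partial>Ps n w) \<le> (\<integral>z. L (Qn n (Pn n w)) z \<partial>Ps n w)"
    have 1: "(\<integral>z. s1.selected n w z \<partial>Pn n w) \<le> 0" using le s(1)[of "Pn n w"] by simp
    have 2: "(\<integral>z. s2.selected n w z \<partial>Ps n w) \<le> (\<integral>z. s1.selected n w z \<partial>Ps n w)"
      using le s(1,2)[of "Ps n w"] by simp
    have 3: "0 \<le> (\<integral>z. s1.selected n w z \<partial>P0)" "0 \<le> (\<integral>z. s2.selected n w z \<partial>P0)" using s(4,5)[of P0] by simp_all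
    \<comment> \<open>The difference under \<open>P_n\<close> may be negative, as the bootstrap
      version can have the smaller empirical risk. From below it is at least
      \<open>P_n f_n^#\<close>, because \<open>P_n f_n \<le> 0\<close>, and hence at least minus the
      empirical error of \<open>g2\<close>, because \<open>P_0 f_n^# \<ge> 0\<close>.\<close>
    show "(\<integral>z. s1.selected n w z \<partial>P0) \<le> \<bar>s1.empirical_error n w\<bar> \<and>
      (\<integral>z. s2.selected n w z \<partial>P0) \<le> R n w \<and>
      \<bar>\<integral>z. L (Qs n (Pn n w) (Ps n w)) z - L (Qn n (Pn n w)) z \<partial>Pn n w\<bar> \<le> R n w \<and>
      \<bar>(\<integral>z. L (Qs n (Pn n w) (Ps n w)) z \<partial>P0) - (\<integral>z. L q0 z \<partial>P0)\<bar> \<le> R n w"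
      unfolding s(3)[OF disjI2[OF disjI1[OF refl]]] s(2)[OF disjI1[OF refl], symmetric]
      using 1 2 3 unfolding R_def PnD PsD by linarith
  qed
  have r0: "0 \<le> root_rate n" for n by simp
  \<comment> \<open>Through the quadratic bound a crude rate for an excess risk becomes one for the
    second moment of the loss difference; \<open>\<bar>C\<bar>\<close> allows for a constant of
    either sign.\<close>
  have second_moment: "big_OP \<Omega> (\<lambda>n w. \<integral>z. (h n w z)\<^sup>2 \<partial>P0) root_rate"
    if W: "big_OP \<Omega> W root_rate" and le: "wp_to_1 \<Omega> (\<lambda>n w. (\<integral>z. h n w z \<partial>P0) \<le> W n w)"
      and h: "\<And>n w. 0 < n \<Longrightarrow> w \<in> space \<Omega> \<Longrightarrow> 0 \<le> (\<integral>z. h n w z \<partial>P0) \<and> (\<integral>z. (h n w z)\<^sup>2 \<partial>P0) \<le> C * (\<integral>z. h n w z \<partial>P0)"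
    for h :: "nat \<Rightarrow> 'w \<Rightarrow> 'a \<Rightarrow> real" and W
  proof (rule big_OP_mono[OF big_OP_cmult[OF W r0, of "\<bar>C\<bar>"]], rule wp_to_1_mono[OF le])
    fix n :: nat and w assume n: "0 < n" "w \<in> space \<Omega>" and "(\<integral>z. h n w z \<partial>P0) \<le> W n w"
    then have "\<bar>C\<bar> * (\<integral>z. h n w z \<partial>P0) \<le> \<bar>C\<bar> * W n w" by (intro mult_left_mono) auto
    moreover have "C * (\<integral>z. h n w z \<partial>P0) \<le> \<bar>C\<bar> * (\<integral>z. h n w z \<partial>P0)"
      using h[OF n] by (intro mult_right_mono) auto
    ultimately show "\<bar>\<integral>z. (h n w z)\<^sup>2 \<partial>P0\<bar> \<le> \<bar>C\<bar> * W n w"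
      using h[OF n] by (simp add: Bochner_Integration.integral_nonneg)
  qed
  have m1: "big_OP \<Omega> (\<lambda>n w. \<integral>z. (s1.selected n w z)\<^sup>2 \<partial>P0) root_rate"
  proof (rule second_moment[OF big_OP_abs[OF s1.crude_rate_empirical]])
    show "wp_to_1 \<Omega> (\<lambda>n w. (\<integral>z. s1.selected n w z \<partial>P0) \<le> \<bar>s1.empirical_error n w\<bar>)"
      by (rule wp_to_1_mono[OF basic]) (elim conjE)
  qed (use splits(4,6) in blast)
  have m2: "big_OP \<Omega> (\<lambda>n w. \<integral>z. (s2.selected n w z)\<^sup>2 \<partial>P0) root_rate"
  proof (rule second_moment)
    show "big_OP \<Omega> R root_rate"
      unfolding R_def[abs_def]
      by (intro big_OP_add big_OP_abs s2.crude_rate_empirical s2.crude_rate_bootstrap s1.crude_rate_bootstrap)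
    show "wp_to_1 \<Omega> (\<lambda>n w. (\<integral>z. s2.selected n w z \<partial>P0) \<le> R n w)"
      by (rule wp_to_1_mono[OF basic]) (elim conjE)
  qed (use splits(5,7) in blast)
  note refined = s2.localized_rates[OF m2] s1.localized_rates(2)[OF m1]
  have R_rate: "big_OP \<Omega> R (hal_rate \<alpha>)"
    unfolding R_def[abs_def] by (intro big_OP_add big_OP_abs refined)
  show ?thesis
    by (intro conjI; rule big_OP_mono[OF R_rate wp_to_1_mono[OF basic]]; elim conjE)
qed

end

section \<open>Cadlag losses\<close>

text \<open>Passage to the assumptions of \<open>hal_rates\<close>: the cadlag property makes losses
  measurable and upgrades pointwise measurability of the estimators to joint measurability, and the
  entropy of the large class provides covers of the losses.\<close>

lemma cadlag_hal_rates:
  fixes \<tau> :: "real^'d::finite" and L :: "'q \<Rightarrow> real^'d \<Rightarrow> real"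
  defines "S \<equiv> cubeM \<tau>"
  assumes \<tau>: "\<forall>i. 0 \<le> \<tau> $ i" and boot: "iid_bootstrap \<Omega> S P0 X Xs" and \<alpha>: "0 < \<alpha>" "\<alpha> < 1"
    and entropy: "\<exists>K. \<forall>\<^sub>F \<epsilon> in at_right 0. unif_entropy S \<F> \<epsilon> \<le> ennreal (K * \<epsilon> powr (- (1 - \<alpha>)))"
    and sub: "L ` \<Q> \<subseteq> \<F>"
    and bounded: "\<exists>b. \<forall>z\<in>cbox 0 \<tau>. \<forall>q\<in>\<Q>. \<bar>L q z\<bar> \<le> b"
    and q0: "is_arg_min (\<lambda>q. \<integral>z. L q z \<partial>P0) (\<lambda>q. q \<in> \<Q>) q0"
    and quadratic: "\<exists>C. \<forall>q\<in>\<Q>. (\<integral>z. (L q z - L q0 z)\<^sup>2 \<partial>P0) \<le> C * ((\<integral>z. L q z \<partial>P0) - (\<integral>z. L q0 z \<partial>P0))"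
    and cadlag: "\<forall>q\<in>\<Q>. cadlag_on \<tau> (L q)"
    and estimators: "is_estimator S \<Q> L Qn" "is_boot_estimator S \<Q> L Qs"
  defines "Pn \<equiv> \<lambda>n w. emp S n (\<lambda>i. X i w)" and "Ps \<equiv> \<lambda>n w. emp S n (\<lambda>i. Xs n i w)"
  assumes mle: "wp_to_1 \<Omega> (\<lambda>n w. (\<integral>z. L (Qn n (Pn n w)) z \<partial>Pn n w) \<le> (\<integral>z. L q0 z \<partial>Pn n w))"
    and boot_mle: "boot_wp_to_1 \<Omega> S Pn (\<lambda>n P P'. (\<integral>z. L (Qs n P P') z \<partial>P') \<le> (\<integral>z. L (Qn n P) z \<partial>P'))"
  shows "big_OP \<Omega> (\<lambda>n w. \<integral>z. L (Qs n (Pn n w) (Ps n w)) z - L (Qn n (Pn n w)) z \<partial>Pn n w) (hal_rate \<alpha>) \<and>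
    big_OP \<Omega> (\<lambda>n w. (\<integral>z. L (Qs n (Pn n w) (Ps n w)) z \<partial>P0) - (\<integral>z. L q0 z \<partial>P0)) (hal_rate \<alpha>)"
proof -
  interpret iid_bootstrap \<Omega> S P0 X Xs by (rule boot)
  have \<tau>': "0 \<le> \<tau> $ i" for i using \<tau> by simp
  have spS: "space S = cbox 0 \<tau>" by (simp add: S_def)
  obtain b where b: "\<And>q z. q \<in> \<Q> \<Longrightarrow> z \<in> space S \<Longrightarrow> \<bar>L q z\<bar> \<le> b"
    using bounded unfolding spS by blast
  obtain C where C: "\<And>q. q \<in> \<Q> \<Longrightarrow> (\<integral>z. (L q z - L q0 z)\<^sup>2 \<partial>P0) \<le> C * ((\<integral>z. L q z \<partial>P0) - (\<integral>z. L q0 z \<partial>P0))"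
    using quadratic by blast
  have q0': "q0 \<in> \<Q>" "\<And>q. q \<in> \<Q> \<Longrightarrow> (\<integral>z. L q0 z \<partial>P0) \<le> (\<integral>z. L q z \<partial>P0)"
    using q0 by (auto simp: is_arg_min_def not_less)
  have Lm: "L q \<in> borel_measurable S" if "q \<in> \<Q>" for q
    unfolding S_def using \<tau>' cadlag that by (intro cadlag_measurable) auto
  obtain K0 where K0: "\<forall>\<^sub>F \<epsilon> in at_right 0. unif_entropy S \<F> \<epsilon> \<le> ennreal (K0 * \<epsilon> powr (- (1 - \<alpha>)))"
    using entropy by blast
  have cov: "\<exists>K. uniform_cover (space S) (L ` \<Q>) R \<alpha> K" if "0 < R" for R
    using q0'(1) Lm by (intro uniform_cover_of_entropy[OF K0 \<alpha>(2) that sub]) auto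
  have Qn: "Qn n (emp S n x) \<in> \<Q>" if "0 < n" "x \<in> space (samples n S)" for n x
    using estimators(1) that by (simp add: is_estimator_def)
  have Qnm: "(\<lambda>(x, z). L (Qn n (emp S n x)) z) \<in> borel_measurable (samples n S \<Otimes>\<^sub>M S)" if n: "0 < n" for n
    using estimators(1) n cadlag Qn[OF n] unfolding S_def is_estimator_def
    by (intro cadlag_joint_measurable \<tau>') auto
  have Qs: "Qs n (emp S n x) (emp S n y) \<in> \<Q>"
    if "0 < n" "x \<in> space (samples n S)" "y \<in> space (samples n S)" for n x y
    using estimators(2) that by (simp add: is_boot_estimator_def)
  have Qsm: "(\<lambda>((x, y), z). L (Qs n (emp S n x) (emp S n y)) z)
      \<in> borel_measurable ((samples n S \<Otimes>\<^sub>M samples n S) \<Otimes>\<^sub>M S)" if n: "0 < n" for n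
  proof -
    have "(\<lambda>(p, z). L (Qs n (emp S n (fst p)) (emp S n (snd p))) z)
        \<in> borel_measurable ((samples n S \<Otimes>\<^sub>M samples n S) \<Otimes>\<^sub>M cubeM \<tau>)"
    proof (rule cadlag_joint_measurable[OF \<tau>'])
      show "cadlag_on \<tau> (L (Qs n (emp S n (fst p)) (emp S n (snd p))))"
        if "p \<in> space (samples n S \<Otimes>\<^sub>M samples n S)" for p
        using that Qs[OF n] cadlag by (auto simp: space_pair_measure)
      show "(\<lambda>p. L (Qs n (emp S n (fst p)) (emp S n (snd p))) z) \<in> borel_measurable (samples n S \<Otimes>\<^sub>M samples n S)"
        if "z \<in> cbox 0 \<tau>" for z
        using estimators(2) n that by (simp add: is_boot_estimator_def spS case_prod_unfold)
    qed
    then show ?thesis by (simp add: S_def case_prod_unfold)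
  qed
  show ?thesis
    unfolding Pn_def Ps_def
    by (rule hal_rates[OF \<alpha>];
        (erule cov | erule (1) b | erule Lm | rule q0' | assumption | erule C | erule Qn | erule Qnm | erule (1) Qs | erule Qsm
          | rule mle[unfolded Pn_def] | rule boot_mle[unfolded Pn_def])+)
qed

section \<open>Constrained minimizers and the final assembly\<close>

lemma bounded_mle_risk_le:
  assumes "bounded_mle \<Q> L comps \<tau> P C q" "q0 \<in> \<Q>" "comp_norm comps \<tau> q0 \<le> C"
  shows "(\<integral>z. L q z \<partial>P) \<le> (\<integral>z. L q0 z \<partial>P)"
  using assms by (auto simp: bounded_mle_def is_arg_min_def not_less)

text \<open>The estimator competes with its own bootstrap version: its sections generate measures
  absolutely continuous with respect to themselves, and it meets its own norm bound.\<close>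

lemma bounded_boot_mle_risk_le:
  assumes "bounded_boot_mle \<Q> L comps \<tau> P q qs" "q \<in> \<Q>"
  shows "(\<integral>z. L qs z \<partial>P) \<le> (\<integral>z. L q z \<partial>P)"
  using assms by (auto simp: bounded_boot_mle_def is_arg_min_def not_less comp_abs_cont_def absolutely_continuous_def)

theorem theorem3:
  fixes \<Omega> :: "'w measure"
    and \<tau> :: "real^'d::finite"
    and S P0 :: "(real^'d) measure"
    and X :: "nat \<Rightarrow> 'w \<Rightarrow> real^'d"
    and Xs :: "nat \<Rightarrow> nat \<Rightarrow> 'w \<Rightarrow> real^'d"
    and Pn Ps :: "nat \<Rightarrow> 'w \<Rightarrow> (real^'d) measure"
    and \<M> :: "(real^'d) measure set"
    and \<Gamma> :: "(real^'d) measure \<Rightarrow> (real \<Rightarrow> (real^'d) measure) set"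
    and \<Psi> :: "(real^'d) measure \<Rightarrow> real"
    and \<Psi>\<^sub>Q :: "'q \<Rightarrow> real"
    and Q :: "(real^'d) measure \<Rightarrow> 'q"
    and G :: "(real^'d) measure \<Rightarrow> 'g"
    and \<Q> :: "'q set" and \<G> :: "'g set"
    and Q0 :: 'q and G0 :: 'g
    and L1 :: "'q \<Rightarrow> real^'d \<Rightarrow> real"
    and L2 :: "'g \<Rightarrow> real^'d \<Rightarrow> real"
    and Dstar :: "'q \<Rightarrow> 'g \<Rightarrow> real^'d \<Rightarrow> real"
    and \<alpha> :: real
    and Qn :: "nat \<Rightarrow> (real^'d) measure \<Rightarrow> 'q"
    and Gn :: "nat \<Rightarrow> (real^'d) measure \<Rightarrow> 'g"
    and Qs :: "nat \<Rightarrow> (real^'d) measure \<Rightarrow> (real^'d) measure \<Rightarrow> 'q"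
    and Gs :: "nat \<Rightarrow> (real^'d) measure \<Rightarrow> (real^'d) measure \<Rightarrow> 'g"
    and compQ :: "'q \<Rightarrow> 'k1::finite \<Rightarrow> real^'e1::finite \<Rightarrow> real"
    and compG :: "'g \<Rightarrow> 'k2::finite \<Rightarrow> real^'e2::finite \<Rightarrow> real"
    and \<tau>\<^sub>Q :: "'k1 \<Rightarrow> real^'e1" and \<tau>\<^sub>G :: "'k2 \<Rightarrow> real^'e2"
    and A\<^sub>Q :: "'k1 \<Rightarrow> ('e1 set \<times> (real^'e1)) set" and A\<^sub>G :: "'k2 \<Rightarrow> ('e2 set \<times> (real^'e2)) set"
    and nonneg\<^sub>Q :: "'k1 \<Rightarrow> bool" and nonneg\<^sub>G :: "'k2 \<Rightarrow> bool"
    and CQl CQu :: "'k1 \<Rightarrow> ennreal" and CGl CGu :: "'k2 \<Rightarrow> ennreal"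
    and CQn :: "nat \<Rightarrow> (real^'d) measure \<Rightarrow> 'k1 \<Rightarrow> ennreal"
    and CGn :: "nat \<Rightarrow> (real^'d) measure \<Rightarrow> 'k2 \<Rightarrow> ennreal"
  defines "S \<equiv> cubeM \<tau>"
    and "Pn \<equiv> \<lambda>n \<omega>. emp S n (\<lambda>i. X i \<omega>)"
    and "Ps \<equiv> \<lambda>n \<omega>. emp S n (\<lambda>i. Xs n i \<omega>)"
    and "\<Q> \<equiv> Q ` \<M>" and "\<G> \<equiv> G ` \<M>"
    and "Q0 \<equiv> Q P0" and "G0 \<equiv> G P0"
  assumes cube: "\<forall>i. 0 \<le> \<tau> $ i"
    and model: "\<M> \<subseteq> {P. prob_space P \<and> sets P = sets S}" "P0 \<in> \<M>"
    \<comment> \<open>the data and the bootstrap sample\<close>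
    and prob: "prob_space \<Omega>"
    and iid: "prob_space.indep_vars \<Omega> (\<lambda>_. S) X UNIV" "\<forall>i. distr \<Omega> S (X i) = P0"
    and boot: "bootstrap_sample \<Omega> S X Xs"
    \<comment> \<open>the target parameter, its canonical gradient and the losses\<close>
    and target: "\<forall>P\<in>\<M>. \<Psi> P = \<Psi>\<^sub>Q (Q P)"
    and gradient: "canonical_gradient \<M> \<Gamma> \<Psi> (\<lambda>P. Dstar (Q P) (G P))"
    and Q0: "is_arg_min (\<lambda>q. \<integral>z. L1 q z \<partial>P0) (\<lambda>q. q \<in> \<Q>) Q0"
    and G0: "is_arg_min (\<lambda>g. \<integral>z. L2 g z \<partial>P0) (\<lambda>g. g \<in> \<G>) G0"
    and bounded: "\<exists>b. \<forall>z\<in>cbox 0 \<tau>. (\<forall>q\<in>\<Q>. \<bar>L1 q z\<bar> \<le> b) \<and> (\<forall>g\<in>\<G>. \<bar>L2 g z\<bar> \<le> b)"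
    and \<alpha>: "0 < \<alpha>" "\<alpha> < 1"
    and entropy: "\<exists>K. \<forall>\<^sub>F \<epsilon> in at_right 0.
      unif_entropy S (L1 ` \<Q> \<union> L2 ` \<G> \<union> {Dstar q g | q g. q \<in> \<Q> \<and> g \<in> \<G>}) \<epsilon>
        \<le> ennreal (K * \<epsilon> powr (- (1 - \<alpha>)))"
    \<comment> \<open>quadratic bound of the loss differences by the excess risks\<close>
    and quadratic: "\<exists>C.
      (\<forall>q\<in>\<Q>. (\<integral>z. (L1 q z - L1 Q0 z)\<^sup>2 \<partial>P0) \<le> C * ((\<integral>z. L1 q z \<partial>P0) - (\<integral>z. L1 Q0 z \<partial>P0))) \<and>
      (\<forall>g\<in>\<G>. (\<integral>z. (L2 g z - L2 G0 z)\<^sup>2 \<partial>P0) \<le> C * ((\<integral>z. L2 g z \<partial>P0) - (\<integral>z. L2 G0 z \<partial>P0)))"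
    \<comment> \<open>uniformly bounded sectional variation\<close>
    and cadlag: "\<exists>B<\<infinity>. \<forall>q\<in>\<Q>. \<forall>g\<in>\<G>. \<forall>f\<in>{L1 q, L2 g, Dstar q g}. cadlag_on \<tau> f \<and> sv_norm \<tau> f \<le> B"
    and estimators: "is_estimator S \<Q> L1 Qn" "is_estimator S \<G> L2 Gn"
      "is_boot_estimator S \<Q> L1 Qs" "is_boot_estimator S \<G> L2 Gs"
  shows
    "let r = (\<lambda>n. real n powr (- 1 / 2 - \<alpha> / 4));
         Qn' = (\<lambda>n \<omega>. Qn n (Pn n \<omega>)); Gn' = (\<lambda>n \<omega>. Gn n (Pn n \<omega>));
         Qs' = (\<lambda>n \<omega>. Qs n (Pn n \<omega>) (Ps n \<omega>)); Gs' = (\<lambda>n \<omega>. Gs n (Pn n \<omega>) (Ps n \<omega>));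
         rates =
           big_OP \<Omega> (\<lambda>n \<omega>. \<integral>z. L1 (Qs' n \<omega>) z - L1 (Qn' n \<omega>) z \<partial>Pn n \<omega>) r \<and>
           big_OP \<Omega> (\<lambda>n \<omega>. \<integral>z. L2 (Gs' n \<omega>) z - L2 (Gn' n \<omega>) z \<partial>Pn n \<omega>) r \<and>
           big_OP \<Omega> (\<lambda>n \<omega>. (\<integral>z. L1 (Qs' n \<omega>) z \<partial>P0) - (\<integral>z. L1 Q0 z \<partial>P0)) r \<and>
           big_OP \<Omega> (\<lambda>n \<omega>. (\<integral>z. L2 (Gs' n \<omega>) z \<partial>P0) - (\<integral>z. L2 G0 z \<partial>P0)) r
     in
      (wp_to_1 \<Omega> (\<lambda>n \<omega>. (\<integral>z. L1 (Qn' n \<omega>) z \<partial>Pn n \<omega>) \<le> (\<integral>z. L1 Q0 z \<partial>Pn n \<omega>)) \<and>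
       wp_to_1 \<Omega> (\<lambda>n \<omega>. (\<integral>z. L2 (Gn' n \<omega>) z \<partial>Pn n \<omega>) \<le> (\<integral>z. L2 G0 z \<partial>Pn n \<omega>)) \<and>
       boot_wp_to_1 \<Omega> S Pn (\<lambda>n P P'. (\<integral>z. L1 (Qs n P P') z \<partial>P') \<le> (\<integral>z. L1 (Qn n P) z \<partial>P')) \<and>
       boot_wp_to_1 \<Omega> S Pn (\<lambda>n P P'. (\<integral>z. L2 (Gs n P P') z \<partial>P') \<le> (\<integral>z. L2 (Gn n P) z \<partial>P'))
       \<longrightarrow> rates) \<and>
      (structured_parameter (cbox 0 \<tau>) \<Q> L1 compQ \<tau>\<^sub>Q A\<^sub>Q nonneg\<^sub>Q CQl CQu \<and>
       structured_parameter (cbox 0 \<tau>) \<G> L2 compG \<tau>\<^sub>G A\<^sub>G nonneg\<^sub>G CGl CGu \<and>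
       wp_to_1 \<Omega> (\<lambda>n \<omega>.
         comp_norm compQ \<tau>\<^sub>Q Q0 \<le> CQn n (Pn n \<omega>) \<and> CQn n (Pn n \<omega>) \<le> CQu \<and>
         comp_norm compG \<tau>\<^sub>G G0 \<le> CGn n (Pn n \<omega>) \<and> CGn n (Pn n \<omega>) \<le> CGu) \<and>
       wp_to_1 \<Omega> (\<lambda>n \<omega>. bounded_mle \<Q> L1 compQ \<tau>\<^sub>Q (Pn n \<omega>) (CQn n (Pn n \<omega>)) (Qn' n \<omega>)) \<and>
       wp_to_1 \<Omega> (\<lambda>n \<omega>. bounded_mle \<G> L2 compG \<tau>\<^sub>G (Pn n \<omega>) (CGn n (Pn n \<omega>)) (Gn' n \<omega>)) \<and>
       boot_wp_to_1 \<Omega> S Pn (\<lambda>n P P'. bounded_boot_mle \<Q> L1 compQ \<tau>\<^sub>Q P' (Qn n P) (Qs n P P')) \<and>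
       boot_wp_to_1 \<Omega> S Pn (\<lambda>n P P'. bounded_boot_mle \<G> L2 compG \<tau>\<^sub>G P' (Gn n P) (Gs n P P'))
       \<longrightarrow> rates)"
proof -
  have boot_iid: "iid_bootstrap \<Omega> S P0 X Xs"
    using prob model iid boot by (auto simp: iid_bootstrap_def iid_bootstrap_axioms_def)
  interpret iid_bootstrap \<Omega> S P0 X Xs by (rule boot_iid)
  let ?mle = "\<lambda>L Qn q0. wp_to_1 \<Omega> (\<lambda>n \<omega>. (\<integral>z. L (Qn n (Pn n \<omega>)) z \<partial>Pn n \<omega>) \<le> (\<integral>z. L q0 z \<partial>Pn n \<omega>))"
  let ?boot = "\<lambda>L Qn Qs. boot_wp_to_1 \<Omega> S Pn (\<lambda>n P P'. (\<integral>z. L (Qs n P P') z \<partial>P') \<le> (\<integral>z. L (Qn n P) z \<partial>P'))"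
  \<comment> \<open>Both parameter sets are thereby nonempty, which lets the joint quantification in
    \<open>cadlag\<close> be used for one loss at a time.\<close>
  have mem: "Q0 \<in> \<Q>" "G0 \<in> \<G>" using model by (auto simp: Q0_def G0_def \<Q>_def \<G>_def)
  have sample_space: "sample n \<omega> \<in> space (samples n S)" if "\<omega> \<in> space \<Omega>" for n \<omega>
    using that by (rule measurable_space[OF sample_measurable])
  have Pn: "Pn n \<omega> = emp S n (sample n \<omega>)" for n \<omega> by (simp add: Pn_def emp_sample)
  have mem_n: "Qn n (Pn n \<omega>) \<in> \<Q>" "Gn n (Pn n \<omega>) \<in> \<G>" if "0 < n" "\<omega> \<in> space \<Omega>" for n \<omega>
    using estimators(1,2) that sample_space[OF that(2), of n] by (auto simp: Pn is_estimator_def)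
  have losses_cadlag: "\<forall>q\<in>\<Q>. \<forall>g\<in>\<G>. cadlag_on \<tau> (L1 q) \<and> cadlag_on \<tau> (L2 g)"
    using cadlag by auto
  have rates_Q: "big_OP \<Omega> (\<lambda>n \<omega>. \<integral>z. L1 (Qs n (Pn n \<omega>) (Ps n \<omega>)) z - L1 (Qn n (Pn n \<omega>)) z \<partial>Pn n \<omega>) (hal_rate \<alpha>) \<and>
      big_OP \<Omega> (\<lambda>n \<omega>. (\<integral>z. L1 (Qs n (Pn n \<omega>) (Ps n \<omega>)) z \<partial>P0) - (\<integral>z. L1 Q0 z \<partial>P0)) (hal_rate \<alpha>)"
    if "?mle L1 Qn Q0" "?boot L1 Qn Qs"
  proof -
    have "\<exists>b. \<forall>z\<in>cbox 0 \<tau>. \<forall>q\<in>\<Q>. \<bar>L1 q z\<bar> \<le> b" using bounded by blast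
    moreover have "\<exists>C. \<forall>q\<in>\<Q>. (\<integral>z. (L1 q z - L1 Q0 z)\<^sup>2 \<partial>P0) \<le> C * ((\<integral>z. L1 q z \<partial>P0) - (\<integral>z. L1 Q0 z \<partial>P0))"
      using quadratic by blast
    moreover have "\<forall>q\<in>\<Q>. cadlag_on \<tau> (L1 q)" using losses_cadlag mem by blast
    moreover have "L1 ` \<Q> \<subseteq> L1 ` \<Q> \<union> L2 ` \<G> \<union> {Dstar q g | q g. q \<in> \<Q> \<and> g \<in> \<G>}" by blast
    ultimately show ?thesis
      using cadlag_hal_rates[OF cube boot_iid[unfolded S_def] \<alpha> entropy[unfolded S_def] _ _ Q0 _ _
          estimators(1)[unfolded S_def] estimators(3)[unfolded S_def] that[unfolded Pn_def S_def]]
      unfolding Pn_def Ps_def S_def by blast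
  qed
  have rates_G: "big_OP \<Omega> (\<lambda>n \<omega>. \<integral>z. L2 (Gs n (Pn n \<omega>) (Ps n \<omega>)) z - L2 (Gn n (Pn n \<omega>)) z \<partial>Pn n \<omega>) (hal_rate \<alpha>) \<and>
      big_OP \<Omega> (\<lambda>n \<omega>. (\<integral>z. L2 (Gs n (Pn n \<omega>) (Ps n \<omega>)) z \<partial>P0) - (\<integral>z. L2 G0 z \<partial>P0)) (hal_rate \<alpha>)"
    if "?mle L2 Gn G0" "?boot L2 Gn Gs"
  proof -
    have "\<exists>b. \<forall>z\<in>cbox 0 \<tau>. \<forall>g\<in>\<G>. \<bar>L2 g z\<bar> \<le> b" using bounded by blast
    moreover have "\<exists>C. \<forall>g\<in>\<G>. (\<integral>z. (L2 g z - L2 G0 z)\<^sup>2 \<partial>P0) \<le> C * ((\<integral>z. L2 g z \<partial>P0) - (\<integral>z. L2 G0 z \<partial>P0))"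
      using quadratic by blast
    moreover have "\<forall>g\<in>\<G>. cadlag_on \<tau> (L2 g)" using losses_cadlag mem by blast
    moreover have "L2 ` \<G> \<subseteq> L1 ` \<Q> \<union> L2 ` \<G> \<union> {Dstar q g | q g. q \<in> \<Q> \<and> g \<in> \<G>}" by blast
    ultimately show ?thesis
      using cadlag_hal_rates[OF cube boot_iid[unfolded S_def] \<alpha> entropy[unfolded S_def] _ _ G0 _ _
          estimators(2)[unfolded S_def] estimators(4)[unfolded S_def] that[unfolded Pn_def S_def]]
      unfolding Pn_def Ps_def S_def by blast
  qed
  \<comment> \<open>With probability tending to 1 the data-adaptive bound dominates the norms of the
    true parameter, which is then a competitor in the constrained minimization; the data-adaptive
    case thus reduces to the risk inequality.\<close>
  have mle_Q: "?mle L1 Qn Q0"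
    if "wp_to_1 \<Omega> (\<lambda>n \<omega>.
         comp_norm compQ \<tau>\<^sub>Q Q0 \<le> CQn n (Pn n \<omega>) \<and> CQn n (Pn n \<omega>) \<le> CQu \<and>
         comp_norm compG \<tau>\<^sub>G G0 \<le> CGn n (Pn n \<omega>) \<and> CGn n (Pn n \<omega>) \<le> CGu)"
      "wp_to_1 \<Omega> (\<lambda>n \<omega>. bounded_mle \<Q> L1 compQ \<tau>\<^sub>Q (Pn n \<omega>) (CQn n (Pn n \<omega>)) (Qn n (Pn n \<omega>)))"
    by (rule wp_to_1_mono[OF wp_to_1_conj[OF that]]) (blast intro: bounded_mle_risk_le mem)
  have boot_Q: "?boot L1 Qn Qs"
    if "boot_wp_to_1 \<Omega> S Pn (\<lambda>n P P'. bounded_boot_mle \<Q> L1 compQ \<tau>\<^sub>Q P' (Qn n P) (Qs n P P'))"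
    by (rule boot_wp_to_1_mono[OF that]) (blast intro: bounded_boot_mle_risk_le mem_n)
  have mle_G: "?mle L2 Gn G0"
    if "wp_to_1 \<Omega> (\<lambda>n \<omega>.
         comp_norm compQ \<tau>\<^sub>Q Q0 \<le> CQn n (Pn n \<omega>) \<and> CQn n (Pn n \<omega>) \<le> CQu \<and>
         comp_norm compG \<tau>\<^sub>G G0 \<le> CGn n (Pn n \<omega>) \<and> CGn n (Pn n \<omega>) \<le> CGu)"
      "wp_to_1 \<Omega> (\<lambda>n \<omega>. bounded_mle \<G> L2 compG \<tau>\<^sub>G (Pn n \<omega>) (CGn n (Pn n \<omega>)) (Gn n (Pn n \<omega>)))"
    by (rule wp_to_1_mono[OF wp_to_1_conj[OF that]]) (blast intro: bounded_mle_risk_le mem)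
  have boot_G: "?boot L2 Gn Gs"
    if "boot_wp_to_1 \<Omega> S Pn (\<lambda>n P P'. bounded_boot_mle \<G> L2 compG \<tau>\<^sub>G P' (Gn n P) (Gs n P P'))"
    by (rule boot_wp_to_1_mono[OF that]) (blast intro: bounded_boot_mle_risk_le mem_n)
  show ?thesis
    unfolding Let_def
    by (intro conjI impI; elim conjE;
        (rule rates_Q[THEN conjunct1] | rule rates_Q[THEN conjunct2] | rule rates_G[THEN conjunct1] | rule rates_G[THEN conjunct2]);
        (assumption | rule mle_Q; assumption | rule mle_G; assumption | rule boot_Q; assumption | rule boot_G; assumption))
qed

end
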